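(* Let $P=\sqrt{-\Delta}$ on $\mathbb{R}^2$. Then for any $\gamma>\frac12$ there exists a constant $C_\gamma$ such that for all $T>0$ and all $f\in H^\gamma(\mathbb{R}^2)$, $$\big\|e^{-itP}f\big\|_{L^2_tL^\infty_{|x|}L^2_\theta([0,T]\times\mathbb{R}^2)}\le C_\gamma\,\big(\ln(2+T)\big)^{1/2}\,\|f\|_{H^\gamma(\mathbb{R}^2)}.$$ Moreover, if $2<q<\infty$, then there is a constant $C_q$ such that for all $f\in\dot H^{\gamma}(\mathbb{R}^2)$ with $\gamma=1-1/q$, $$\big\|e^{-itP}f\big\|_{L^q_tL^\infty_{|x|}L^2_\theta(\mathbb{R}\times\mathbb{R}^2)}\le C_q\,\|f\|_{\dot H^\gamma(\mathbb{R}^2)}.$$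
   Context: $H^\gamma(\mathbb{R}^2)$ and $\dot H^\gamma(\mathbb{R}^2)$ are the usual inhomogeneous and homogeneous $L^2$-based Sobolev spaces, and $e^{-itP}$ is the Fourier multiplier with symbol $e^{-it|\xi|}$. For a time interval $I\subset\mathbb{R}$, $$\|u\|_{L^q_tL^\infty_{|x|}L^2_\theta(I\times\mathbb{R}^2)}=\left(\int_I\operatorname{esssup}_{\rho>0}\Big(\int_0^{2\pi}|u(t,\rho(\cos\theta,\sin\theta))|^2\,d\theta\Big)^{q/2}dt\right)^{1/q}.$$ *)

theory Defs
  imports "HOL-Analysis.Analysis" "HOL-Probability.Essential_Supremum"
begin

section \<open>Schwartz functions and tempered distributions on the plane\<close>

fun iter_partial :: "2 list \<Rightarrow> (real^2 \<Rightarrow> complex) \<Rightarrow> real^2 \<Rightarrow> complex" where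
  "iter_partial [] \<phi> = \<phi>"
| "iter_partial (i # is) \<phi> = (\<lambda>x. frechet_derivative (iter_partial is \<phi>) (at x) (axis i 1))"

text \<open>Total differentiability of all iterated partial derivatives amounts to \<open>C\<^sup>\<infinity>\<close>.\<close>

definition schwartz :: "(real^2 \<Rightarrow> complex) \<Rightarrow> bool" where
  "schwartz \<phi> \<longleftrightarrow>
     (\<forall>is x. iter_partial is \<phi> differentiable (at x)) \<and>
     (\<forall>is (N::nat). bounded (range (\<lambda>x. (1 + norm x) ^ N * norm (iter_partial is \<phi> x))))"

definition schwartz_seminorm :: "nat \<Rightarrow> (real^2 \<Rightarrow> complex) \<Rightarrow> real" where
  "schwartz_seminorm N \<phi> =
     (SUP (is, x) \<in> {is. length is \<le> N} \<times> UNIV. (1 + norm x) ^ N * norm (iter_partial is \<phi> x))"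

text \<open>A distribution is a functional on all functions, but only its values on Schwartz functions
  matter.\<close>

type_synonym distr = "(real^2 \<Rightarrow> complex) \<Rightarrow> complex"

definition tempered_distribution :: "distr \<Rightarrow> bool" where
  "tempered_distribution S \<longleftrightarrow>
     (\<forall>\<phi> \<psi>. schwartz \<phi> \<longrightarrow> schwartz \<psi> \<longrightarrow> S (\<lambda>x. \<phi> x + \<psi> x) = S \<phi> + S \<psi>) \<and>
     (\<forall>c \<phi>. schwartz \<phi> \<longrightarrow> S (\<lambda>x. c * \<phi> x) = c * S \<phi>) \<and>
     (\<exists>C N. \<forall>\<phi>. schwartz \<phi> \<longrightarrow> norm (S \<phi>) \<le> C * schwartz_seminorm N \<phi>)"

text \<open>The distribution \<open>S\<close> is given by integration against the function \<open>g\<close>. Testing with a Gaussian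
  shows that such a \<open>g\<close> is locally integrable, hence it is unique up to null sets.\<close>

definition represented_by :: "distr \<Rightarrow> (real^2 \<Rightarrow> complex) \<Rightarrow> bool" where
  "represented_by S g \<longleftrightarrow>
     g \<in> borel_measurable borel \<and>
     (\<forall>\<phi>. schwartz \<phi> \<longrightarrow> integrable lborel (\<lambda>x. g x * \<phi> x) \<and> S \<phi> = (LINT x|lborel. g x * \<phi> x))"

definition fun_of_distr :: "distr \<Rightarrow> real^2 \<Rightarrow> complex" where
  "fun_of_distr S = (SOME g. represented_by S g)"


section \<open>Fourier transform, Sobolev spaces and Fourier multipliers\<close>

definition fourier :: "(real^2 \<Rightarrow> complex) \<Rightarrow> real^2 \<Rightarrow> complex" where
  "fourier \<phi> \<xi> = (LINT x|lborel. cis (- (x \<bullet> \<xi>)) * \<phi> x)"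

definition inv_fourier :: "(real^2 \<Rightarrow> complex) \<Rightarrow> real^2 \<Rightarrow> complex" where
  "inv_fourier \<phi> x = (LINT \<xi>|lborel. cis (x \<bullet> \<xi>) * \<phi> \<xi>) / complex_of_real ((2 * pi)\<^sup>2)"

definition fourier_distr :: "distr \<Rightarrow> distr" where
  "fourier_distr S = (\<lambda>\<phi>. S (fourier \<phi>))"

definition inv_fourier_distr :: "distr \<Rightarrow> distr" where
  "inv_fourier_distr S = (\<lambda>\<phi>. S (inv_fourier \<phi>))"

text \<open>The weights are \<open>(1 + |\<xi>|\<^sup>2) powr \<gamma>\<close> and \<open>|\<xi>| powr (2 * \<gamma>)\<close>. Finiteness of either weighted
  integral for a locally integrable \<open>g\<close> makes \<open>g\<close> integrable against Schwartz functions (if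
  \<open>\<gamma> \<ge> 0\<close> in the homogeneous case), so \<open>represented_by\<close> demands no more than
  local integrability of the Fourier transform. The homogeneous space is used for \<open>\<gamma> < 1\<close> only
  (half the dimension), where it is a space of tempered distributions, with no quotient by
  polynomials. The factor \<open>(2 * pi)\<^sup>2\<close> makes the norms of order \<open>0\<close> equal to the
  \<open>L\<^sup>2\<close> norm.\<close>

definition sobolev :: "real \<Rightarrow> distr \<Rightarrow> bool" where
  "sobolev \<gamma> f \<longleftrightarrow> tempered_distribution f \<and>
     (\<exists>g. represented_by (fourier_distr f) g \<and>
          integrable lborel (\<lambda>\<xi>. (1 + (norm \<xi>)\<^sup>2) powr \<gamma> * (norm (g \<xi>))\<^sup>2))"

definition sobolev_norm :: "real \<Rightarrow> distr \<Rightarrow> real" where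
  "sobolev_norm \<gamma> f =
     sqrt ((LINT \<xi>|lborel. (1 + (norm \<xi>)\<^sup>2) powr \<gamma> *
              (norm (fun_of_distr (fourier_distr f) \<xi>))\<^sup>2) / (2 * pi)\<^sup>2)"

definition hom_sobolev :: "real \<Rightarrow> distr \<Rightarrow> bool" where
  "hom_sobolev \<gamma> f \<longleftrightarrow> tempered_distribution f \<and>
     (\<exists>g. represented_by (fourier_distr f) g \<and>
          integrable lborel (\<lambda>\<xi>. norm \<xi> powr (2 * \<gamma>) * (norm (g \<xi>))\<^sup>2))"

definition hom_sobolev_norm :: "real \<Rightarrow> distr \<Rightarrow> real" where
  "hom_sobolev_norm \<gamma> f =
     sqrt ((LINT \<xi>|lborel. norm \<xi> powr (2 * \<gamma>) *
              (norm (fun_of_distr (fourier_distr f) \<xi>))\<^sup>2) / (2 * pi)\<^sup>2)"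

definition fourier_multiplier :: "(real^2 \<Rightarrow> complex) \<Rightarrow> distr \<Rightarrow> distr" where
  "fourier_multiplier m f =
     inv_fourier_distr (\<lambda>\<phi>. LINT \<xi>|lborel. m \<xi> * fun_of_distr (fourier_distr f) \<xi> * \<phi> \<xi>)"

text \<open>\<open>e\<^sup>-\<^sup>i\<^sup>t\<^sup>P f\<close> with \<open>P = sqrt (- \<Delta>)\<close>, as a distribution and as a function.\<close>

definition half_wave :: "real \<Rightarrow> distr \<Rightarrow> distr" where
  "half_wave t f = fourier_multiplier (\<lambda>\<xi>. cis (- t * norm \<xi>)) f"

definition half_wave_fun :: "distr \<Rightarrow> real \<Rightarrow> real^2 \<Rightarrow> complex" where
  "half_wave_fun f t = fun_of_distr (half_wave t f)"


section \<open>The mixed norm\<close>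

definition ennpowr :: "ennreal \<Rightarrow> real \<Rightarrow> ennreal" where
  "ennpowr x p = (if x = top then top else ennreal (enn2real x powr p))" \<comment> \<open>for \<open>p > 0\<close>\<close>

text \<open>Changing \<open>u t\<close> on a null set changes the angular integral only for a null set of radii, so
  the essential supremum depends only on the almost-everywhere class of \<open>u t\<close>.\<close>

definition mixed_norm :: "real \<Rightarrow> real set \<Rightarrow> (real \<Rightarrow> real^2 \<Rightarrow> complex) \<Rightarrow> ennreal" where
  "mixed_norm q I u =
     ennpowr
       (\<integral>\<^sup>+t\<in>I.
          ennpowr
            (esssup (restrict_space lborel {0<..})
               (\<lambda>\<rho>. \<integral>\<^sup>+\<theta>\<in>{0..2*pi}.
                  ennreal ((norm (u t (vector [\<rho> * cos \<theta>, \<rho> * sin \<theta>])))\<^sup>2) \<partial>lborel))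
            (q / 2)
        \<partial>lborel)
       (1 / q)"

end

theory Submission
  imports Defs "HOL-Probability.Characteristic_Functions" "HOL-Probability.Sinc_Integral"
begin

text \<open>
Both estimates are energy estimates on dyadic annuli in physical space, summed over dyadic bands of
frequencies.  Let \<open>g\<close> be the Fourier transform of the data, cut off to \<open>|\<xi>| \<le> N\<close>, let \<open>E\<close> be the
integral of \<open>|g|\<^sup>2\<close>, and let \<open>u(t, x)\<close> be the integral of \<open>cis (x \<bullet> \<xi> - t |\<xi>|) g(\<xi>)\<close> over \<open>\<xi>\<close>.
In an annulus \<open>R \<le> |x| \<le> 2 R\<close> with \<open>R \<ge> 1/N\<close>, the one-dimensional Sobolev inequality along each ray
bounds the square mean of \<open>u(t)\<close> over every circle, simultaneously for all radii, by the integral of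
\<open>2 N |u|\<^sup>2 + |\<nabla>u|\<^sup>2 / N\<close> over \<open>\<theta>\<close> and \<open>r\<close> (\<open>sobolev_wave_line\<close>, \<open>circle_le_shell\<close>).  Since
\<open>dr d\<theta> = dx / |x|\<close>, two classical facts estimate this integral.

Plancherel at a fixed time (\<open>wave_energy\<close>) gives the bound \<open>C N E / R\<close>.  The smoothing effect
(\<open>local_smoothing\<close>) says that the integral of \<open>|u|\<^sup>2\<close> over all times and \<open>|x| \<le> b\<close> is at most
\<open>C b E\<close>; hence the integral over time of the annulus energy is at most \<open>C N E\<close>, whatever \<open>R\<close> is.
The smoothing effect itself is Plancherel in one space variable and time: where \<open>|\<xi>\<^sub>1| \<le> |\<xi>\<^sub>2|\<close>, the
map \<open>\<xi> \<mapsto> (\<xi>\<^sub>1, |\<xi>|)\<close> is injective on each of the two components and has Jacobian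
\<open>|\<xi>\<^sub>2| / |\<xi>| \<ge> 1 / sqrt 2\<close>, so for each fixed \<open>x\<^sub>2\<close> the square integral of \<open>u\<close> over \<open>x\<^sub>1\<close> and \<open>t\<close> is
at most \<open>C E\<close> (\<open>plancherel_cone\<close>, \<open>wave_cone_slice\<close>).  All Plancherel inequalities are instances
of one Schur test (\<open>plancherel_phases\<close>).

For \<open>t \<le> T\<close> about \<open>log (2 + N T)\<close> annuli have to be counted with the second bound, the outer ones
being controlled by the first: this is the logarithm (\<open>env_L2\<close>).  For \<open>q > 2\<close> the interpolation of
the two bounds makes the sum over the annuli geometric (\<open>env_Lp\<close>).  In the first estimate the
frequency bands are summed by the Cauchy-Schwarz inequality with weights \<open>2 powr (\<eta> |j|)\<close>, which
\<open>\<gamma> > 1/2\<close> pays for.  In the second there is no room for weights; a pointwise interpolation in the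
manner of Hedberg bounds the \<open>q\<close>-th power of the sum by a sum of \<open>q\<^sub>1\<close>-th powers with
\<open>2 < q\<^sub>1 < q\<close> (\<open>hedberg_interpolation\<close>), and each of these is controlled by \<open>env_Lp\<close>.

It remains to connect these integrals with the distributions in the statement.  The dyadic waves sum
up, for every time, to a function that represents the half-wave distribution
(\<open>half_wave_represented\<close>), and a representing function is unique up to null sets since Gaussians are
Schwartz functions (\<open>represented_by_unique\<close>).  So the function chosen by Hilbert's choice operator
agrees on almost every circle with that sum.
\<close>

section \<open>Lebesgue measure on the plane\<close>

abbreviation nsq :: "complex \<Rightarrow> ennreal" where
  "nsq z \<equiv> ennreal ((norm z)\<^sup>2)"

abbreviation pt :: "real \<Rightarrow> real \<Rightarrow> real^2" where
  "pt a b \<equiv> vector [a, b]"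

lemma pt_components: "pt (x $ 1) (x $ 2) = x"
  by (simp add: vec_eq_iff forall_2)

lemma pt_eq_axis: "pt a b = a *\<^sub>R axis 1 1 + b *\<^sub>R axis 2 1"
  by (simp add: vec_eq_iff forall_2 axis_def)

lemma measurable_pt [measurable]:
  assumes [measurable]: "f \<in> borel_measurable M" "g \<in> borel_measurable M"
  shows "(\<lambda>x. pt (f x) (g x)) \<in> borel_measurable M"
  unfolding pt_eq_axis by measurable

lemma measurable_vec_nth [measurable]: "(\<lambda>x::real^2. x $ i) \<in> borel_measurable borel"
  by (intro borel_measurable_continuous_onI continuous_intros)

lemma inner_pt: "x \<bullet> y = x $ 1 * y $ 1 + x $ 2 * y $ 2" for x y :: "real^2"
  by (simp add: inner_vec_def sum_2)

lemma norm_pt: "norm x = sqrt ((x $ 1)\<^sup>2 + (x $ 2)\<^sup>2)" for x :: "real^2"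
  by (simp add: norm_vec_def L2_set_def sum_2)

lemma Basis_real2: "Basis = {axis 1 1, axis 2 (1::real) :: real^2}"
  by (auto simp: Basis_vec_def UNIV_2)

lemma lborel_real2: "lborel = distr (lborel \<Otimes>\<^sub>M lborel) borel (\<lambda>(a, b). pt a b)"
proof (rule lborel_eqI)
  fix l u :: "real^2"
  assume le: "\<And>b. b \<in> Basis \<Longrightarrow> l \<bullet> b \<le> u \<bullet> b"
  have l1: "l $ 1 \<le> u $ 1" and l2: "l $ 2 \<le> u $ 2"
    using le[of "axis 1 1"] le[of "axis 2 1"] by (auto simp: Basis_real2 inner_axis)
  have vi: "(\<lambda>(a, b). pt a b) -` box l u = {l $ 1 <..< u $ 1} \<times> {l $ 2 <..< u $ 2}"
    by (auto simp: mem_box Basis_real2 inner_axis)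
  have "emeasure (distr (lborel \<Otimes>\<^sub>M lborel) borel (\<lambda>(a, b). pt a b)) (box l u)
      = emeasure (lborel \<Otimes>\<^sub>M lborel) ({l $ 1 <..< u $ 1} \<times> {l $ 2 <..< u $ 2})"
    by (subst emeasure_distr) (auto simp: vi space_pair_measure)
  also have "\<dots> = ennreal ((u $ 1 - l $ 1) * (u $ 2 - l $ 2))"
    using l1 l2 by (subst lborel.emeasure_pair_measure_Times) (auto simp: ennreal_mult)
  also have "(u $ 1 - l $ 1) * (u $ 2 - l $ 2) = (\<Prod>b\<in>Basis. (u - l) \<bullet> b)"
    by (simp add: Basis_real2 inner_axis axis_eq_axis)
  finally show "emeasure (distr (lborel \<Otimes>\<^sub>M lborel) borel (\<lambda>(a, b). pt a b)) (box l u)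
      = ennreal (\<Prod>b\<in>Basis. (u - l) \<bullet> b)" .
qed simp

lemma nn_integral_real2:
  assumes [measurable]: "f \<in> borel_measurable borel"
  shows "(\<integral>\<^sup>+x. f x \<partial>lborel) = (\<integral>\<^sup>+a. \<integral>\<^sup>+b. f (pt a b) \<partial>lborel \<partial>lborel)"
  by (subst lborel_real2, subst nn_integral_distr)
     (auto simp: lborel.nn_integral_fst[symmetric] split_beta')

lemma nn_integral_real2_swap:
  assumes [measurable]: "f \<in> borel_measurable borel"
  shows "(\<integral>\<^sup>+x. f x \<partial>lborel) = (\<integral>\<^sup>+b. \<integral>\<^sup>+a. f (pt a b) \<partial>lborel \<partial>lborel)"
  unfolding nn_integral_real2[OF assms] by (rule lborel_pair.Fubini') measurable

lemma nn_integral_uminus_real: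
  assumes [measurable]: "f \<in> borel_measurable borel"
  shows "(\<integral>\<^sup>+x. f (- x) \<partial>lborel) = (\<integral>\<^sup>+x. f (x::real) \<partial>lborel)"
  using nn_integral_real_affine[of f "-1" 0] by simp

lemma nn_integral_rotate:
  fixes f :: "real^2 \<Rightarrow> ennreal"
  assumes [measurable]: "f \<in> borel_measurable borel"
  shows "(\<integral>\<^sup>+x. f (pt (- x $ 2) ((x::real^2) $ 1)) \<partial>lborel) = (\<integral>\<^sup>+x. f x \<partial>lborel)"
proof -
  have "(\<integral>\<^sup>+x. f (pt (- x $ 2) ((x::real^2) $ 1)) \<partial>lborel) = (\<integral>\<^sup>+a. \<integral>\<^sup>+b. f (pt (- b) a) \<partial>lborel \<partial>lborel)"
    by (subst nn_integral_real2) auto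
  also have "\<dots> = (\<integral>\<^sup>+a. \<integral>\<^sup>+b. f (pt b a) \<partial>lborel \<partial>lborel)"
    by (intro nn_integral_cong nn_integral_uminus_real[of "\<lambda>b. f (pt b _)"]) auto
  also have "\<dots> = (\<integral>\<^sup>+x. f x \<partial>lborel)"
    by (subst nn_integral_real2_swap) auto
  finally show ?thesis .
qed

text \<open>In this sector \<open>x = r cos \<theta>\<close> and \<open>y = x tan \<theta>\<close> with a bounded tangent, so that polar
coordinates are two successive one-dimensional substitutions.\<close>

lemma nn_integral_sector_le:
  fixes f :: "real^2 \<Rightarrow> ennreal"
  assumes [measurable]: "f \<in> borel_measurable borel"
  shows "(\<integral>\<^sup>+\<theta>\<in>{-(pi/4)..pi/4}. \<integral>\<^sup>+r\<in>{0<..}. f (pt (r * cos \<theta>) (r * sin \<theta>)) * ennreal r \<partial>lborel \<partial>lborel)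
    \<le> (\<integral>\<^sup>+x. f x \<partial>lborel)"
proof -
  have cp: "cos \<theta> > 0" if "\<theta> \<in> {-(pi/4)..pi/4}" for \<theta>
    using that pi_gt_zero by (intro cos_gt_zero_pi; simp; linarith)
  \<comment> \<open>Substitute \<open>x = r cos \<theta>\<close>; the factor \<open>1 / (cos \<theta>)\<^sup>2\<close> is the derivative of the tangent.\<close>
  have 1: "(\<integral>\<^sup>+r\<in>{0<..}. f (pt (r * cos \<theta>) (r * sin \<theta>)) * ennreal r \<partial>lborel)
      = (\<integral>\<^sup>+x\<in>{0<..}. f (pt x (x * tan \<theta>)) * ennreal (x / (cos \<theta>)\<^sup>2) \<partial>lborel)" (is "?L = ?R")
    if th: "\<theta> \<in> {-(pi/4)..pi/4}" for \<theta>
  proof -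
    have c: "cos \<theta> > 0" using cp[OF th] .
    have "?R = ennreal \<bar>cos \<theta>\<bar> * (\<integral>\<^sup>+x. f (pt (0 + cos \<theta> * x) ((0 + cos \<theta> * x) * tan \<theta>))
        * ennreal ((0 + cos \<theta> * x) / (cos \<theta>)\<^sup>2) * indicator {0<..} (0 + cos \<theta> * x) \<partial>lborel)"
      using c by (subst nn_integral_real_affine[of _ "cos \<theta>" 0]) auto
    also have "\<dots> = (\<integral>\<^sup>+x. ennreal (cos \<theta>) * (f (pt (x * cos \<theta>) (x * sin \<theta>)) * ennreal (x / (cos \<theta>))
        * indicator {0<..} x) \<partial>lborel)"
      using c by (subst nn_integral_cmult[symmetric])
        (auto intro!: nn_integral_cong split: split_indicator simp: tan_def power2_eq_square ac_simps
            zero_less_mult_iff)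
    also have "\<dots> = ?L"
    proof (intro nn_integral_cong)
      fix x :: real
      have "ennreal (cos \<theta>) * ennreal (x / cos \<theta>) = ennreal x"
        using c by (subst ennreal_mult'[symmetric]) auto
      then show "ennreal (cos \<theta>) * (f (pt (x * cos \<theta>) (x * sin \<theta>)) * ennreal (x / cos \<theta>) * indicator {0<..} x)
          = f (pt (x * cos \<theta>) (x * sin \<theta>)) * ennreal x * indicator {0<..} x"
        by (metis (no_types, opaque_lifting) mult.assoc mult.left_commute)
    qed
    finally show ?thesis ..
  qed
  have "(\<integral>\<^sup>+\<theta>\<in>{-(pi/4)..pi/4}. \<integral>\<^sup>+r\<in>{0<..}. f (pt (r * cos \<theta>) (r * sin \<theta>)) * ennreal r \<partial>lborel \<partial>lborel)
     = (\<integral>\<^sup>+\<theta>\<in>{-(pi/4)..pi/4}. \<integral>\<^sup>+x\<in>{0<..}. f (pt x (x * tan \<theta>)) * ennreal (x / (cos \<theta>)\<^sup>2) \<partial>lborel \<partial>lborel)"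
    by (intro nn_integral_cong) (auto split: split_indicator simp: 1)
  also have "\<dots> = (\<integral>\<^sup>+\<theta>. \<integral>\<^sup>+x. f (pt x (x * tan \<theta>)) * ennreal (x / (cos \<theta>)\<^sup>2) * indicator {0<..} x
      * indicator {-(pi/4)..pi/4} \<theta> \<partial>lborel \<partial>lborel)"
    unfolding tan_def by (intro nn_integral_cong nn_integral_multc[symmetric]) measurable
  also have "\<dots> = (\<integral>\<^sup>+x. \<integral>\<^sup>+\<theta>. f (pt x (x * tan \<theta>)) * ennreal (x / (cos \<theta>)\<^sup>2) * indicator {0<..} x
      * indicator {-(pi/4)..pi/4} \<theta> \<partial>lborel \<partial>lborel)"
    unfolding tan_def by (rule lborel_pair.Fubini') measurable
  also have "\<dots> \<le> (\<integral>\<^sup>+x. \<integral>\<^sup>+y. f (pt x y) \<partial>lborel \<partial>lborel)"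
  proof (rule nn_integral_mono)
    fix x :: real
    show "(\<integral>\<^sup>+\<theta>. f (pt x (x * tan \<theta>)) * ennreal (x / (cos \<theta>)\<^sup>2) * indicator {0<..} x
        * indicator {-(pi/4)..pi/4} \<theta> \<partial>lborel)
       \<le> (\<integral>\<^sup>+y. f (pt x y) \<partial>lborel)"
    proof (cases "x > 0")
      case True
      have "(\<integral>\<^sup>+y. f (pt x y) * indicator {x * tan (-(pi/4))..x * tan (pi/4)} y \<partial>lborel) =
         (\<integral>\<^sup>+\<theta>. f (pt x (x * tan \<theta>)) * ennreal (x / (cos \<theta>)\<^sup>2) * indicator {-(pi/4)..pi/4} \<theta> \<partial>lborel)"
      proof (rule nn_integral_substitution_aux)
        show "((\<lambda>a. x * tan a) has_real_derivative x / (cos a)\<^sup>2) (at a)" if "a \<in> {- (pi / 4)..pi / 4}" for a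
          using cp[OF that] by (auto intro!: derivative_eq_intros simp: divide_inverse)
        show "continuous_on {- (pi / 4)..pi / 4} (\<lambda>a. x / (cos a)\<^sup>2)"
          using cp by (intro continuous_intros) (auto simp: less_le)
      qed (use True in auto)
      moreover have "(\<integral>\<^sup>+y. f (pt x y) * indicator {x * tan (-(pi/4))..x * tan (pi/4)} y \<partial>lborel)
          \<le> (\<integral>\<^sup>+y. f (pt x y) \<partial>lborel)"
        by (intro nn_integral_mono) (auto split: split_indicator)
      ultimately show ?thesis using True by simp
    qed simp
  qed
  also have "\<dots> = (\<integral>\<^sup>+x. f x \<partial>lborel)"
    by (rule nn_integral_real2[symmetric]) measurable
  finally show ?thesis .
qed

text \<open>An upper bound suffices for all later purposes, so the angles may be covered with overlaps:
five quarter turns of the sector contain the interval from \<open>0\<close> to \<open>2 * pi\<close>.\<close>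

lemma nn_integral_polar_le:
  fixes f :: "real^2 \<Rightarrow> ennreal"
  assumes [measurable]: "f \<in> borel_measurable borel"
  shows "(\<integral>\<^sup>+\<theta>\<in>{0..2*pi}. \<integral>\<^sup>+r\<in>{0<..}. f (pt (r * cos \<theta>) (r * sin \<theta>)) * ennreal r \<partial>lborel \<partial>lborel)
    \<le> 5 * (\<integral>\<^sup>+x. f x \<partial>lborel)"
proof -
  define A :: "(real^2 \<Rightarrow> ennreal) \<Rightarrow> real \<Rightarrow> ennreal" where
    "A = (\<lambda>h \<theta>. \<integral>\<^sup>+r\<in>{0<..}. h (pt (r * cos \<theta>) (r * sin \<theta>)) * ennreal r \<partial>lborel)"
  have mA [measurable]: "A h \<in> borel_measurable borel" if [measurable]: "h \<in> borel_measurable borel" for h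
    unfolding A_def by measurable
  have step: "(\<integral>\<^sup>+\<theta>\<in>{real k * (pi/2) - pi/4..real k * (pi/2) + pi/4}. A h \<theta> \<partial>lborel) \<le> (\<integral>\<^sup>+x. h x \<partial>lborel)"
    if "h \<in> borel_measurable borel" for h k
    using that
  proof (induction k arbitrary: h)
    case 0
    then show ?case using nn_integral_sector_le[of h] by (simp add: A_def)
  next
    case (Suc k)
    have [measurable]: "h \<in> borel_measurable borel" by fact
    let ?h = "\<lambda>x::real^2. h (pt (- x $ 2) (x $ 1))"
    have "(\<integral>\<^sup>+\<theta>. A h \<theta> * indicator {real (Suc k) * (pi/2) - pi/4..real (Suc k) * (pi/2) + pi/4} \<theta> \<partial>lborel)
        = (\<integral>\<^sup>+\<theta>. A h (pi/2 + \<theta>) * indicator {real (Suc k) * (pi/2) - pi/4..real (Suc k) * (pi/2)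
          + pi/4} (pi/2 + \<theta>) \<partial>lborel)"
      using nn_integral_real_affine[of "\<lambda>\<theta>. A h \<theta> * indicator {real (Suc k) * (pi/2) - pi/4..real (Suc k)
          * (pi/2) + pi/4} \<theta>" 1 "pi/2"]
      by simp
    also have "\<dots> = (\<integral>\<^sup>+\<theta>. A ?h \<theta> * indicator {real k * (pi/2) - pi/4..real k * (pi/2) + pi/4} \<theta> \<partial>lborel)"
      proof (rule nn_integral_cong)
      fix \<theta> :: real
      have "A h (pi/2 + \<theta>) = A ?h \<theta>"
        by (simp add: A_def cos_add sin_add)
      moreover have "pi/2 + \<theta> \<in> {real (Suc k) * (pi/2) - pi/4..real (Suc k) * (pi/2) + pi/4}
          \<longleftrightarrow> \<theta> \<in> {real k * (pi/2) - pi/4..real k * (pi/2) + pi/4}"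
        using distrib_right[of 1 "real k" "pi/2"] by (auto simp: add.commute simp del: times_divide_eq_right)
      ultimately show "A h (pi/2 + \<theta>) * indicator {real (Suc k) * (pi/2) - pi/4..real (Suc k) * (pi/2)
          + pi/4} (pi/2 + \<theta>)
          = A ?h \<theta> * indicator {real k * (pi/2) - pi/4..real k * (pi/2) + pi/4} \<theta>"
        by (simp add: indicator_def)
    qed
    also have "\<dots> \<le> (\<integral>\<^sup>+x. ?h x \<partial>lborel)"
      by (rule Suc.IH) measurable
    also have "\<dots> = (\<integral>\<^sup>+x. h x \<partial>lborel)"
      by (rule nn_integral_rotate) measurable
    finally show ?case .
  qed
  have cover: "\<exists>k<5. \<theta> \<in> {real k * (pi/2) - pi/4..real k * (pi/2) + pi/4}" if "\<theta> \<in> {0..2*pi}" for \<theta>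
  proof -
    have "\<theta> \<le> pi/4 \<or> (pi/4 \<le> \<theta> \<and> \<theta> \<le> 3*pi/4) \<or> (3*pi/4 \<le> \<theta> \<and> \<theta> \<le> 5*pi/4) \<or> (5*pi/4 \<le> \<theta> \<and> \<theta>
        \<le> 7*pi/4) \<or> 7*pi/4 \<le> \<theta>"
      by auto
    then show ?thesis
      using that pi_gt_zero
      apply (elim disjE)
      subgoal by (intro exI[of _ 0]) auto
      subgoal by (intro exI[of _ 1]) (auto simp: field_simps)
      subgoal by (intro exI[of _ 2]) (auto simp: field_simps)
      subgoal by (intro exI[of _ 3]) (auto simp: field_simps)
      subgoal by (intro exI[of _ 4]) (auto simp: field_simps)
      done
  qed
  have "(\<integral>\<^sup>+\<theta>\<in>{0..2*pi}. A f \<theta> \<partial>lborel)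
     \<le> (\<integral>\<^sup>+\<theta>. (\<Sum>k<5. A f \<theta> * indicator {real k * (pi/2) - pi/4..real k * (pi/2) + pi/4} \<theta>) \<partial>lborel)"
  proof (rule nn_integral_mono)
    fix \<theta> :: real
    show "A f \<theta> * indicator {0..2*pi} \<theta>
       \<le> (\<Sum>k<5. A f \<theta> * indicator {real k * (pi/2) - pi/4..real k * (pi/2) + pi/4} \<theta>)"
    proof (cases "\<theta> \<in> {0..2*pi}")
      case True
      from cover[OF True] obtain k :: nat where k: "k < 5" "\<theta> \<in> {real k * (pi/2) - pi/4..real k * (pi/2)
          + pi/4}" by auto
      have "A f \<theta> * indicator {real k * (pi/2) - pi/4..real k * (pi/2) + pi/4} \<theta>
         \<le> (\<Sum>k<5. A f \<theta> * indicator {real k * (pi/2) - pi/4..real k * (pi/2) + pi/4} \<theta>)"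
        using k(1) by (intro member_le_sum) auto
      then show ?thesis using True k(2) by simp
    qed simp
  qed
  also have "\<dots> = (\<Sum>k<5. \<integral>\<^sup>+\<theta>. A f \<theta> * indicator {real k * (pi/2) - pi/4..real k * (pi/2) + pi/4} \<theta> \<partial>lborel)"
    by (rule nn_integral_sum) measurable
  also have "\<dots> \<le> (\<Sum>k<(5::nat). \<integral>\<^sup>+x. f x \<partial>lborel)"
    by (intro sum_mono step) measurable
  finally show ?thesis by (simp add: A_def)
qed

section \<open>Plancherel inequalities from Schur's test\<close>

lemma measurable_cis [measurable]: "cis \<in> borel_measurable borel"
  by (intro borel_measurable_continuous_onI continuous_intros)

lemma measurable_cnj [measurable]: "cnj \<in> borel_measurable borel"
  by (intro borel_measurable_continuous_onI continuous_intros)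

lemma ennreal_halves: "x / 2 + x / 2 = (x::ennreal)"
proof -
  have "x / 2 + x / 2 = 2 * (x / 2)" by (simp only: mult_2)
  also have "\<dots> = x * (2 / 2)" by (simp only: ennreal_times_divide mult.commute)
  also have "(2::ennreal) / 2 = 1" by (rule ennreal_divide_self) auto
  finally show ?thesis by simp
qed

lemma integrable_times_pair:
  fixes f :: "'a::euclidean_space \<Rightarrow> complex" and g :: "'b::euclidean_space \<Rightarrow> complex"
  assumes f: "integrable lborel f" and g: "integrable lborel g"
  shows "integrable (lborel \<Otimes>\<^sub>M lborel) (\<lambda>(x, y). f x * g y)"
proof -
  have [measurable]: "f \<in> borel_measurable borel" "g \<in> borel_measurable borel"
    using f g by auto
  show ?thesis
    by (rule lborel_pair.Fubini_integrable) (use f g in \<open>auto simp: norm_mult\<close>)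
qed

definition gauss_weight :: "real \<Rightarrow> real \<Rightarrow> real" where
  "gauss_weight n y = exp (- (y / n)\<^sup>2 / 2)"

text \<open>The Fourier transform of \<open>gauss_weight n\<close>: an approximate identity of mass \<open>2 * pi\<close>.\<close>

definition gauss_kernel :: "real \<Rightarrow> real \<Rightarrow> real" where
  "gauss_kernel n \<alpha> = 2 * pi * normal_density 0 (1 / n) \<alpha>"

lemma measurable_gauss [measurable]:
  "gauss_weight n \<in> borel_measurable borel" "gauss_kernel n \<in> borel_measurable borel"
  unfolding gauss_weight_def gauss_kernel_def by measurable

lemma gauss_kernel_nonneg: "0 \<le> gauss_kernel n \<alpha>"
  by (simp add: gauss_kernel_def)

lemma gauss_kernel_minus [simp]: "gauss_kernel n (- \<alpha>) = gauss_kernel n \<alpha>"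
  by (simp add: gauss_kernel_def normal_density_def)

lemma gauss_kernel_commute: "gauss_kernel n (\<alpha> - \<beta>) = gauss_kernel n (\<beta> - \<alpha>)"
  by (metis gauss_kernel_minus minus_diff_eq)

lemma nn_integral_gauss_kernel: "0 < n \<Longrightarrow> (\<integral>\<^sup>+\<alpha>. ennreal (gauss_kernel n \<alpha>) \<partial>lborel) = ennreal (2 * pi)"
  by (subst nn_integral_eq_integral) (auto simp: gauss_kernel_def[abs_def])

lemma gauss_weight_eq:
  assumes "0 < n"
  shows "gauss_weight n y = sqrt (2 * pi) * std_normal_density (y / n)"
  by (simp add: gauss_weight_def std_normal_density_def)

lemma integrable_gauss_weight: "0 < n \<Longrightarrow> integrable lborel (gauss_weight n)"
  using lborel_integrable_real_affine[of "std_normal_density" "1/n" 0]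
  by (simp add: gauss_weight_eq cong: Bochner_Integration.integrable_cong)

lemma fourier_gauss_weight:
  assumes n: "0 < n"
  shows "(LINT y|lborel. cis (y * \<alpha>) * complex_of_real (gauss_weight n y)) = complex_of_real (gauss_kernel n \<alpha>)"
proof -
  have "(LINT y|lborel. cis (y * \<alpha>) * complex_of_real (gauss_weight n y))
      = \<bar>n\<bar> *\<^sub>R (LINT y|lborel. cis ((0 + n * y) * \<alpha>) * complex_of_real (gauss_weight n (0 + n * y)))"
    using n by (intro lborel_integral_real_affine) auto
  also have "(LINT y|lborel. cis ((0 + n * y) * \<alpha>) * complex_of_real (gauss_weight n (0 + n * y)))
      = (LINT y|lborel. complex_of_real (sqrt (2*pi)) * (std_normal_density y *\<^sub>R iexp (n * \<alpha> * y)))"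
    using n by (intro Bochner_Integration.integral_cong)
        (auto simp: gauss_weight_eq cis_conv_exp scaleR_conv_of_real ac_simps)
  also have "\<dots> = complex_of_real (sqrt (2*pi)) * (LINT y|lborel. std_normal_density y *\<^sub>R iexp (n * \<alpha> * y))"
    by (rule integral_mult_right_zero)
  also have "(LINT y|lborel. std_normal_density y *\<^sub>R iexp (n * \<alpha> * y)) = char std_normal_distribution (n * \<alpha>)"
    unfolding char_def by (subst integral_density) auto
  also have "\<dots> = exp (- ((n * \<alpha>)\<^sup>2) / 2)"
    by (simp add: char_std_normal_distribution)
  finally show ?thesis
    using n by (simp add: gauss_kernel_def normal_density_def scaleR_conv_of_real real_sqrt_divide
        real_sqrt_mult power_mult_distrib
       field_simps flip: of_real_exp of_real_mult)
qed

text \<open>The Gaussian weight makes the integrals over \<open>z\<close> and over two frequencies interchangeable.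
The inner integral over \<open>z\<close> is then the nonnegative kernel
\<open>gauss_kernel n (p \<xi> - p \<xi>') * gauss_kernel n (q \<xi> - q \<xi>')\<close>, whose row integrals are at most \<open>B\<close>;
a symmetric kernel with this property has norm at most \<open>B\<close> on square integrable functions.\<close>

lemma plancherel_phases_cutoff:
  fixes p q :: "real^2 \<Rightarrow> real" and a :: "real^2 \<Rightarrow> complex"
  assumes [measurable]: "p \<in> borel_measurable borel" "q \<in> borel_measurable borel" "S \<in> sets borel"
    and a: "integrable lborel a" and supp: "\<And>\<xi>. \<xi> \<notin> S \<Longrightarrow> a \<xi> = 0"
    and n: "0 < n"
    and B: "\<And>\<alpha> \<beta>. (\<integral>\<^sup>+\<xi>\<in>S. ennreal (gauss_kernel n (\<alpha> - p \<xi>) * gauss_kernel n (\<beta> - q \<xi>)) \<partial>lborel) \<le> B"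
  shows "(\<integral>\<^sup>+z. ennreal (gauss_weight n (fst z) * gauss_weight n (snd z) *
             (norm (LINT \<xi>|lborel. cis (fst z * p \<xi> + snd z * q \<xi>) * a \<xi>))\<^sup>2) \<partial>lborel)
    \<le> B * (\<integral>\<^sup>+\<xi>. nsq (a \<xi>) \<partial>lborel)"
proof -
  have [measurable]: "a \<in> borel_measurable borel" using a by auto
  let ?W = "\<lambda>z::real\<times>real. gauss_weight n (fst z) * gauss_weight n (snd z)"
  let ?K = "\<lambda>\<zeta>::(real^2)\<times>(real^2). gauss_kernel n (p (fst \<zeta>) - p (snd \<zeta>))
      * gauss_kernel n (q (fst \<zeta>) - q (snd \<zeta>))"
  define v where "v = (\<lambda>z::real\<times>real. LINT \<xi>|lborel. cis (fst z * p \<xi> + snd z * q \<xi>) * a \<xi>)"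
  define A where "A = (\<lambda>\<zeta>::(real^2)\<times>(real^2). a (fst \<zeta>) * cnj (a (snd \<zeta>)))"
  define e where "e = (\<lambda>(z::real\<times>real) (\<zeta>::(real^2)\<times>(real^2)).
     cis (fst z * (p (fst \<zeta>) - p (snd \<zeta>))) * cis (snd z * (q (fst \<zeta>) - q (snd \<zeta>))))"
  have "v \<in> borel_measurable (borel \<Otimes>\<^sub>M borel)" "A \<in> borel_measurable (borel \<Otimes>\<^sub>M borel)"
    unfolding v_def A_def by measurable
  then have [measurable]: "v \<in> borel_measurable borel" "A \<in> borel_measurable borel"
    by (simp_all only: borel_prod)
  have "integrable (lborel \<Otimes>\<^sub>M lborel)
      (\<lambda>(x, y). complex_of_real (gauss_weight n x) * complex_of_real (gauss_weight n y))"
    by (intro integrable_times_pair integrable_of_real integrable_gauss_weight n)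
  then have iWc: "integrable lborel (\<lambda>z. complex_of_real (?W z))"
    by (simp only: lborel_prod split_beta' of_real_mult)
  then have iW: "integrable lborel ?W"
    by (simp only: complex_of_real_integrable_eq)
  have iA: "integrable lborel A"
    using integrable_times_pair[of a "\<lambda>x. cnj (a x)"] a
    by (simp add: lborel_prod split_beta' A_def)
  have [measurable]: "fst \<in> borel_measurable (borel :: (real \<times> real) measure)"
    "snd \<in> borel_measurable (borel :: (real \<times> real) measure)"
    "fst \<in> borel_measurable (borel :: ((real^2) \<times> (real^2)) measure)"
    "snd \<in> borel_measurable (borel :: ((real^2) \<times> (real^2)) measure)"
    by (auto intro!: borel_measurable_continuous_onI continuous_intros)
  have ne: "norm (e z \<zeta>) = 1" for z \<zeta> by (simp add: e_def norm_mult)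
  \<comment> \<open>The square of an integral is a double integral; this produces the two frequencies.\<close>
  have vv: "complex_of_real ((norm (v z))\<^sup>2) = (LINT \<zeta>|lborel. e z \<zeta> * A \<zeta>)" for z
  proof -
    let ?f = "\<lambda>\<xi>. cis (fst z * p \<xi> + snd z * q \<xi>) * a \<xi>"
    have i: "integrable lborel ?f"
      by (rule Bochner_Integration.integrable_bound[OF a]) (auto simp: norm_mult)
    have "complex_of_real ((norm (v z))\<^sup>2) = v z * cnj (v z)"
      by (rule complex_norm_square)
    also have "\<dots> = (LINT \<xi>|lborel. LINT \<xi>'|lborel. ?f \<xi> * cnj (?f \<xi>'))"
      by (simp only: v_def integral_mult_right_zero integral_mult_left_zero Bochner_Integration.integral_cnj)
    also have "\<dots> = (LINT \<zeta>|(lborel \<Otimes>\<^sub>M lborel). ?f (fst \<zeta>) * cnj (?f (snd \<zeta>)))"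
      using lborel_pair.integral_fst[OF integrable_times_pair[OF i integrable_cnj[OF i]]]
      by (simp add: split_beta')
    also have "\<dots> = (LINT \<zeta>|lborel. e z \<zeta> * A \<zeta>)"
      by (simp add: lborel_prod e_def A_def cis_cnj cis_mult algebra_simps)
    finally show ?thesis .
  qed
  have ip: "integrable (lborel \<Otimes>\<^sub>M lborel) (\<lambda>(z, \<zeta>). complex_of_real (?W z) * (e z \<zeta> * A \<zeta>))"
  proof (rule Bochner_Integration.integrable_bound[OF integrable_times_pair[OF iWc iA]])
    show "(\<lambda>(z, \<zeta>). complex_of_real (?W z) * (e z \<zeta> * A \<zeta>)) \<in> borel_measurable (lborel \<Otimes>\<^sub>M lborel)"
      unfolding e_def by measurable
  qed (auto simp: norm_mult ne)
  have We: "(LINT z|lborel. complex_of_real (?W z) * (e z \<zeta> * A \<zeta>)) = complex_of_real (?K \<zeta>) * A \<zeta>" for \<zeta>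
  proof -
    let ?g = "\<lambda>\<alpha> y. cis (y * \<alpha>) * complex_of_real (gauss_weight n y)"
    have i: "integrable lborel (?g \<alpha>)" for \<alpha>
      by (rule Bochner_Integration.integrable_bound[OF integrable_gauss_weight[OF n]]) (auto simp: norm_mult)
    let ?\<alpha> = "p (fst \<zeta>) - p (snd \<zeta>)" and ?\<beta> = "q (fst \<zeta>) - q (snd \<zeta>)"
    have "(LINT z|lborel. complex_of_real (?W z) * (e z \<zeta> * A \<zeta>))
        = (LINT z|lborel. (?g ?\<alpha> (fst z) * ?g ?\<beta> (snd z)) * A \<zeta>)"
      by (simp add: e_def mult_ac)
    also have "\<dots> = (LINT z|(lborel \<Otimes>\<^sub>M lborel). ?g ?\<alpha> (fst z) * ?g ?\<beta> (snd z)) * A \<zeta>"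
      by (simp add: lborel_prod)
    also have "(LINT z|(lborel \<Otimes>\<^sub>M lborel). ?g ?\<alpha> (fst z) * ?g ?\<beta> (snd z))
        = (LINT x|lborel. ?g ?\<alpha> x) * (LINT x|lborel. ?g ?\<beta> x)"
      using lborel_pair.integral_fst[OF integrable_times_pair[OF i[of ?\<alpha>] i[of ?\<beta>]]]
      by (simp add: split_beta')
    also have "\<dots> = complex_of_real (?K \<zeta>)"
      unfolding fourier_gauss_weight[OF n] by simp
    finally show ?thesis .
  qed
  have Kc: "?K (y, x) = ?K (x, y)" for x y
    by (simp only: fst_conv snd_conv gauss_kernel_commute[of n "p y" "p x"] gauss_kernel_commute[of n "q
        y" "q x"])
  have nvbd: "norm (v z) \<le> (LINT \<xi>|lborel. norm (a \<xi>))" for z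
    unfolding v_def by (rule order_trans[OF integral_norm_bound]) (simp add: norm_mult)
  have iWv: "integrable lborel (\<lambda>z. ?W z * (norm (v z))\<^sup>2)"
  proof (rule Bochner_Integration.integrable_bound)
    show "integrable lborel (\<lambda>z. ?W z * (LINT \<xi>|lborel. norm (a \<xi>))\<^sup>2)"
      using iW by simp
    show "AE z in lborel. norm (?W z * (norm (v z))\<^sup>2) \<le> norm (?W z * (LINT \<xi>|lborel. norm (a \<xi>))\<^sup>2)"
      using nvbd by (intro AE_I2) (auto simp: abs_mult intro!: mult_mono power_mono)
  qed auto
  have iKA: "integrable lborel (\<lambda>\<zeta>. complex_of_real (?K \<zeta>) * A \<zeta>)"
    using lborel_pair.integrable_snd[OF ip] by (simp only: We)
  have "(\<integral>\<^sup>+z. ennreal (?W z * (norm (v z))\<^sup>2) \<partial>lborel) = ennreal (LINT z|lborel. ?W z * (norm (v z))\<^sup>2)"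
    by (rule nn_integral_eq_integral[OF iWv]) (auto simp: gauss_weight_def)
  also have "\<dots> = ennreal (norm (complex_of_real (LINT z|lborel. ?W z * (norm (v z))\<^sup>2)))"
    by (simp add: gauss_weight_def)
  also have "complex_of_real (LINT z|lborel. ?W z * (norm (v z))\<^sup>2)
     = (LINT z|lborel. LINT \<zeta>|lborel. complex_of_real (?W z) * (e z \<zeta> * A \<zeta>))"
    by (subst integral_complex_of_real[symmetric]) (simp only: of_real_mult[of "?W _" "_ ^ 2"] vv
        integral_mult_right_zero)
  also have "\<dots> = (LINT \<zeta>|lborel. complex_of_real (?K \<zeta>) * A \<zeta>)"
    using lborel_pair.Fubini_integral[OF ip] by (simp only: We)
  also have "ennreal (norm \<dots>) \<le> (\<integral>\<^sup>+\<zeta>. ennreal (norm (complex_of_real (?K \<zeta>) * A \<zeta>)) \<partial>lborel)"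
    by (rule integral_norm_bound_ennreal[OF iKA])
  also have "\<dots> \<le> (\<integral>\<^sup>+\<zeta>. (nsq (a (fst \<zeta>)) / 2) * (ennreal (?K \<zeta>) * indicator S (snd \<zeta>))
       + (nsq (a (snd \<zeta>)) / 2) * (ennreal (?K \<zeta>) * indicator S (fst \<zeta>)) \<partial>(lborel \<Otimes>\<^sub>M lborel))"
    unfolding lborel_prod
  proof (rule nn_integral_mono)
    fix \<zeta> :: "(real^2)\<times>(real^2)"
    show "ennreal (norm (complex_of_real (?K \<zeta>) * A \<zeta>))
        \<le> (nsq (a (fst \<zeta>)) / 2) * (ennreal (?K \<zeta>) * indicator S (snd \<zeta>))
       + (nsq (a (snd \<zeta>)) / 2) * (ennreal (?K \<zeta>) * indicator S (fst \<zeta>))"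
    proof (cases "fst \<zeta> \<in> S \<and> snd \<zeta> \<in> S")
      case True
      let ?x = "norm (a (fst \<zeta>))" and ?y = "norm (a (snd \<zeta>))"
      have K: "0 \<le> ?K \<zeta>" by (simp add: gauss_kernel_nonneg)
      have "norm (complex_of_real (?K \<zeta>) * A \<zeta>) = ?K \<zeta> * (?x * ?y)"
        by (simp add: norm_mult A_def gauss_kernel_nonneg del: of_real_mult)
      also have "\<dots> \<le> ?K \<zeta> * (?x\<^sup>2 / 2 + ?y\<^sup>2 / 2)"
        using sum_squares_bound[of ?x ?y] by (intro mult_left_mono K) (simp add: field_simps)
      finally show ?thesis using True K
        by (simp add: ennreal_mult'[symmetric] ennreal_plus[symmetric] ennreal_divide_numeral distrib_left
            mult.commute del: ennreal_plus)
    next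
      case False
      then have "A \<zeta> = 0" using supp by (auto simp: A_def)
      then show ?thesis by simp
    qed
  qed
  also have "\<dots> = (\<integral>\<^sup>+\<zeta>. (nsq (a (fst \<zeta>)) / 2) * (ennreal (?K \<zeta>) * indicator S (snd \<zeta>)) \<partial>(lborel \<Otimes>\<^sub>M lborel))
       + (\<integral>\<^sup>+\<zeta>. (nsq (a (snd \<zeta>)) / 2) * (ennreal (?K \<zeta>) * indicator S (fst \<zeta>)) \<partial>(lborel \<Otimes>\<^sub>M lborel))"
    by (rule nn_integral_add) measurable
  also have "(\<integral>\<^sup>+\<zeta>. (nsq (a (fst \<zeta>)) / 2) * (ennreal (?K \<zeta>) * indicator S (snd \<zeta>)) \<partial>(lborel \<Otimes>\<^sub>M lborel))
      = (\<integral>\<^sup>+x. (nsq (a x) / 2) * (\<integral>\<^sup>+y. ennreal (?K (x, y)) * indicator S y \<partial>lborel) \<partial>lborel)"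
    by (subst lborel.nn_integral_fst[symmetric]) (auto simp: nn_integral_cmult)
  also have "(\<integral>\<^sup>+\<zeta>. (nsq (a (snd \<zeta>)) / 2) * (ennreal (?K \<zeta>) * indicator S (fst \<zeta>)) \<partial>(lborel \<Otimes>\<^sub>M lborel))
      = (\<integral>\<^sup>+x. (nsq (a x) / 2) * (\<integral>\<^sup>+y. ennreal (?K (y, x)) * indicator S y \<partial>lborel) \<partial>lborel)"
    by (subst lborel_pair.nn_integral_snd[symmetric]) (auto simp: nn_integral_cmult split_beta')
  also have "(\<integral>\<^sup>+x. (nsq (a x) / 2) * (\<integral>\<^sup>+y. ennreal (?K (y, x)) * indicator S y \<partial>lborel) \<partial>lborel)
      = (\<integral>\<^sup>+x. (nsq (a x) / 2) * (\<integral>\<^sup>+y. ennreal (?K (x, y)) * indicator S y \<partial>lborel) \<partial>lborel)"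
    by (simp only: Kc)
  also have "\<dots> + \<dots> = (\<integral>\<^sup>+x. nsq (a x) * (\<integral>\<^sup>+y. ennreal (?K (x, y)) * indicator S y \<partial>lborel) \<partial>lborel)"
  proof (subst nn_integral_add[symmetric])
    have "x / 2 * y + x / 2 * y = x * y" for x y :: ennreal
      by (simp only: ennreal_halves flip: distrib_right)
    note h = this
    show "(\<integral>\<^sup>+x. nsq (a x) / 2 * (\<integral>\<^sup>+y. ennreal (?K (x, y)) * indicator S y \<partial>lborel)
         + nsq (a x) / 2 * (\<integral>\<^sup>+y. ennreal (?K (x, y)) * indicator S y \<partial>lborel) \<partial>lborel)
      = (\<integral>\<^sup>+x. nsq (a x) * (\<integral>\<^sup>+y. ennreal (?K (x, y)) * indicator S y \<partial>lborel) \<partial>lborel)"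
      by (intro nn_integral_cong h)
  qed measurable
  also have "\<dots> \<le> (\<integral>\<^sup>+x. nsq (a x) * B \<partial>lborel)"
    using B by (intro nn_integral_mono mult_left_mono) auto
  also have "\<dots> = B * (\<integral>\<^sup>+x. nsq (a x) \<partial>lborel)"
    by (subst nn_integral_multc) (auto simp: mult.commute)
  finally show ?thesis by (simp add: v_def)
qed

text \<open>The bound \<open>B\<close> says that the image of Lebesgue measure on \<open>S\<close> under \<open>(p, q)\<close> has density at most
\<open>B / (2 * pi)\<^sup>2\<close>, tested with Gaussians only.  In this form no inverse of the map \<open>(p, q)\<close> is
needed.  The Gaussian cut-off is removed with Fatou's lemma.\<close>

lemma plancherel_phases:
  fixes p q :: "real^2 \<Rightarrow> real" and a :: "real^2 \<Rightarrow> complex"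
  assumes [measurable]: "p \<in> borel_measurable borel" "q \<in> borel_measurable borel" "S \<in> sets borel"
    and a: "integrable lborel a" and supp: "\<And>\<xi>. \<xi> \<notin> S \<Longrightarrow> a \<xi> = 0"
    and B: "\<And>n \<alpha> \<beta>. 0 < n \<Longrightarrow> (\<integral>\<^sup>+\<xi>\<in>S. ennreal (gauss_kernel n (\<alpha> - p \<xi>) * gauss_kernel n (\<beta> - q \<xi>)) \<partial>lborel) \<le> B"
  shows "(\<integral>\<^sup>+y. \<integral>\<^sup>+s. nsq (LINT \<xi>|lborel. cis (y * p \<xi> + s * q \<xi>) * a \<xi>) \<partial>lborel \<partial>lborel)
    \<le> B * (\<integral>\<^sup>+\<xi>. nsq (a \<xi>) \<partial>lborel)"
proof -
  have [measurable]: "a \<in> borel_measurable borel" using a by auto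
  define v where "v = (\<lambda>z::real\<times>real. LINT \<xi>|lborel. cis (fst z * p \<xi> + snd z * q \<xi>) * a \<xi>)"
  have "v \<in> borel_measurable (borel \<Otimes>\<^sub>M borel)"
    unfolding v_def by measurable
  then have [measurable]: "v \<in> borel_measurable borel"
    by (simp only: borel_prod)
  let ?W = "\<lambda>n z. gauss_weight (real (Suc n)) (fst z) * gauss_weight (real (Suc n)) (snd z)"
  have lim: "(\<lambda>n. ennreal (?W n z * (norm (v z))\<^sup>2)) \<longlonglongrightarrow> nsq (v z)" for z
  proof -
    have g: "(\<lambda>n. gauss_weight (real (Suc n)) y) \<longlonglongrightarrow> 1" for y
    proof -
      have "(\<lambda>n. y * (1 / real (Suc n))) \<longlonglongrightarrow> y * 0"
        using LIMSEQ_inverse_real_of_nat by (intro tendsto_intros) (simp add: inverse_eq_divide)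
      then have "(\<lambda>n. y / real (Suc n)) \<longlonglongrightarrow> 0" by simp
      from tendsto_exp[OF tendsto_divide[OF tendsto_minus[OF tendsto_power[OF this, of 2]] tendsto_const[of 2]]]
      show ?thesis unfolding gauss_weight_def by simp
    qed
    have "(\<lambda>n. ?W n z * (norm (v z))\<^sup>2) \<longlonglongrightarrow> 1 * 1 * (norm (v z))\<^sup>2"
      by (intro tendsto_mult g tendsto_const)
    then show ?thesis by (intro tendsto_ennrealI) simp
  qed
  have "(\<integral>\<^sup>+z. nsq (v z) \<partial>lborel) = (\<integral>\<^sup>+z. liminf (\<lambda>n. ennreal (?W n z * (norm (v z))\<^sup>2)) \<partial>lborel)"
    by (intro nn_integral_cong lim_imp_Liminf[OF _ lim, symmetric]) simp
  also have "\<dots> \<le> liminf (\<lambda>n. \<integral>\<^sup>+z. ennreal (?W n z * (norm (v z))\<^sup>2) \<partial>lborel)"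
  proof (rule nn_integral_liminf)
    have [measurable]: "fst \<in> borel_measurable (borel :: (real \<times> real) measure)"
      "snd \<in> borel_measurable (borel :: (real \<times> real) measure)"
      by (auto intro!: borel_measurable_continuous_onI continuous_intros)
    show "(\<lambda>z. ennreal (?W n z * (norm (v z))\<^sup>2)) \<in> borel_measurable lborel" for n
      by measurable
  qed
  also have "\<dots> \<le> liminf (\<lambda>n::nat. B * (\<integral>\<^sup>+\<xi>. nsq (a \<xi>) \<partial>lborel))"
    unfolding v_def
    by (intro Liminf_mono always_eventually allI plancherel_phases_cutoff[where S=S] a supp B) auto
  also have "\<dots> = B * (\<integral>\<^sup>+\<xi>. nsq (a \<xi>) \<partial>lborel)"
    by (simp add: Liminf_const)
  also have "(\<integral>\<^sup>+z. nsq (v z) \<partial>lborel) = (\<integral>\<^sup>+y. \<integral>\<^sup>+s. nsq (v (y, s)) \<partial>lborel \<partial>lborel)"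
    by (subst lborel.nn_integral_fst) (simp_all only: lborel_prod, measurable)
  finally show ?thesis by (simp add: v_def)
qed

lemma nn_integral_gauss_kernel_shift:
  assumes "0 < n"
  shows "(\<integral>\<^sup>+x. ennreal (gauss_kernel n (\<alpha> - x)) \<partial>lborel) = ennreal (2 * pi)"
    "(\<integral>\<^sup>+x. ennreal (gauss_kernel n (\<alpha> + x)) \<partial>lborel) = ennreal (2 * pi)"
  using nn_integral_real_affine[of "\<lambda>x. ennreal (gauss_kernel n x)" "-1" \<alpha>]
    nn_integral_real_affine[of "\<lambda>x. ennreal (gauss_kernel n x)" 1 \<alpha>] nn_integral_gauss_kernel[OF assms]
  by simp_all

lemma plancherel_plane:
  assumes a: "integrable lborel a"
  shows "(\<integral>\<^sup>+x. nsq (LINT \<xi>|lborel. cis (x \<bullet> \<xi>) * a \<xi>) \<partial>lborel)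
    \<le> ennreal ((2 * pi)\<^sup>2) * (\<integral>\<^sup>+\<xi>. nsq (a (\<xi>::real^2)) \<partial>lborel)"
proof -
  have [measurable]: "a \<in> borel_measurable borel" using a by auto
  have k: "(\<integral>\<^sup>+\<xi>\<in>UNIV. ennreal (gauss_kernel n (\<alpha> - \<xi> $ 1)
      * gauss_kernel n (\<beta> - (\<xi>::real^2) $ 2)) \<partial>lborel) \<le> ennreal ((2 * pi)\<^sup>2)"
    if n: "0 < n" for n \<alpha> \<beta>
  proof -
    have "(\<integral>\<^sup>+\<xi>\<in>UNIV. ennreal (gauss_kernel n (\<alpha> - \<xi> $ 1) * gauss_kernel n (\<beta> - (\<xi>::real^2) $ 2)) \<partial>lborel)
       = (\<integral>\<^sup>+x. \<integral>\<^sup>+y. ennreal (gauss_kernel n (\<alpha> - x)) * ennreal (gauss_kernel n (\<beta> - y)) \<partial>lborel \<partial>lborel)"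
      by (subst nn_integral_real2) (auto simp: ennreal_mult' gauss_kernel_nonneg)
    also have "\<dots> = ennreal (2 * pi) * ennreal (2 * pi)"
      using nn_integral_gauss_kernel_shift[OF n] by (simp add: nn_integral_cmult nn_integral_multc)
    finally show ?thesis by (simp add: power2_eq_square ennreal_mult'[symmetric])
  qed
  have m: "(\<lambda>(x::real^2, \<xi>). cis (x \<bullet> \<xi>) * a \<xi>) \<in> borel_measurable (borel \<Otimes>\<^sub>M lborel)"
    by measurable
  have [measurable]: "(\<lambda>x::real^2. LINT \<xi>|lborel. cis (x \<bullet> \<xi>) * a \<xi>) \<in> borel_measurable borel"
    using lborel.borel_measurable_lebesgue_integral[OF m] by simp
  show ?thesis
    using plancherel_phases[of "\<lambda>\<xi>. \<xi> $ 1" "\<lambda>\<xi>. \<xi> $ 2" UNIV a, OF _ _ _ a _ k]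
    by (subst nn_integral_real2) (auto simp: inner_pt)
qed

section \<open>Plancherel in one space variable and time\<close>

text \<open>On \<open>s \<ge> c\<close> the function \<open>sqrt (c\<^sup>2 + s\<^sup>2)\<close> has derivative \<open>s / sqrt (c\<^sup>2 + s\<^sup>2) \<ge> 1 / 2\<close>.  For
\<open>c = 0\<close> it is not differentiable at \<open>0\<close>, but then it is the identity on \<open>s \<ge> 0\<close>.\<close>

lemma nn_integral_hyperbola_le:
  fixes f :: "real \<Rightarrow> ennreal" and c :: real
  assumes [measurable]: "f \<in> borel_measurable borel" and c: "0 \<le> c"
  shows "(\<integral>\<^sup>+s\<in>{c..}. f (sqrt (c\<^sup>2 + s\<^sup>2)) \<partial>lborel) \<le> 2 * (\<integral>\<^sup>+x. f x \<partial>lborel)"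
proof (cases "c = 0")
  case True
  have "(\<integral>\<^sup>+s\<in>{c..}. f (sqrt (c\<^sup>2 + s\<^sup>2)) \<partial>lborel) \<le> (\<integral>\<^sup>+x. f x \<partial>lborel)"
    using True by (intro nn_integral_mono) (auto split: split_indicator)
  also have "\<dots> \<le> 2 * (\<integral>\<^sup>+x. f x \<partial>lborel)"
    by (simp add: mult_2)
  finally show ?thesis .
next
  case False
  with c have c: "0 < c" by simp
  let ?\<phi> = "\<lambda>s. sqrt (c\<^sup>2 + s\<^sup>2)" and ?\<phi>' = "\<lambda>s. s / sqrt (c\<^sup>2 + s\<^sup>2)"
  have pos: "0 < c\<^sup>2 + s\<^sup>2" for s using c by (simp add: add_pos_nonneg)
  have half: "1 / 2 \<le> ?\<phi>' s" if "c \<le> s" for s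
  proof -
    have "c\<^sup>2 \<le> s\<^sup>2" using c that by (intro power_mono) auto
    moreover have "(2 * s)\<^sup>2 = 4 * s\<^sup>2" by (simp add: power_mult_distrib)
    ultimately have "c\<^sup>2 + s\<^sup>2 \<le> (2 * s)\<^sup>2" using zero_le_power2[of s] by linarith
    then have "sqrt (c\<^sup>2 + s\<^sup>2) \<le> 2 * s" using c that by (intro real_le_lsqrt) auto
    then show ?thesis using c that pos[of s] by (simp add: divide_simps)
  qed
  have m: "(\<integral>\<^sup>+s. f (?\<phi> s) * indicator {c..c + real m} s \<partial>lborel) \<le> 2 * (\<integral>\<^sup>+x. f x \<partial>lborel)" for m
  proof (cases "m = 0")
    case True
    have "AE s in lborel. s \<noteq> c" by (rule AE_lborel_singleton)
    then have "AE s in lborel. f (?\<phi> s) * indicator {c..c + real m} s = 0"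
      by eventually_elim (use True in auto)
    then have "(\<integral>\<^sup>+s. f (?\<phi> s) * indicator {c..c + real m} s \<partial>lborel) = 0"
      by (subst nn_integral_0_iff_AE) auto
    then show ?thesis by simp
  next
    case False
    have "(\<integral>\<^sup>+s. f (?\<phi> s) * indicator {c..c + real m} s \<partial>lborel)
        \<le> (\<integral>\<^sup>+s. 2 * (f (?\<phi> s) * ennreal (?\<phi>' s) * indicator {c..c + real m} s) \<partial>lborel)"
    proof (rule nn_integral_mono)
      fix s
      show "f (?\<phi> s) * indicator {c..c + real m} s \<le> 2 * (f (?\<phi> s) * ennreal (?\<phi>' s) * indicator {c..c
          + real m} s)"
      proof (cases "s \<in> {c..c + real m}")
        case True
        then have "c \<le> s" by simp
        then have "1 \<le> 2 * ?\<phi>' s" using half[of s] by linarith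
        then have "ennreal 1 \<le> ennreal (2 * ?\<phi>' s)" by (rule ennreal_leI)
        also have "\<dots> = 2 * ennreal (?\<phi>' s)" using ennreal_mult'[of 2 "?\<phi>' s"] by simp
        finally have "f (?\<phi> s) * 1 \<le> f (?\<phi> s) * (2 * ennreal (?\<phi>' s))"
          by (intro mult_left_mono) simp_all
        then show ?thesis using True by (simp add: mult_ac)
      qed simp
    qed
    also have "\<dots> = 2 * (\<integral>\<^sup>+s. f (?\<phi> s) * ennreal (?\<phi>' s) * indicator {c..c + real m} s \<partial>lborel)"
      by (rule nn_integral_cmult) measurable
    also have "(\<integral>\<^sup>+s. f (?\<phi> s) * ennreal (?\<phi>' s) * indicator {c..c + real m} s \<partial>lborel)
        = (\<integral>\<^sup>+x. f x * indicator {?\<phi> c..?\<phi> (c + real m)} x \<partial>lborel)"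
    proof (rule nn_integral_substitution_aux[symmetric])
      show "(?\<phi> has_real_derivative ?\<phi>' s) (at s)" for s
        using pos[of s] by (auto intro!: derivative_eq_intros simp: field_simps)
      show "continuous_on {c..c + real m} ?\<phi>'"
        using c by (intro continuous_intros) auto
      show "0 \<le> ?\<phi>' s" if "s \<in> {c..c + real m}" for s using that c by auto
    qed (use False in auto)
    also have "2 * \<dots> \<le> 2 * (\<integral>\<^sup>+x. f x \<partial>lborel)"
      by (intro mult_left_mono nn_integral_mono) (auto split: split_indicator)
    finally show ?thesis .
  qed
  have "(\<integral>\<^sup>+s. f (?\<phi> s) * indicator {c..} s \<partial>lborel)
     = (\<integral>\<^sup>+s. (SUP m::nat. f (?\<phi> s) * indicator {c..c + real m} s) \<partial>lborel)"
  proof (rule nn_integral_cong)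
    fix s
    show "f (?\<phi> s) * indicator {c..} s = (SUP m::nat. f (?\<phi> s) * indicator {c..c + real m} s)"
    proof (rule antisym)
      obtain m :: nat where "s - c \<le> real m" using real_arch_simple by blast
      then show "f (?\<phi> s) * indicator {c..} s \<le> (SUP m::nat. f (?\<phi> s) * indicator {c..c + real m} s)"
        by (intro SUP_upper2[of m]) (auto split: split_indicator)
    qed (auto intro!: SUP_least split: split_indicator)
  qed
  also have "\<dots> = (SUP m::nat. \<integral>\<^sup>+s. f (?\<phi> s) * indicator {c..c + real m} s \<partial>lborel)"
    by (rule nn_integral_monotone_convergence_SUP) (auto simp: mono_def le_fun_def split: split_indicator)
  also have "\<dots> \<le> 2 * (\<integral>\<^sup>+x. f x \<partial>lborel)"
    by (intro SUP_least m)
  finally show ?thesis .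
qed

lemma nn_integral_hyperbola2_le:
  fixes f :: "real \<Rightarrow> ennreal" and c :: real
  assumes [measurable]: "f \<in> borel_measurable borel"
  shows "(\<integral>\<^sup>+s\<in>{s. \<bar>c\<bar> \<le> \<bar>s\<bar>}. f (sqrt (c\<^sup>2 + s\<^sup>2)) \<partial>lborel) \<le> 4 * (\<integral>\<^sup>+x. f x \<partial>lborel)"
proof -
  let ?I = "\<integral>\<^sup>+s\<in>{\<bar>c\<bar>..}. f (sqrt (\<bar>c\<bar>\<^sup>2 + s\<^sup>2)) \<partial>lborel"
  have "(\<integral>\<^sup>+s\<in>{s. \<bar>c\<bar> \<le> \<bar>s\<bar>}. f (sqrt (c\<^sup>2 + s\<^sup>2)) \<partial>lborel)
     \<le> (\<integral>\<^sup>+s. f (sqrt (\<bar>c\<bar>\<^sup>2 + s\<^sup>2)) * indicator {\<bar>c\<bar>..} s + f (sqrt (\<bar>c\<bar>\<^sup>2 + (-s)\<^sup>2))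
       * indicator {\<bar>c\<bar>..} (-s) \<partial>lborel)"
    by (intro nn_integral_mono) (auto split: split_indicator)
  also have "\<dots> = ?I + (\<integral>\<^sup>+s. f (sqrt (\<bar>c\<bar>\<^sup>2 + (-s)\<^sup>2)) * indicator {\<bar>c\<bar>..} (-s) \<partial>lborel)"
    by (rule nn_integral_add) measurable
  also have "\<dots> = ?I + ?I"
    by (subst nn_integral_uminus_real[of "\<lambda>s. f (sqrt (\<bar>c\<bar>\<^sup>2 + s\<^sup>2)) * indicator {\<bar>c\<bar>..} s"]) auto
  also have "\<dots> \<le> 2 * (\<integral>\<^sup>+x. f x \<partial>lborel) + 2 * (\<integral>\<^sup>+x. f x \<partial>lborel)"
    by (intro add_mono nn_integral_hyperbola_le) auto
  also have "\<dots> = 4 * (\<integral>\<^sup>+x. f x \<partial>lborel)"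
    by (simp flip: distrib_right)
  finally show ?thesis .
qed

text \<open>The component \<open>i\<close> is the smaller one in absolute value; written with the norm, the condition needs no
name for the other component.\<close>

definition cone :: "2 \<Rightarrow> (real^2) set" where
  "cone i = {\<xi>. \<bar>\<xi> $ i\<bar> \<le> norm \<xi> / sqrt 2}"

lemma cone_pt: "pt a b \<in> cone 1 \<longleftrightarrow> \<bar>a\<bar> \<le> \<bar>b\<bar>" "pt a b \<in> cone 2 \<longleftrightarrow> \<bar>b\<bar> \<le> \<bar>a\<bar>"
proof -
  have *: "\<bar>x\<bar> \<le> sqrt (x\<^sup>2 + y\<^sup>2) / sqrt 2 \<longleftrightarrow> \<bar>x\<bar> \<le> \<bar>y\<bar>" for x y :: real
  proof -
    have "\<bar>x\<bar> \<le> sqrt (x\<^sup>2 + y\<^sup>2) / sqrt 2 \<longleftrightarrow> sqrt (x\<^sup>2) \<le> sqrt ((x\<^sup>2 + y\<^sup>2) / 2)"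
      by (simp add: real_sqrt_divide)
    also have "\<dots> \<longleftrightarrow> x\<^sup>2 \<le> y\<^sup>2"
      by (simp only: real_sqrt_le_iff) auto
    also have "\<dots> \<longleftrightarrow> \<bar>x\<bar> \<le> \<bar>y\<bar>"
      by (rule abs_le_square_iff[symmetric])
    finally show ?thesis .
  qed
  show "pt a b \<in> cone 1 \<longleftrightarrow> \<bar>a\<bar> \<le> \<bar>b\<bar>" "pt a b \<in> cone 2 \<longleftrightarrow> \<bar>b\<bar> \<le> \<bar>a\<bar>"
    using *[of a b] *[of b a] by (simp_all add: cone_def norm_pt add.commute)
qed

lemma cone_sets [measurable]: "cone i \<in> sets borel"
  unfolding cone_def by measurable

lemma cone_Un: "\<xi> \<in> cone 1 \<or> \<xi> \<in> cone 2"
  using cone_pt[of "\<xi> $ 1" "\<xi> $ 2"] by (auto simp: pt_components)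

text \<open>For fixed \<open>\<xi> $ i\<close> the map from the other component to \<open>norm \<xi>\<close> is two-to-one and expands by at
least \<open>1 / 2\<close> on the cone, which bounds the row integrals of Schur's test by
\<open>(2 * pi) * 4 * (2 * pi)\<close>.\<close>

lemma plancherel_cone:
  assumes a: "integrable lborel a" and supp: "\<And>\<xi>. \<xi> \<notin> cone i \<Longrightarrow> a \<xi> = 0"
  shows "(\<integral>\<^sup>+y. \<integral>\<^sup>+t. nsq (LINT \<xi>|lborel. cis (y * \<xi> $ i - t * norm \<xi>) * a \<xi>) \<partial>lborel \<partial>lborel)
    \<le> ennreal (16 * pi\<^sup>2) * (\<integral>\<^sup>+\<xi>. nsq (a \<xi>) \<partial>lborel)"
proof -
  have inner: "(\<integral>\<^sup>+s. ennreal (gauss_kernel n (\<alpha> - c)) * (ennreal (gauss_kernel n (\<beta> + sqrt (c\<^sup>2 + s\<^sup>2)))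
      * indicator {s. \<bar>c\<bar> \<le> \<bar>s\<bar>} s) \<partial>lborel)
      \<le> ennreal (gauss_kernel n (\<alpha> - c)) * (4 * ennreal (2 * pi))" if n: "0 < n" for n \<alpha> \<beta> c
    using nn_integral_hyperbola2_le[of "\<lambda>x. ennreal (gauss_kernel n (\<beta> + x))" c]
        nn_integral_gauss_kernel_shift(2)[OF n, of \<beta>]
    by (subst nn_integral_cmult) (auto intro!: mult_left_mono)
  have k: "(\<integral>\<^sup>+\<xi>\<in>cone i. ennreal (gauss_kernel n (\<alpha> - \<xi> $ i) * gauss_kernel n (\<beta> - (- norm \<xi>))) \<partial>lborel)
      \<le> ennreal (16 * pi\<^sup>2)" (is "?L \<le> _")
    if n: "0 < n" for n \<alpha> \<beta>
  proof -
    have "?L = (\<integral>\<^sup>+c. \<integral>\<^sup>+s. ennreal (gauss_kernel n (\<alpha> - c))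
        * (ennreal (gauss_kernel n (\<beta> + sqrt (c\<^sup>2 + s\<^sup>2))) * indicator {s. \<bar>c\<bar> \<le> \<bar>s\<bar>} s) \<partial>lborel \<partial>lborel)"
      using exhaust_2[of i]
    proof
      assume i: "i = 1"
      show ?thesis unfolding i
        by (subst nn_integral_real2)
           (auto intro!: nn_integral_cong simp: norm_pt ennreal_mult' gauss_kernel_nonneg cone_pt mult_ac
               split: split_indicator)
    next
      assume i: "i = 2"
      show ?thesis unfolding i
        by (subst nn_integral_real2_swap)
           (auto intro!: nn_integral_cong simp: norm_pt ennreal_mult' gauss_kernel_nonneg cone_pt mult_ac
               add.commute split: split_indicator)
    qed
    also have "\<dots> \<le> (\<integral>\<^sup>+c. ennreal (gauss_kernel n (\<alpha> - c)) * (4 * ennreal (2 * pi)) \<partial>lborel)"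
      by (intro nn_integral_mono inner n)
    also have "\<dots> = ennreal (2 * pi) * (4 * ennreal (2 * pi))"
      using nn_integral_gauss_kernel_shift(1)[OF n] by (subst nn_integral_multc) auto
    also have "\<dots> = ennreal (16 * pi\<^sup>2)"
      by (simp add: ennreal_mult'[symmetric] power2_eq_square flip: ennreal_numeral)
    finally show ?thesis .
  qed
  show ?thesis
    using plancherel_phases[of "\<lambda>\<xi>. \<xi> $ i" "\<lambda>\<xi>. - norm \<xi>" "cone i" a, OF _ _ _ a supp k]
    by (simp add: )
qed

section \<open>The Sobolev inequality on lines\<close>

text \<open>The first two moments of \<open>h\<close> bound the Taylor remainder by \<open>(y - r)\<^sup>2\<close> times a constant, without
any passage to the limit under the integral.\<close>

lemma has_vector_derivative_oscillatory:
  fixes c :: "'a::euclidean_space \<Rightarrow> real" and h :: "'a \<Rightarrow> complex"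
  assumes [measurable]: "c \<in> borel_measurable borel"
    and h: "integrable lborel h" and ch: "integrable lborel (\<lambda>\<xi>. c \<xi> * h \<xi>)"
    and cch: "integrable lborel (\<lambda>\<xi>. (c \<xi>)\<^sup>2 * h \<xi>)"
  shows "((\<lambda>r. LINT \<xi>|lborel. cis (r * c \<xi>) * h \<xi>) has_vector_derivative
      (LINT \<xi>|lborel. cis (r * c \<xi>) * (\<i> * (c \<xi> * h \<xi>)))) (at r)"
proof -
  have [measurable]: "h \<in> borel_measurable borel" using h by auto
  have i1: "integrable lborel (\<lambda>\<xi>. cis (r * c \<xi>) * h \<xi>)" for r
    by (rule Bochner_Integration.integrable_bound[OF h]) (auto simp: norm_mult)
  have i2: "integrable lborel (\<lambda>\<xi>. cis (r * c \<xi>) * (\<i> * (c \<xi> * h \<xi>)))" for r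
    by (rule Bochner_Integration.integrable_bound[OF ch]) (auto simp: norm_mult)
  have i3: "integrable lborel (\<lambda>\<xi>. (c \<xi>)\<^sup>2 * norm (h \<xi>))"
    using integrable_norm[OF cch] by (simp add: norm_mult norm_power)
  have taylor: "norm (cis (y * s) - cis (r * s) - (y - r) * (cis (r * s) * (\<i> * s)))
      \<le> (y - r)\<^sup>2 * s\<^sup>2" for y s :: real
  proof -
    have "cis (y * s) = cis (r * s) * cis ((y - r) * s)"
      by (simp add: cis_mult algebra_simps)
    then have "cis (y * s) - cis (r * s) - (y - r) * (cis (r * s) * (\<i> * s))
        = cis (r * s) * (cis ((y - r) * s) - 1 - \<i> * ((y - r) * s))"
      by (simp add: algebra_simps)
    then have "norm (cis (y * s) - cis (r * s) - (y - r) * (cis (r * s) * (\<i> * s)))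
        = norm (iexp ((y - r) * s) - (\<Sum>k\<le>1. (\<i> * complex_of_real ((y - r) * s)) ^ k / fact k))"
      by (simp add: norm_mult cis_conv_exp diff_diff_eq)
    also have "\<dots> \<le> \<bar>(y - r) * s\<bar> ^ Suc 1 / fact (Suc 1)"
      by (rule iexp_approx1)
    also have "\<dots> \<le> (y - r)\<^sup>2 * s\<^sup>2"
      by (simp add: power_mult_distrib numeral_2_eq_2[symmetric])
    finally show ?thesis .
  qed
  have bd: "norm ((LINT \<xi>|lborel. cis (y * c \<xi>) * h \<xi>) - (LINT \<xi>|lborel. cis (r * c \<xi>) * h \<xi>)
      - (y - r) *\<^sub>R (LINT \<xi>|lborel. cis (r * c \<xi>) * (\<i> * (c \<xi> * h \<xi>))))
    \<le> (y - r)\<^sup>2 * (LINT \<xi>|lborel. (c \<xi>)\<^sup>2 * norm (h \<xi>))" for y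
  proof -
    let ?q = "\<lambda>\<xi>. cis (y * c \<xi>) * h \<xi> - cis (r * c \<xi>) * h \<xi> - (y - r) *\<^sub>R (cis (r * c \<xi>) * (\<i> * (c \<xi> * h \<xi>)))"
    have eq: "(LINT \<xi>|lborel. cis (y * c \<xi>) * h \<xi>) - (LINT \<xi>|lborel. cis (r * c \<xi>) * h \<xi>)
      - (y - r) *\<^sub>R (LINT \<xi>|lborel. cis (r * c \<xi>) * (\<i> * (c \<xi> * h \<xi>))) = (LINT \<xi>|lborel. ?q \<xi>)"
      by (simp only: Bochner_Integration.integral_diff Bochner_Integration.integrable_diff i1 i2
          integral_scaleR_right integrable_scaleR_right)
    have "norm (LINT \<xi>|lborel. ?q \<xi>) \<le> (LINT \<xi>|lborel. norm (?q \<xi>))"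
      by (rule integral_norm_bound)
    also have "\<dots> \<le> (LINT \<xi>|lborel. (y - r)\<^sup>2 * ((c \<xi>)\<^sup>2 * norm (h \<xi>)))"
    proof (rule integral_mono)
      fix \<xi>
      have "?q \<xi> = (cis (y * c \<xi>) - cis (r * c \<xi>) - (y - r) * (cis (r * c \<xi>) * (\<i> * c \<xi>))) * h \<xi>"
        by (simp only: scaleR_conv_of_real left_diff_distrib mult.assoc)
      then have "norm (?q \<xi>) = norm (cis (y * c \<xi>) - cis (r * c \<xi>) - (y - r)
          * (cis (r * c \<xi>) * (\<i> * c \<xi>))) * norm (h \<xi>)"
        by (simp only: norm_mult)
      also have "\<dots> \<le> ((y - r)\<^sup>2 * (c \<xi>)\<^sup>2) * norm (h \<xi>)"
        by (intro mult_right_mono taylor) simp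
      finally show "norm (?q \<xi>) \<le> (y - r)\<^sup>2 * ((c \<xi>)\<^sup>2 * norm (h \<xi>))" by (simp only: mult.assoc)
      show "integrable lborel (\<lambda>\<xi>. norm (?q \<xi>))"
        by (intro integrable_norm Bochner_Integration.integrable_diff integrable_scaleR_right i1 i2)
      show "integrable lborel (\<lambda>\<xi>. (y - r)\<^sup>2 * ((c \<xi>)\<^sup>2 * norm (h \<xi>)))"
        by (intro integrable_mult_right i3)
    qed
    also have "\<dots> = (y - r)\<^sup>2 * (LINT \<xi>|lborel. (c \<xi>)\<^sup>2 * norm (h \<xi>))"
      by simp
    finally show ?thesis unfolding eq .
  qed
  show ?thesis
    unfolding has_vector_derivative_def
  proof (rule has_derivativeI_sandwich[of 1])
    let ?K = "LINT \<xi>|lborel. (c \<xi>)\<^sup>2 * norm (h \<xi>)"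
    show "((\<lambda>y. \<bar>y - r\<bar> * ?K) \<longlongrightarrow> 0) (at r)"
      by (rule tendsto_eq_intros | simp)+
    fix y assume "y \<noteq> r"
    then show "norm ((LINT \<xi>|lborel. cis (y * c \<xi>) * h \<xi>) - (LINT \<xi>|lborel. cis (r * c \<xi>) * h \<xi>)
      - (y - r) *\<^sub>R (LINT \<xi>|lborel. cis (r * c \<xi>) * (\<i> * (c \<xi> * h \<xi>)))) / norm (y - r) \<le> \<bar>y - r\<bar> * ?K"
      using bd[of y] by (simp add: pos_divide_le_eq power2_eq_square abs_mult_self_eq mult_ac)
  qed (auto intro: bounded_linear_scaleR_left)
qed

text \<open>The derivative of \<open>norm (V s)\<^sup>2\<close> is at most \<open>N * norm (V s)\<^sup>2 + norm (V' s)\<^sup>2 / N\<close> in absolute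
value, so the values of \<open>norm (V s)\<^sup>2\<close> at two points differ by at most the integral of this; then
average over one of the two points.  The condition on the length of the interval makes the average
comparable to \<open>N\<close> times the integral.\<close>

lemma sobolev_line:
  fixes V V' :: "real \<Rightarrow> complex"
  assumes V: "\<And>r. (V has_vector_derivative V' r) (at r)" and V': "continuous_on UNIV V'"
    and N: "0 < N" and ab: "1 / N \<le> b - a" and r: "r \<in> {a..b}"
  shows "nsq (V r) \<le> (\<integral>\<^sup>+s\<in>{a..b}. ennreal (2 * N * (norm (V s))\<^sup>2 + (norm (V' s))\<^sup>2 / N) \<partial>lborel)"
proof -
  let ?w = "\<lambda>s. N * (norm (V s))\<^sup>2 + (norm (V' s))\<^sup>2 / N"
  let ?D = "\<lambda>s. 2 * (V s \<bullet> V' s)"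
  have "a < b" using N ab by (smt (verit) zero_less_divide_1_iff)
  have cV: "continuous_on UNIV V"
    using V by (intro continuous_at_imp_continuous_on) (auto intro: has_vector_derivative_continuous)
  have cV2: "continuous_on S V" "continuous_on S V'" for S
    using cV V' by (auto intro: continuous_on_subset)
  have wi: "?w integrable_on {x..y}" for x y
    using N by (intro integrable_continuous_interval continuous_intros cV2) auto
  have w0: "0 \<le> ?w s" for s using N by auto
  \<comment> \<open>The arithmetic-geometric mean inequality with the weights that \<open>N\<close> prescribes.\<close>
  have Dw: "\<bar>?D s\<bar> \<le> ?w s" for s
  proof -
    have "\<bar>?D s\<bar> \<le> 2 * (norm (V s) * norm (V' s))"
      using Cauchy_Schwarz_ineq2[of "V s" "V' s"] by simp
    also have "\<dots> = 2 * ((sqrt N * norm (V s)) * (norm (V' s) / sqrt N))"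
      using N by simp
    also have "\<dots> \<le> (sqrt N * norm (V s))\<^sup>2 + (norm (V' s) / sqrt N)\<^sup>2"
      using sum_squares_bound[of "sqrt N * norm (V s)" "norm (V' s) / sqrt N"] by (simp only: mult.assoc)
    also have "\<dots> = ?w s" using N by (simp add: power_mult_distrib power_divide)
    finally show ?thesis .
  qed
  have diff: "\<bar>(norm (V y))\<^sup>2 - (norm (V x))\<^sup>2\<bar> \<le> integral {a..b} ?w" if "a \<le> x" "x \<le> y" "y \<le> b" for x y
  proof -
    have F: "(?D has_integral ((norm (V y))\<^sup>2 - (norm (V x))\<^sup>2)) {x..y}"
    proof (rule fundamental_theorem_of_calculus[OF that(2)])
      fix s
      have "((\<lambda>s. V s \<bullet> V s) has_vector_derivative ?D s) (at s)"
        using bounded_bilinear.has_vector_derivative[OF bounded_bilinear_inner V V, of s]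
        by (simp add: inner_commute)
      then show "((\<lambda>s. (norm (V s))\<^sup>2) has_vector_derivative ?D s) (at s within {x..y})"
        by (simp add: power2_norm_eq_inner has_vector_derivative_at_within)
    qed
    have "(norm (V y))\<^sup>2 - (norm (V x))\<^sup>2 \<le> integral {x..y} ?w"
      using Dw by (intro has_integral_le[OF F integrable_integral[OF wi]]) (meson abs_le_D1)
    moreover have "- ((norm (V y))\<^sup>2 - (norm (V x))\<^sup>2) \<le> integral {x..y} ?w"
      using Dw by (intro has_integral_le[OF has_integral_neg[OF F] integrable_integral[OF wi]])
          (meson abs_le_D2)
    moreover have "integral {x..y} ?w \<le> integral {a..b} ?w"
      using that wi w0 by (intro integral_subset_le) auto
    ultimately show ?thesis by linarith
  qed
  have diff': "(norm (V r))\<^sup>2 \<le> (norm (V s))\<^sup>2 + integral {a..b} ?w" if s: "s \<in> {a..b}" for s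
    using diff[of r s] diff[of s r] r s by (cases "r \<le> s") auto
  have vi: "(\<lambda>s. (norm (V s))\<^sup>2) integrable_on {a..b}"
    by (intro integrable_continuous_interval continuous_intros cV2)
  have "(b - a) * (norm (V r))\<^sup>2 = integral {a..b} (\<lambda>s. (norm (V r))\<^sup>2)"
    using \<open>a < b\<close> by simp
  also have "\<dots> \<le> integral {a..b} (\<lambda>s. (norm (V s))\<^sup>2 + integral {a..b} ?w)"
    using vi diff' by (intro integral_le integrable_add) auto
  also have "\<dots> = integral {a..b} (\<lambda>s. (norm (V s))\<^sup>2) + (b - a) * integral {a..b} ?w"
    using vi \<open>a < b\<close> by (subst integral_add) auto
  finally have "(norm (V r))\<^sup>2 \<le> integral {a..b} (\<lambda>s. (norm (V s))\<^sup>2) / (b - a) + integral {a..b} ?w"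
    using \<open>a < b\<close> by (simp add: field_simps)
  also have "integral {a..b} (\<lambda>s. (norm (V s))\<^sup>2) / (b - a) \<le> integral {a..b} (\<lambda>s. (norm (V s))\<^sup>2) * N"
  proof -
    have "1 / (b - a) \<le> N" using ab N \<open>a < b\<close> by (simp add: field_simps)
    moreover have "0 \<le> integral {a..b} (\<lambda>s. (norm (V s))\<^sup>2)" using vi by (intro integral_nonneg) auto
    ultimately have "integral {a..b} (\<lambda>s. (norm (V s))\<^sup>2) * (1 / (b - a))
        \<le> integral {a..b} (\<lambda>s. (norm (V s))\<^sup>2) * N"
      by (rule mult_left_mono)
    then show ?thesis by simp
  qed
  also have "integral {a..b} (\<lambda>s. (norm (V s))\<^sup>2) * N = integral {a..b} (\<lambda>s. (norm (V s))\<^sup>2 * N)"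
    by (simp only: integral_mult_left)
  also have "integral {a..b} (\<lambda>s. (norm (V s))\<^sup>2 * N) + integral {a..b} ?w
     = integral {a..b} (\<lambda>s. (norm (V s))\<^sup>2 * N + ?w s)"
    by (intro integral_add[symmetric] wi integrable_continuous_interval continuous_intros cV2)
  also have "(\<lambda>s. (norm (V s))\<^sup>2 * N + ?w s) = (\<lambda>s. 2 * N * (norm (V s))\<^sup>2 + (norm (V' s))\<^sup>2 / N)"
    by (auto simp: algebra_simps)
  finally have le: "(norm (V r))\<^sup>2 \<le> integral {a..b} (\<lambda>s. 2 * N * (norm (V s))\<^sup>2 + (norm (V' s))\<^sup>2 / N)"
    by simp
  have "((\<lambda>s. 2 * N * (norm (V s))\<^sup>2 + (norm (V' s))\<^sup>2 / N) has_integral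
      integral {a..b} (\<lambda>s. 2 * N * (norm (V s))\<^sup>2 + (norm (V' s))\<^sup>2 / N)) {a..b}"
    using N by (intro integrable_integral integrable_continuous_interval continuous_intros cV2) auto
  from nn_integral_has_integral_lebesgue'[OF _ this]
  have "(\<integral>\<^sup>+s\<in>{a..b}. ennreal (2 * N * (norm (V s))\<^sup>2 + (norm (V' s))\<^sup>2 / N) \<partial>lborel)
      = ennreal (integral {a..b} (\<lambda>s. 2 * N * (norm (V s))\<^sup>2 + (norm (V' s))\<^sup>2 / N))"
    using N by auto
  then show ?thesis using le by (simp add: ennreal_leI)
qed

section \<open>Waves of bounded frequency\<close>

text \<open>The half-wave evolution of the inverse Fourier transform of \<open>g\<close>, without the factor
\<open>1 / (2 * pi)\<^sup>2\<close>.\<close>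

definition wave :: "(real^2 \<Rightarrow> complex) \<Rightarrow> real \<Rightarrow> real^2 \<Rightarrow> complex" where
  "wave g t x = (LINT \<xi>|lborel. cis (x \<bullet> \<xi> - t * norm \<xi>) * g \<xi>)"

definition band_limited :: "real \<Rightarrow> (real^2 \<Rightarrow> complex) \<Rightarrow> bool" where
  "band_limited N g \<longleftrightarrow> integrable lborel g \<and> (\<forall>\<xi>. N < norm \<xi> \<longrightarrow> g \<xi> = 0)"

text \<open>On the Fourier side, the partial derivative in direction \<open>i\<close>.\<close>

definition grad_symbol :: "2 \<Rightarrow> (real^2 \<Rightarrow> complex) \<Rightarrow> real^2 \<Rightarrow> complex" where
  "grad_symbol i g = (\<lambda>\<xi>. \<i> * (complex_of_real (\<xi> $ i) * g \<xi>))"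

abbreviation mass :: "(real^2 \<Rightarrow> complex) \<Rightarrow> ennreal" where
  "mass g \<equiv> (\<integral>\<^sup>+\<xi>. nsq (g \<xi>) \<partial>lborel)"

lemma band_integrable: "band_limited N g \<Longrightarrow> integrable lborel g"
  and band_measurable [measurable_dest]: "band_limited N g \<Longrightarrow> g \<in> borel_measurable borel"
  by (auto simp: band_limited_def)

lemma band_mult:
  assumes g: "band_limited N g" and m [measurable]: "m \<in> borel_measurable borel"
    and bd: "\<And>\<xi>. norm \<xi> \<le> N \<Longrightarrow> norm (m \<xi>) \<le> M"
  shows "band_limited N (\<lambda>\<xi>. m \<xi> * g \<xi>)"
proof -
  have [measurable]: "g \<in> borel_measurable borel" using g by (rule band_measurable)
  have "integrable lborel (\<lambda>\<xi>. m \<xi> * g \<xi>)"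
  proof (rule Bochner_Integration.integrable_bound)
    show "integrable lborel (\<lambda>\<xi>. M * norm (g \<xi>))"
      using band_integrable[OF g] by auto
    show "AE \<xi> in lborel. norm (m \<xi> * g \<xi>) \<le> norm (M * norm (g \<xi>))"
    proof (rule AE_I2)
      fix \<xi>
      show "norm (m \<xi> * g \<xi>) \<le> norm (M * norm (g \<xi>))"
      proof (cases "norm \<xi> \<le> N")
        case True
        then show ?thesis using bd[OF True]
          by (auto simp: norm_mult abs_mult intro!: mult_right_mono)
      next
        case False
        then show ?thesis using g by (auto simp: band_limited_def)
      qed
    qed
  qed measurable
  then show ?thesis using g by (auto simp: band_limited_def)
qed

lemma band_dmul:
  assumes "band_limited N g" shows "band_limited N (grad_symbol i g)"
proof -
  have "band_limited N (\<lambda>\<xi>. (\<i> * complex_of_real (\<xi> $ i)) * g \<xi>)"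
    by (rule band_mult[OF assms, where M=N])
       (auto simp: norm_mult intro: order_trans[OF component_le_norm_cart])
  then show ?thesis by (simp add: grad_symbol_def mult.assoc)
qed

lemma mass_dmul_le:
  assumes g: "band_limited N g"
  shows "mass (grad_symbol 1 g) + mass (grad_symbol 2 g) \<le> ennreal (N\<^sup>2) * mass g"
proof -
  have [measurable]: "g \<in> borel_measurable borel" using g by (rule band_measurable)
  have [measurable]: "grad_symbol i g \<in> borel_measurable borel" for i using band_dmul[OF g]
      by (rule band_measurable)
  have "mass (grad_symbol 1 g) + mass (grad_symbol 2 g)
      = (\<integral>\<^sup>+\<xi>. nsq (grad_symbol 1 g \<xi>) + nsq (grad_symbol 2 g \<xi>) \<partial>lborel)"
    by (rule nn_integral_add[symmetric]) measurable
  also have "\<dots> \<le> (\<integral>\<^sup>+\<xi>. ennreal (N\<^sup>2) * nsq (g \<xi>) \<partial>lborel)"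
  proof (rule nn_integral_mono)
    fix \<xi> :: "real^2"
    have "(norm (grad_symbol 1 g \<xi>))\<^sup>2 + (norm (grad_symbol 2 g \<xi>))\<^sup>2 = (norm \<xi>)\<^sup>2 * (norm (g \<xi>))\<^sup>2"
      by (simp add: grad_symbol_def norm_mult power_mult_distrib norm_pt algebra_simps)
    also have "\<dots> \<le> N\<^sup>2 * (norm (g \<xi>))\<^sup>2"
      using g by (cases "norm \<xi> \<le> N") (auto simp: band_limited_def intro!: mult_right_mono power_mono)
    finally show "nsq (grad_symbol 1 g \<xi>) + nsq (grad_symbol 2 g \<xi>) \<le> ennreal (N\<^sup>2) * nsq (g \<xi>)"
      by (simp add: ennreal_mult[symmetric] ennreal_plus[symmetric] ennreal_leI del: ennreal_plus)
  qed
  also have "\<dots> = ennreal (N\<^sup>2) * mass g"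
    by (rule nn_integral_cmult) measurable
  finally show ?thesis .
qed

lemma wave_measurable [measurable (raw)]:
  assumes [measurable]: "g \<in> borel_measurable borel" "f \<in> borel_measurable M" "h \<in> borel_measurable M"
  shows "(\<lambda>z. wave g (f z) (h z)) \<in> borel_measurable M"
  unfolding wave_def by measurable

lemma norm_wave_le: "integrable lborel g \<Longrightarrow> norm (wave g t x) \<le> (LINT \<xi>|lborel. norm (g \<xi>))"
  unfolding wave_def by (rule order_trans[OF integral_norm_bound]) (simp add: norm_mult)

lemma wave_energy:
  assumes g: "integrable lborel g"
  shows "(\<integral>\<^sup>+x. nsq (wave g t x) \<partial>lborel) \<le> ennreal ((2 * pi)\<^sup>2) * mass g"
proof -
  have [measurable]: "g \<in> borel_measurable borel" using g by auto
  have "integrable lborel (\<lambda>\<xi>. cis (- (t * norm \<xi>)) * g \<xi>)"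
    by (rule Bochner_Integration.integrable_bound[OF g]) (auto simp: norm_mult)
  from plancherel_plane[OF this] show ?thesis
    by (simp add: wave_def norm_mult mult.assoc[symmetric] cis_mult)
qed

lemma wave_line_derivative:
  assumes g: "band_limited N g"
  shows "((\<lambda>r. wave g t (x0 + r *\<^sub>R e)) has_vector_derivative
      (e $ 1 * wave (grad_symbol 1 g) t (x0 + r *\<^sub>R e) + e $ 2 * wave (grad_symbol 2 g) t (x0 + r *\<^sub>R e)))
          (at r)"
proof -
  have [measurable]: "g \<in> borel_measurable borel" using g by (rule band_measurable)
  let ?h = "\<lambda>\<xi>. cis (x0 \<bullet> \<xi> - t * norm \<xi>) * g \<xi>"
  have h: "band_limited N ?h"
    by (rule band_mult[OF g, where M=1]) auto
  have c1: "norm (complex_of_real (e \<bullet> \<xi>)) \<le> norm e * N" if "norm \<xi> \<le> N" for \<xi>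
  proof -
    have "\<bar>e \<bullet> \<xi>\<bar> \<le> norm e * norm \<xi>" by (rule Cauchy_Schwarz_ineq2)
    also have "\<dots> \<le> norm e * N" using that by (intro mult_left_mono) auto
    finally show ?thesis by simp
  qed
  have ch: "band_limited N (\<lambda>\<xi>. complex_of_real (e \<bullet> \<xi>) * ?h \<xi>)"
    by (rule band_mult[OF h _ c1]) auto
  have cch: "band_limited N (\<lambda>\<xi>. complex_of_real (e \<bullet> \<xi>) * (complex_of_real (e \<bullet> \<xi>) * ?h \<xi>))"
    by (rule band_mult[OF ch _ c1]) auto
  have d: "band_limited N (grad_symbol i g)" for i by (rule band_dmul[OF g])
  have [measurable]: "grad_symbol i g \<in> borel_measurable borel" for i using d by (rule band_measurable)
  have i: "integrable lborel (\<lambda>\<xi>. cis ((x0 + r *\<^sub>R e) \<bullet> \<xi> - t * norm \<xi>) * grad_symbol i g \<xi>)" for r i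
    by (rule Bochner_Integration.integrable_bound[OF band_integrable[OF d]]) (auto simp: norm_mult)
  have eq: "cis ((x0 + r *\<^sub>R e) \<bullet> \<xi> - t * norm \<xi>) * g \<xi> = cis (r * (e \<bullet> \<xi>)) * ?h \<xi>" for r \<xi>
  proof -
    have "(x0 + r *\<^sub>R e) \<bullet> \<xi> - t * norm \<xi> = r * (e \<bullet> \<xi>) + (x0 \<bullet> \<xi> - t * norm \<xi>)"
      by (simp add: inner_add_left)
    then show ?thesis by (simp only: cis_mult[symmetric] mult.assoc)
  qed
  have "cis (r * (e \<bullet> \<xi>)) * (\<i> * ((e \<bullet> \<xi>) * ?h \<xi>))
      = e $ 1 * (cis ((x0 + r *\<^sub>R e) \<bullet> \<xi> - t * norm \<xi>) * grad_symbol 1 g \<xi>) + e $ 2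
        * (cis ((x0 + r *\<^sub>R e) \<bullet> \<xi> - t * norm \<xi>) * grad_symbol 2 g \<xi>)" for r \<xi>
  proof -
    have "cis (r * (e \<bullet> \<xi>)) * (\<i> * ((e \<bullet> \<xi>) * ?h \<xi>)) = (\<i> * (e \<bullet> \<xi>)) * (cis (r * (e \<bullet> \<xi>)) * ?h \<xi>)"
      by simp
    also have "\<dots> = (\<i> * (e \<bullet> \<xi>)) * (cis ((x0 + r *\<^sub>R e) \<bullet> \<xi> - t * norm \<xi>) * g \<xi>)"
      by (simp only: eq)
    finally show ?thesis by (simp add: grad_symbol_def inner_pt[of e] algebra_simps)
  qed
  then have "(LINT \<xi>|lborel. cis (r * (e \<bullet> \<xi>)) * (\<i> * ((e \<bullet> \<xi>) * ?h \<xi>)))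
      = e $ 1 * wave (grad_symbol 1 g) t (x0 + r *\<^sub>R e) + e $ 2 * wave (grad_symbol 2 g) t (x0 + r *\<^sub>R e)" for r
    using i by (simp add: wave_def)
  then show ?thesis
    using has_vector_derivative_oscillatory[of "\<lambda>\<xi>. e \<bullet> \<xi>" ?h r] band_integrable[OF h]
        band_integrable[OF ch] band_integrable[OF cch]
    by (simp add: wave_def eq power2_eq_square mult.assoc)
qed

text \<open>The density that controls the oscillation of \<open>wave g t\<close> at the scale \<open>1 / N\<close>; the two terms have
the same size if \<open>g\<close> lives at frequencies of size \<open>N\<close>.\<close>

definition energy_density :: "real \<Rightarrow> (real^2 \<Rightarrow> complex) \<Rightarrow> real \<Rightarrow> real^2 \<Rightarrow> real" where
  "energy_density N g t x = 2 * N * (norm (wave g t x))\<^sup>2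
     + ((norm (wave (grad_symbol 1 g) t x))\<^sup>2 + (norm (wave (grad_symbol 2 g) t x))\<^sup>2) / N"

text \<open>The derivative along the line is \<open>e \<bullet> \<nabla>\<close>, and the gradient commutes with the evolution.\<close>

lemma sobolev_wave_line:
  assumes g: "band_limited N g" and N: "0 < N" and ab: "1 / N \<le> b - a" and r: "r \<in> {a..b}" and e: "norm e \<le> 1"
  shows "nsq (wave g t (x0 + r *\<^sub>R e)) \<le> (\<integral>\<^sup>+s\<in>{a..b}. ennreal (energy_density N g t (x0 + s *\<^sub>R e)) \<partial>lborel)"
proof -
  let ?V' = "\<lambda>r. e $ 1 * wave (grad_symbol 1 g) t (x0 + r *\<^sub>R e) + e $ 2
      * wave (grad_symbol 2 g) t (x0 + r *\<^sub>R e)"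
  have c: "continuous_on UNIV (\<lambda>r. wave (grad_symbol i g) t (x0 + r *\<^sub>R e))" for i
    by (intro continuous_at_imp_continuous_on ballI
        has_vector_derivative_continuous[OF wave_line_derivative[OF band_dmul[OF g]]])
  have "continuous_on UNIV ?V'"
    by (intro continuous_intros c)
  from sobolev_line[OF wave_line_derivative[OF g] this N ab r]
  have "nsq (wave g t (x0 + r *\<^sub>R e))
      \<le> (\<integral>\<^sup>+s\<in>{a..b}. ennreal (2 * N * (norm (wave g t (x0 + s *\<^sub>R e)))\<^sup>2 + (norm (?V' s))\<^sup>2 / N) \<partial>lborel)" .
  also have "\<dots> \<le> (\<integral>\<^sup>+s\<in>{a..b}. ennreal (energy_density N g t (x0 + s *\<^sub>R e)) \<partial>lborel)"
  proof (intro nn_integral_mono mult_right_mono ennreal_leI)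
    fix s
    let ?a = "norm (wave (grad_symbol 1 g) t (x0 + s *\<^sub>R e))" and ?b
        = "norm (wave (grad_symbol 2 g) t (x0 + s *\<^sub>R e))"
    have "norm (?V' s) \<le> \<bar>e $ 1\<bar> * ?a + \<bar>e $ 2\<bar> * ?b"
      using norm_triangle_ineq[of "e $ 1 * wave (grad_symbol 1 g) t (x0 + s *\<^sub>R e)" "e $ 2
          * wave (grad_symbol 2 g) t (x0 + s *\<^sub>R e)"]
      by (simp add: norm_mult)
    then have "(norm (?V' s))\<^sup>2 \<le> (\<bar>e $ 1\<bar> * ?a + \<bar>e $ 2\<bar> * ?b)\<^sup>2"
      by (intro power_mono) auto
    also have "\<dots> \<le> ((e $ 1)\<^sup>2 + (e $ 2)\<^sup>2) * (?a\<^sup>2 + ?b\<^sup>2)"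
      using sum_squares_bound[of "\<bar>e $ 1\<bar> * ?b" "\<bar>e $ 2\<bar> * ?a"]
      by (simp add: power2_sum power_mult_distrib algebra_simps)
    also have "\<dots> \<le> 1 * (?a\<^sup>2 + ?b\<^sup>2)"
      using e by (intro mult_right_mono) (auto simp: norm_pt)
    finally show "2 * N * (norm (wave g t (x0 + s *\<^sub>R e)))\<^sup>2 + (norm (?V' s))\<^sup>2 / N
        \<le> energy_density N g t (x0 + s *\<^sub>R e)"
      using N by (simp add: energy_density_def divide_right_mono)
  qed simp
  finally show ?thesis .
qed

section \<open>The energy in an annulus\<close>

definition polar :: "real \<times> real \<Rightarrow> real^2" where
  "polar p = pt (snd p * cos (fst p)) (snd p * sin (fst p))"

definition annulus :: "real \<Rightarrow> real \<Rightarrow> real \<times> real \<Rightarrow> ennreal" where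
  "annulus a b p = indicator {0..2*pi} (fst p) * indicator {a..b} (snd p)"

definition shell :: "real \<Rightarrow> (real^2 \<Rightarrow> complex) \<Rightarrow> real \<Rightarrow> real \<Rightarrow> real \<Rightarrow> ennreal" where
  "shell N g a b t = (\<integral>\<^sup>+p. annulus a b p * ennreal (energy_density N g t (polar p)) \<partial>(lborel \<Otimes>\<^sub>M lborel))"

lemma measurable_polar [measurable]: "polar \<in> borel_measurable (borel \<Otimes>\<^sub>M borel)"
  and measurable_annulus [measurable]: "annulus a b \<in> borel_measurable (borel \<Otimes>\<^sub>M borel)"
  unfolding polar_def[abs_def] annulus_def[abs_def] by measurable

lemma norm_polar: "norm (polar p) = \<bar>snd p\<bar>"
proof -
  have "(snd p * cos (fst p))\<^sup>2 + (snd p * sin (fst p))\<^sup>2 = (snd p)\<^sup>2 * ((cos (fst p))\<^sup>2 + (sin (fst p))\<^sup>2)"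
    by (simp only: power_mult_distrib distrib_left)
  then show ?thesis by (simp add: polar_def norm_pt)
qed

lemma edens_measurable [measurable (raw)]:
  assumes "band_limited N g" and [measurable]: "f \<in> borel_measurable M" "h \<in> borel_measurable M"
  shows "(\<lambda>z. energy_density N g (f z) (h z)) \<in> borel_measurable M"
proof -
  have [measurable]: "g \<in> borel_measurable borel" "grad_symbol i g \<in> borel_measurable borel" for i
    using assms(1) band_dmul[OF assms(1)] by (auto intro: band_measurable)
  show ?thesis unfolding energy_density_def by measurable
qed

text \<open>The gradient of a wave with frequencies up to \<open>N\<close> has at most \<open>N\<^sup>2\<close> times the mass.  So a bound for the
square integral that is uniform in the wave costs a factor \<open>2 * N + N\<^sup>2 / N\<close> for the energy density.\<close>

lemma nn_integral_edens_le:
  assumes g: "band_limited N g" and N: "0 < N" and c: "0 \<le> c"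
    and [measurable]: "w \<in> borel_measurable M" "T \<in> borel_measurable M" "X \<in> borel_measurable M"
    and le: "\<And>h. h = g \<or> h = grad_symbol 1 g \<or> h = grad_symbol 2 g \<Longrightarrow>
      (\<integral>\<^sup>+z. w z * nsq (wave h (T z) (X z)) \<partial>M) \<le> ennreal c * mass h"
  shows "(\<integral>\<^sup>+z. w z * ennreal (energy_density N g (T z) (X z)) \<partial>M) \<le> ennreal (3 * N * c) * mass g"
proof -
  have [measurable]: "g \<in> borel_measurable borel" "grad_symbol i g \<in> borel_measurable borel" for i
    using g band_dmul[OF g] by (auto intro: band_measurable)
  define Q where "Q = (\<lambda>h z. w z * nsq (wave h (T z) (X z)))"
  have [measurable]: "Q g \<in> borel_measurable M" "Q (grad_symbol i g) \<in> borel_measurable M" for i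
    unfolding Q_def by measurable
  have "w z * ennreal (energy_density N g (T z) (X z)) = ennreal (2 * N) * Q g z + ennreal (1 / N)
      * (Q (grad_symbol 1 g) z + Q (grad_symbol 2 g) z)" for z
  proof -
    let ?a = "(norm (wave g (T z) (X z)))\<^sup>2" and ?b = "(norm (wave (grad_symbol 1 g) (T z) (X z)))\<^sup>2"
      and ?c = "(norm (wave (grad_symbol 2 g) (T z) (X z)))\<^sup>2"
    have "energy_density N g (T z) (X z) = 2 * N * ?a + 1 / N * (?b + ?c)"
      by (simp add: energy_density_def)
    then have "ennreal (energy_density N g (T z) (X z))
        = ennreal (2 * N) * ennreal ?a + ennreal (1 / N) * (ennreal ?b + ennreal ?c)"
      using N by (simp only: ennreal_plus ennreal_mult zero_le_power2 mult_nonneg_nonneg add_nonneg_nonneg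
          less_imp_le zero_less_divide_1_iff zero_le_numeral)
    then show ?thesis by (simp only: Q_def distrib_left mult.left_commute[of "w z"])
  qed
  then have "(\<integral>\<^sup>+z. w z * ennreal (energy_density N g (T z) (X z)) \<partial>M)
      = (\<integral>\<^sup>+z. ennreal (2 * N) * Q g z + ennreal (1 / N) * (Q (grad_symbol 1 g) z + Q (grad_symbol 2 g) z) \<partial>M)"
    by simp
  also have "\<dots> = ennreal (2 * N) * (\<integral>\<^sup>+z. Q g z \<partial>M) + ennreal (1 / N)
      * ((\<integral>\<^sup>+z. Q (grad_symbol 1 g) z \<partial>M) + (\<integral>\<^sup>+z. Q (grad_symbol 2 g) z \<partial>M))"
    by (simp add: nn_integral_add nn_integral_cmult)
  also have "\<dots> \<le> ennreal (2 * N) * (ennreal c * mass g) + ennreal (1 / N)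
      * (ennreal c * mass (grad_symbol 1 g) + ennreal c * mass (grad_symbol 2 g))"
    using le by (intro add_mono mult_left_mono) (auto simp: Q_def)
  also have "\<dots> = ennreal (2 * N * c) * mass g + ennreal (1 / N * c)
      * (mass (grad_symbol 1 g) + mass (grad_symbol 2 g))"
    using N c by (simp only: distrib_left[symmetric] mult.assoc[symmetric] ennreal_mult'' )
  also have "\<dots> \<le> ennreal (2 * N * c) * mass g + ennreal (1 / N * c) * (ennreal (N\<^sup>2) * mass g)"
    by (intro add_mono mult_left_mono mass_dmul_le[OF g]) auto
  also have "\<dots> = (ennreal (2 * N * c) + ennreal (1 / N * c * N\<^sup>2)) * mass g"
    using N c by (simp only: distrib_right mult.assoc[symmetric] ennreal_mult'' zero_le_power2)
  also have "ennreal (2 * N * c) + ennreal (1 / N * c * N\<^sup>2) = ennreal (3 * N * c)"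
    using N c by (simp add: ennreal_plus[symmetric] power2_eq_square del: ennreal_plus)
  finally show ?thesis .
qed

text \<open>The right-hand side does not depend on \<open>r\<close>: this is how the supremum over the radii is
controlled.\<close>

lemma circle_le_shell:
  assumes g: "band_limited N g" and N: "0 < N" and ab: "1 / N \<le> b - a" and r: "r \<in> {a..b}"
  shows "(\<integral>\<^sup>+\<theta>\<in>{0..2*pi}. nsq (wave g t (polar (\<theta>, r))) \<partial>lborel) \<le> shell N g a b t"
proof -
  have "(\<integral>\<^sup>+\<theta>\<in>{0..2*pi}. nsq (wave g t (polar (\<theta>, r))) \<partial>lborel)
     \<le> (\<integral>\<^sup>+\<theta>. \<integral>\<^sup>+s. annulus a b (\<theta>, s) * ennreal (energy_density N g t (polar (\<theta>, s))) \<partial>lborel \<partial>lborel)"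
  proof (rule nn_integral_mono)
    fix \<theta> :: real
    have e: "0 + s *\<^sub>R pt (cos \<theta>) (sin \<theta>) = polar (\<theta>, s)" for s
      by (simp add: polar_def vec_eq_iff forall_2)
    have n: "norm (pt (cos \<theta>) (sin \<theta>)) \<le> 1" by (simp add: norm_pt)
    show "nsq (wave g t (polar (\<theta>, r))) * indicator {0..2*pi} \<theta>
       \<le> (\<integral>\<^sup>+s. annulus a b (\<theta>, s) * ennreal (energy_density N g t (polar (\<theta>, s))) \<partial>lborel)"
      using sobolev_wave_line[OF g N ab r n, of t 0] unfolding e
      by (auto simp: annulus_def mult.commute split: split_indicator)
  qed
  also have "\<dots> = shell N g a b t"
    unfolding shell_def using g by (intro lborel.nn_integral_fst) measurable
  finally show ?thesis .
qed

text \<open>In polar coordinates \<open>d\<theta> dr = dx / norm x\<close>, and \<open>norm x \<ge> a\<close> in the annulus.\<close>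

lemma nn_integral_annulus_le:
  assumes [measurable]: "D \<in> borel_measurable borel" and a: "0 < a"
  shows "(\<integral>\<^sup>+p. annulus a b p * D (polar p) \<partial>(lborel \<Otimes>\<^sub>M lborel))
     \<le> ennreal (5 / a) * (\<integral>\<^sup>+x\<in>{x. norm x \<le> b}. D x \<partial>lborel)"
proof -
  let ?D = "\<lambda>x::real^2. D x * indicator {x. norm x \<le> b} x"
  have "(\<integral>\<^sup>+p. annulus a b p * D (polar p) \<partial>(lborel \<Otimes>\<^sub>M lborel))
     = (\<integral>\<^sup>+\<theta>. \<integral>\<^sup>+r. annulus a b (\<theta>, r) * D (polar (\<theta>, r)) \<partial>lborel \<partial>lborel)"
    by (intro lborel.nn_integral_fst[symmetric]) measurable
  also have "\<dots> \<le> (\<integral>\<^sup>+\<theta>. \<integral>\<^sup>+r. ennreal (1 / a) * (?D (pt (r * cos \<theta>) (r * sin \<theta>)) * ennreal r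
      * indicator {0<..} r * indicator {0..2*pi} \<theta>) \<partial>lborel \<partial>lborel)"
  proof (intro nn_integral_mono)
    fix \<theta> r :: real
    show "annulus a b (\<theta>, r) * D (polar (\<theta>, r)) \<le> ennreal (1 / a)
        * (?D (pt (r * cos \<theta>) (r * sin \<theta>)) * ennreal r * indicator {0<..} r * indicator {0..2*pi} \<theta>)"
    proof (cases "\<theta> \<in> {0..2*pi} \<and> r \<in> {a..b}")
      case True
      have "1 \<le> ennreal (1 / a) * ennreal r"
        using True a by (simp add: ennreal_mult'[symmetric])
      then have "1 * D (polar (\<theta>, r)) \<le> (ennreal (1 / a) * ennreal r) * D (polar (\<theta>, r))"
        by (rule mult_right_mono) simp
      moreover have "norm (polar (\<theta>, r)) \<le> b" using True a by (simp add: norm_polar)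
      ultimately show ?thesis using True a by (simp add: annulus_def polar_def mult_ac)
    qed (auto simp: annulus_def)
  qed
  also have "\<dots> = ennreal (1 / a) * (\<integral>\<^sup>+\<theta>. (\<integral>\<^sup>+r. ?D (pt (r * cos \<theta>) (r * sin \<theta>)) * ennreal r
      * indicator {0<..} r \<partial>lborel) * indicator {0..2*pi} \<theta> \<partial>lborel)"
    by (simp add: nn_integral_cmult nn_integral_multc)
  also have "\<dots> \<le> ennreal (1 / a) * (5 * (\<integral>\<^sup>+x. ?D x \<partial>lborel))"
    by (intro mult_left_mono nn_integral_polar_le) auto
  also have "\<dots> = ennreal (5 / a) * (\<integral>\<^sup>+x. ?D x \<partial>lborel)"
  proof -
    have "ennreal (1 / a) * 5 = ennreal (5 / a)"
      using a ennreal_mult[of "1/a" 5] by simp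
    then show ?thesis by (simp only: mult.assoc[symmetric])
  qed
  finally show ?thesis .
qed

lemma nn_integral_annulus_const:
  assumes "a \<le> b"
  shows "(\<integral>\<^sup>+p. annulus a b p * c \<partial>(lborel \<Otimes>\<^sub>M lborel)) = ennreal (2 * pi * (b - a)) * c"
proof -
  have "(\<integral>\<^sup>+p. annulus a b p * c \<partial>(lborel \<Otimes>\<^sub>M lborel)) = (\<integral>\<^sup>+p. annulus a b p \<partial>(lborel \<Otimes>\<^sub>M lborel)) * c"
    by (rule nn_integral_multc) measurable
  also have "(\<integral>\<^sup>+p. annulus a b p \<partial>(lborel \<Otimes>\<^sub>M lborel)) = (\<integral>\<^sup>+\<theta>. \<integral>\<^sup>+r. annulus a b (\<theta>, r) \<partial>lborel \<partial>lborel)"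
    by (intro lborel.nn_integral_fst[symmetric]) measurable
  also have "\<dots> = ennreal (2 * pi * (b - a))"
    using assms by (simp add: annulus_def nn_integral_cmult nn_integral_multc ennreal_mult'[symmetric]
        mult.commute)
  finally show ?thesis .
qed

section \<open>Smoothing effects\<close>

definition plane_point :: "2 \<Rightarrow> real \<Rightarrow> real \<Rightarrow> real^2" where
  "plane_point i y z = (if i = 1 then pt y z else pt z y)"

lemma measurable_place [measurable (raw)]:
  assumes [measurable]: "f \<in> borel_measurable M" "g \<in> borel_measurable M"
  shows "(\<lambda>x. plane_point i (f x) (g x)) \<in> borel_measurable M"
  unfolding plane_point_def by (cases "i = 1") simp_all

text \<open>Freezing one space variable only multiplies \<open>h\<close> by a factor of modulus one.\<close>

lemma wave_cone_slice:
  assumes h: "integrable lborel h" and supp: "\<And>\<xi>. \<xi> \<notin> cone i \<Longrightarrow> h \<xi> = 0"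
  shows "(\<integral>\<^sup>+y. \<integral>\<^sup>+t. nsq (wave h t (plane_point i y z)) \<partial>lborel \<partial>lborel)
    \<le> ennreal (16 * pi\<^sup>2) * mass h"
proof -
  define j :: 2 where "j = (if i = 1 then 2 else 1)"
  have [measurable]: "h \<in> borel_measurable borel" using h by auto
  have i: "integrable lborel (\<lambda>\<xi>. cis (z * \<xi> $ j) * h \<xi>)"
    by (rule Bochner_Integration.integrable_bound[OF h]) (auto simp: norm_mult)
  have "wave h t (plane_point i y z) = (LINT \<xi>|lborel. cis (y * \<xi> $ i - t * norm \<xi>)
      * (cis (z * \<xi> $ j) * h \<xi>))" for y t
    unfolding wave_def
  proof (rule Bochner_Integration.integral_cong)
    fix \<xi> :: "real^2"
    have "plane_point i y z \<bullet> \<xi> - t * norm \<xi> = (y * \<xi> $ i - t * norm \<xi>) + z * \<xi> $ j"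
      using exhaust_2[of i] by (auto simp: plane_point_def j_def inner_pt)
    then show "cis (plane_point i y z \<bullet> \<xi> - t * norm \<xi>) * h \<xi>
        = cis (y * \<xi> $ i - t * norm \<xi>) * (cis (z * \<xi> $ j) * h \<xi>)"
      by (simp only: cis_mult[symmetric] mult.assoc)
  qed simp
  then show ?thesis
    using plancherel_cone[OF i, of i] supp by (simp add: norm_mult)
qed

lemma wave_add:
  assumes "integrable lborel g" "integrable lborel h"
  shows "wave (\<lambda>\<xi>. g \<xi> + h \<xi>) t x = wave g t x + wave h t x"
proof -
  have "integrable lborel (\<lambda>\<xi>. cis (x \<bullet> \<xi> - t * norm \<xi>) * k \<xi>)" if "integrable lborel k" for k
    by (rule Bochner_Integration.integrable_bound[OF that]) (use that in \<open>auto simp: norm_mult\<close>)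
  then show ?thesis using assms by (simp add: wave_def distrib_left)
qed

text \<open>The parts are the restrictions of \<open>h\<close> to \<open>cone 1\<close> and to its complement, which lies in
\<open>cone 2\<close>.\<close>

lemma cone_decomposition:
  assumes h: "band_limited N h"
  obtains h1 h2 where "band_limited N h1" "band_limited N h2" "\<And>\<xi>. \<xi> \<notin> cone 1 \<Longrightarrow> h1 \<xi>
      = 0" "\<And>\<xi>. \<xi> \<notin> cone 2 \<Longrightarrow> h2 \<xi> = 0"
    "mass h1 \<le> mass h" "mass h2 \<le> mass h"
    "\<And>t x. nsq (wave h t x) \<le> 2 * nsq (wave h1 t x) + 2 * nsq (wave h2 t x)"
proof
  let ?h1 = "\<lambda>\<xi>. indicator (cone 1) \<xi> * h \<xi>" and ?h2 = "\<lambda>\<xi>. indicator (- cone 1) \<xi> * h \<xi>"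
  show b: "band_limited N ?h1" "band_limited N ?h2"
    by (rule band_mult[OF h, where M=1]; auto split: split_indicator)+
  show "\<And>\<xi>. \<xi> \<notin> cone 1 \<Longrightarrow> ?h1 \<xi> = 0" "\<And>\<xi>. \<xi> \<notin> cone 2 \<Longrightarrow> ?h2 \<xi> = 0"
    using cone_Un by (auto split: split_indicator)
  show "mass ?h1 \<le> mass h" "mass ?h2 \<le> mass h"
    by (intro nn_integral_mono; auto split: split_indicator)+
  have "h = (\<lambda>\<xi>. ?h1 \<xi> + ?h2 \<xi>)" by (auto split: split_indicator)
  then have w: "wave h t x = wave ?h1 t x + wave ?h2 t x" for t x
    using wave_add[OF band_integrable[OF b(1)] band_integrable[OF b(2)], of t x] by simp
  show "nsq (wave h t x) \<le> 2 * nsq (wave ?h1 t x) + 2 * nsq (wave ?h2 t x)" for t x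
  proof -
    let ?a = "norm (wave ?h1 t x)" and ?b = "norm (wave ?h2 t x)"
    have "(norm (wave h t x))\<^sup>2 \<le> (?a + ?b)\<^sup>2"
      unfolding w by (intro power_mono norm_triangle_ineq) auto
    also have "\<dots> \<le> 2 * ?a\<^sup>2 + 2 * ?b\<^sup>2"
      using sum_squares_bound[of ?a ?b] by (simp add: power2_sum)
    finally have "nsq (wave h t x) \<le> ennreal (2 * ?a\<^sup>2 + 2 * ?b\<^sup>2)" by (rule ennreal_leI)
    then show ?thesis by (simp add: ennreal_mult)
  qed
qed

text \<open>On each cone all slices satisfy the same bound, and only those at a height between \<open>- b\<close> and \<open>b\<close> matter.\<close>

lemma local_smoothing:
  assumes h: "band_limited N h" and b: "0 \<le> b"
  shows "(\<integral>\<^sup>+t. (\<integral>\<^sup>+x\<in>{x. norm x \<le> b}. nsq (wave h t x) \<partial>lborel) \<partial>lborel) \<le> ennreal (128 * pi\<^sup>2 * b) * mass h"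
proof -
  have cone: "(\<integral>\<^sup>+t. \<integral>\<^sup>+x. nsq (wave k t x) * indicator {x. norm x \<le> b} x \<partial>lborel \<partial>lborel)
      \<le> ennreal (32 * pi\<^sup>2 * b) * mass h"
    if k: "band_limited N k" and supp: "\<And>\<xi>. \<xi> \<notin> cone i \<Longrightarrow> k \<xi> = 0" and m: "mass k \<le> mass h" for k i
  proof -
    have [measurable]: "k \<in> borel_measurable borel" using k by (rule band_measurable)
    have "(\<integral>\<^sup>+t. \<integral>\<^sup>+x. nsq (wave k t x) * indicator {x. norm x \<le> b} x \<partial>lborel \<partial>lborel)
       = (\<integral>\<^sup>+x. \<integral>\<^sup>+t. nsq (wave k t x) * indicator {x. norm x \<le> b} x \<partial>lborel \<partial>lborel)"
      by (rule lborel_pair.Fubini') measurable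
    also have "\<dots> = (\<integral>\<^sup>+z. \<integral>\<^sup>+y. \<integral>\<^sup>+t. nsq (wave k t (plane_point i y z)) * indicator {x. norm x
        \<le> b} (plane_point i y z) \<partial>lborel \<partial>lborel \<partial>lborel)"
    proof (cases "i = 1")
      case True
      then show ?thesis by (subst nn_integral_real2_swap) (auto simp: plane_point_def)
    next
      case False
      then show ?thesis by (subst nn_integral_real2) (auto simp: plane_point_def)
    qed
    also have "\<dots> \<le> (\<integral>\<^sup>+z. \<integral>\<^sup>+y. \<integral>\<^sup>+t. nsq (wave k t (plane_point i y z))
        * indicator {-b..b} z \<partial>lborel \<partial>lborel \<partial>lborel)"
    proof (intro nn_integral_mono mult_left_mono)
      fix y z :: real
      have "\<bar>z\<bar> \<le> norm (plane_point i y z)"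
        using component_le_norm_cart[of "plane_point i y z" 1] component_le_norm_cart[of "plane_point i y z" 2]
        by (auto simp: plane_point_def split: if_splits)
      then show "indicator {x. norm x \<le> b} (plane_point i y z) \<le> (indicator {-b..b} z :: ennreal)"
        by (auto split: split_indicator)
    qed simp
    also have "\<dots> = (\<integral>\<^sup>+z. (\<integral>\<^sup>+y. \<integral>\<^sup>+t. nsq (wave k t (plane_point i y z)) \<partial>lborel \<partial>lborel)
        * indicator {-b..b} z \<partial>lborel)"
      by (simp add: nn_integral_multc)
    also have "\<dots> \<le> (\<integral>\<^sup>+z. (ennreal (16 * pi\<^sup>2) * mass h) * indicator {-b..b} z \<partial>lborel)"
      by (intro nn_integral_mono mult_right_mono order_trans[OF wave_cone_slice[OF band_integrable[OF k]
          supp] mult_left_mono[OF m]]) auto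
    also have "\<dots> = (ennreal (16 * pi\<^sup>2) * mass h) * ennreal (2 * b)"
      using b by (subst nn_integral_cmult_indicator) auto
    also have "\<dots> = (ennreal (16 * pi\<^sup>2) * ennreal (2 * b)) * mass h"
      by (simp only: mult_ac)
    also have "\<dots> = ennreal (32 * pi\<^sup>2 * b) * mass h"
      using b by (subst ennreal_mult[symmetric]) (auto simp: mult.assoc)
    finally show ?thesis .
  qed
  obtain h1 h2 where d: "band_limited N h1" "band_limited N h2" "\<And>\<xi>. \<xi> \<notin> cone 1 \<Longrightarrow> h1 \<xi>
      = 0" "\<And>\<xi>. \<xi> \<notin> cone 2 \<Longrightarrow> h2 \<xi> = 0"
    "mass h1 \<le> mass h" "mass h2 \<le> mass h"
    "\<And>t x. nsq (wave h t x) \<le> 2 * nsq (wave h1 t x) + 2 * nsq (wave h2 t x)"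
    using cone_decomposition[OF h] by blast
  have [measurable]: "h1 \<in> borel_measurable borel" "h2 \<in> borel_measurable borel"
    using d(1,2) by (auto intro: band_measurable)
  let ?J = "\<lambda>k. \<integral>\<^sup>+t. \<integral>\<^sup>+x. nsq (wave k t x) * indicator {x. norm x \<le> b} x \<partial>lborel \<partial>lborel"
  have "?J h \<le> (\<integral>\<^sup>+t. \<integral>\<^sup>+x. 2 * (nsq (wave h1 t x) * indicator {x. norm x \<le> b} x) + 2
      * (nsq (wave h2 t x) * indicator {x. norm x \<le> b} x) \<partial>lborel \<partial>lborel)"
    by (intro nn_integral_mono) (auto split: split_indicator intro: d(7))
  also have "\<dots> = 2 * ?J h1 + 2 * ?J h2"
    by (simp add: nn_integral_add nn_integral_cmult)
  also have "\<dots> \<le> 2 * (ennreal (32 * pi\<^sup>2 * b) * mass h) + 2 * (ennreal (32 * pi\<^sup>2 * b) * mass h)"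
    using cone[OF d(1,3,5)] cone[OF d(2,4,6)] by (intro add_mono mult_left_mono) auto
  also have "\<dots> = (4 * ennreal (32 * pi\<^sup>2 * b)) * mass h"
    by (simp only: mult.assoc[symmetric] distrib_right[symmetric]) simp
  also have "4 * ennreal (32 * pi\<^sup>2 * b) = ennreal (128 * pi\<^sup>2 * b)"
    using b ennreal_mult[of 4 "32 * pi\<^sup>2 * b"] by (simp add: mult.assoc)
  finally show ?thesis .
qed

text \<open>Near a point, the Sobolev inequality on a segment in the direction \<open>i\<close> reduces the value of a wave
with frequencies in \<open>cone i\<close> to an integral over a whole slice.  The bound replaces
\<open>local_smoothing\<close> near the origin, where \<open>dx / norm x\<close> is singular.\<close>

lemma pointwise_smoothing:
  assumes h: "band_limited N h" and N: "0 < N"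
  shows "(\<integral>\<^sup>+t. nsq (wave h t x) \<partial>lborel) \<le> ennreal (192 * pi\<^sup>2 * N) * mass h"
proof -
  have cone: "(\<integral>\<^sup>+t. nsq (wave k t x) \<partial>lborel) \<le> ennreal (48 * pi\<^sup>2 * N) * mass h"
    if k: "band_limited N k" and supp: "\<And>\<xi>. \<xi> \<notin> cone i \<Longrightarrow> k \<xi> = 0" and m: "mass k \<le> mass h" for k i
  proof -
    have [measurable]: "k \<in> borel_measurable borel" using k by (rule band_measurable)
    obtain y z where x: "x = plane_point i y z"
    proof (cases "i = 1")
      case True
      then show ?thesis using that[of "x $ 1" "x $ 2"] by (simp add: plane_point_def pt_components)
    next
      case False
      then show ?thesis using that[of "x $ 2" "x $ 1"] by (simp add: plane_point_def pt_components)
    qed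
    have e: "x + s *\<^sub>R plane_point i 1 0 = plane_point i (y + s) z" for s
      by (auto simp: x plane_point_def vec_eq_iff forall_2)
    have ne: "norm (plane_point i 1 0) \<le> 1" by (auto simp: plane_point_def norm_pt)
    have ab: "1 / N \<le> 1 / N - 0" "(0::real) \<in> {0..1/N}" using N by auto
    have "(\<integral>\<^sup>+t. nsq (wave k t x) \<partial>lborel)
        \<le> (\<integral>\<^sup>+t. \<integral>\<^sup>+s. ennreal (energy_density N k t (plane_point i (y + s) z)) \<partial>lborel \<partial>lborel)"
    proof (rule nn_integral_mono)
      fix t
      have "nsq (wave k t x) \<le> (\<integral>\<^sup>+s\<in>{0..1/N}. ennreal (energy_density N k t
          (plane_point i (y + s) z)) \<partial>lborel)"
        using sobolev_wave_line[OF k N ab ne, of t x] unfolding e by (simp add: e[of 0, simplified])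
      also have "\<dots> \<le> (\<integral>\<^sup>+s. ennreal (energy_density N k t (plane_point i (y + s) z)) \<partial>lborel)"
        by (intro nn_integral_mono) (auto split: split_indicator)
      finally show "nsq (wave k t x) \<le> (\<integral>\<^sup>+s. ennreal (energy_density N k t
          (plane_point i (y + s) z)) \<partial>lborel)" .
    qed
    also have "\<dots> = (\<integral>\<^sup>+p. 1 * ennreal (energy_density N k (fst p) (plane_point i (y + snd p) z)) \<partial>(lborel
        \<Otimes>\<^sub>M lborel))"
      using k by (subst lborel.nn_integral_fst[symmetric]) auto
    also have "\<dots> \<le> ennreal (3 * N * (16 * pi\<^sup>2)) * mass k"
    proof (rule nn_integral_edens_le[OF k N])
      fix h' assume "h' = k \<or> h' = grad_symbol 1 k \<or> h' = grad_symbol 2 k"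
      then have b': "band_limited N h'" and s': "\<And>\<xi>. \<xi> \<notin> cone i \<Longrightarrow> h' \<xi> = 0"
        using k band_dmul[OF k] supp by (auto simp: grad_symbol_def)
      have [measurable]: "h' \<in> borel_measurable borel" using b' by (rule band_measurable)
      have "(\<integral>\<^sup>+p. 1 * nsq (wave h' (fst p) (plane_point i (y + snd p) z)) \<partial>(lborel \<Otimes>\<^sub>M lborel))
          = (\<integral>\<^sup>+s. \<integral>\<^sup>+t. nsq (wave h' t (plane_point i (y + s) z)) \<partial>lborel \<partial>lborel)"
        by (subst lborel_pair.nn_integral_snd[symmetric]) (auto simp: split_beta')
      also have "\<dots> = (\<integral>\<^sup>+s. \<integral>\<^sup>+t. nsq (wave h' t (plane_point i s z)) \<partial>lborel \<partial>lborel)"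
        using nn_integral_real_affine[of "\<lambda>s. \<integral>\<^sup>+t. nsq (wave h' t (plane_point i s z)) \<partial>lborel" 1 y]
        by simp
      also have "\<dots> \<le> ennreal (16 * pi\<^sup>2) * mass h'"
        by (rule wave_cone_slice[OF band_integrable[OF b'] s'])
      finally show "(\<integral>\<^sup>+p. 1 * nsq (wave h' (fst p) (plane_point i (y + snd p) z)) \<partial>(lborel \<Otimes>\<^sub>M lborel))
          \<le> ennreal (16 * pi\<^sup>2) * mass h'" .
    qed auto
    also have "\<dots> \<le> ennreal (48 * pi\<^sup>2 * N) * mass h"
      using m by (intro mult_mono) (auto simp: mult_ac)
    finally show ?thesis .
  qed
  obtain h1 h2 where d: "band_limited N h1" "band_limited N h2" "\<And>\<xi>. \<xi> \<notin> cone 1 \<Longrightarrow> h1 \<xi>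
      = 0" "\<And>\<xi>. \<xi> \<notin> cone 2 \<Longrightarrow> h2 \<xi> = 0"
    "mass h1 \<le> mass h" "mass h2 \<le> mass h"
    "\<And>t x. nsq (wave h t x) \<le> 2 * nsq (wave h1 t x) + 2 * nsq (wave h2 t x)"
    using cone_decomposition[OF h] by blast
  have [measurable]: "h1 \<in> borel_measurable borel" "h2 \<in> borel_measurable borel"
    using d(1,2) by (auto intro: band_measurable)
  let ?J = "\<lambda>k. \<integral>\<^sup>+t. nsq (wave k t x) \<partial>lborel"
  have "?J h \<le> (\<integral>\<^sup>+t. 2 * nsq (wave h1 t x) + 2 * nsq (wave h2 t x) \<partial>lborel)"
    by (intro nn_integral_mono d(7))
  also have "\<dots> = 2 * ?J h1 + 2 * ?J h2"
    by (simp add: nn_integral_add nn_integral_cmult)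
  also have "\<dots> \<le> 2 * (ennreal (48 * pi\<^sup>2 * N) * mass h) + 2 * (ennreal (48 * pi\<^sup>2 * N) * mass h)"
    using cone[OF d(1,3,5)] cone[OF d(2,4,6)] by (intro add_mono mult_left_mono) auto
  also have "\<dots> = (4 * ennreal (48 * pi\<^sup>2 * N)) * mass h"
    by (simp only: mult.assoc[symmetric] distrib_right[symmetric]) simp
  also have "4 * ennreal (48 * pi\<^sup>2 * N) = ennreal (192 * pi\<^sup>2 * N)"
    using N ennreal_mult[of 4 "48 * pi\<^sup>2 * N"] by (simp add: mult.assoc)
  finally show ?thesis .
qed

section \<open>Dyadic annuli\<close>

lemma nn_integral_disc_le:
  assumes "0 \<le> N"
  shows "(\<integral>\<^sup>+\<xi>. indicator {\<xi>::real^2. norm \<xi> \<le> N} \<xi> \<partial>lborel) \<le> ennreal (4 * N\<^sup>2)"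
proof -
  have "(\<integral>\<^sup>+\<xi>. indicator {\<xi>::real^2. norm \<xi> \<le> N} \<xi> \<partial>lborel)
      \<le> (\<integral>\<^sup>+x. \<integral>\<^sup>+y. indicator {-N..N} x * indicator {-N..N} y \<partial>lborel \<partial>lborel)"
  proof (subst nn_integral_real2, measurable, intro nn_integral_mono)
    fix x y
    show "(indicator {\<xi>::real^2. norm \<xi> \<le> N} (pt x y) :: ennreal) \<le> indicator {-N..N} x * indicator {-N..N} y"
      using component_le_norm_cart[of "pt x y" 1] component_le_norm_cart[of "pt x y" 2]
      by (auto split: split_indicator)
  qed
  also have "\<dots> = ennreal (2 * N) * ennreal (2 * N)"
    using assms by (simp add: nn_integral_cmult nn_integral_multc)
  also have "\<dots> = ennreal (4 * N\<^sup>2)"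
    using assms by (simp add: ennreal_mult[symmetric] power2_eq_square)
  finally show ?thesis .
qed

text \<open>Cauchy-Schwarz over the disc of frequencies.\<close>

lemma band_integral_norm_le:
  assumes h: "band_limited N h" and N: "0 \<le> N"
  shows "ennreal ((LINT \<xi>|lborel. norm (h \<xi>))\<^sup>2) \<le> ennreal (4 * N\<^sup>2) * mass h"
proof -
  have [measurable]: "h \<in> borel_measurable borel" using h by (rule band_measurable)
  have "ennreal (LINT \<xi>|lborel. norm (h \<xi>)) = (\<integral>\<^sup>+\<xi>. ennreal (norm (h \<xi>)) \<partial>lborel)"
    using band_integrable[OF h] by (intro nn_integral_eq_integral[symmetric]) auto
  also have "\<dots> = (\<integral>\<^sup>+\<xi>. ennreal (norm (h \<xi>)) * indicator {\<xi>. norm \<xi> \<le> N} \<xi> \<partial>lborel)"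
    using h by (intro nn_integral_cong) (auto simp: band_limited_def split: split_indicator)
  finally have "ennreal ((LINT \<xi>|lborel. norm (h \<xi>))\<^sup>2)
      = (\<integral>\<^sup>+\<xi>. ennreal (norm (h \<xi>)) * indicator {\<xi>. norm \<xi> \<le> N} \<xi> \<partial>lborel)\<^sup>2"
    by (simp add: ennreal_power[symmetric])
  also have "\<dots> \<le> (\<integral>\<^sup>+\<xi>. (ennreal (norm (h \<xi>)))\<^sup>2 \<partial>lborel)
      * (\<integral>\<^sup>+\<xi>. (indicator {\<xi>::real^2. norm \<xi> \<le> N} \<xi>)\<^sup>2 \<partial>lborel)"
    by (rule Cauchy_Schwarz_nn_integral[of "\<lambda>\<xi>. ennreal (norm (h \<xi>))" lborel "indicator {\<xi>. norm \<xi>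
        \<le> N}"]) measurable
  also have "(\<integral>\<^sup>+\<xi>. (ennreal (norm (h \<xi>)))\<^sup>2 \<partial>lborel) = mass h"
    by (simp add: ennreal_power)
  also have "(\<integral>\<^sup>+\<xi>. (indicator {\<xi>::real^2. norm \<xi> \<le> N} \<xi>)\<^sup>2 \<partial>lborel)
      = (\<integral>\<^sup>+\<xi>. indicator {\<xi>::real^2. norm \<xi> \<le> N} \<xi> \<partial>lborel)"
    by (intro nn_integral_cong) (auto split: split_indicator)
  also have "mass h * \<dots> \<le> mass h * ennreal (4 * N\<^sup>2)"
    by (intro mult_left_mono nn_integral_disc_le N) auto
  finally show ?thesis by (simp add: mult.commute)
qed

lemma wave_sup_le:
  assumes h: "band_limited N h" and N: "0 \<le> N"
  shows "nsq (wave h t x) \<le> ennreal (4 * N\<^sup>2) * mass h"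
  using norm_wave_le[OF band_integrable[OF h], of t x]
  by (intro order_trans[OF _ band_integral_norm_le[OF h N]] ennreal_leI power_mono) auto

lemma band_dmul_cases: "band_limited N g \<Longrightarrow> h = g \<or> h = grad_symbol 1 g \<or> h = grad_symbol 2 g \<Longrightarrow> band_limited N h"
  using band_dmul by auto

lemma shell_le:
  assumes g: "band_limited N g" and N: "0 < N" and a: "0 < a"
  shows "shell N g a b t \<le> ennreal (60 * pi\<^sup>2 * N / a) * mass g"
proof -
  have "shell N g a b t \<le> ennreal (3 * N * (20 * pi\<^sup>2 / a)) * mass g"
    unfolding shell_def
  proof (rule nn_integral_edens_le[OF g N])
    fix h assume "h = g \<or> h = grad_symbol 1 g \<or> h = grad_symbol 2 g"
    then have h: "band_limited N h" by (rule band_dmul_cases[OF g])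
    have [measurable]: "h \<in> borel_measurable borel" using h by (rule band_measurable)
    have "(\<integral>\<^sup>+p. annulus a b p * nsq (wave h t (polar p)) \<partial>(lborel \<Otimes>\<^sub>M lborel))
       \<le> ennreal (5 / a) * (\<integral>\<^sup>+x\<in>{x. norm x \<le> b}. nsq (wave h t x) \<partial>lborel)"
      by (rule nn_integral_annulus_le[OF _ a]) measurable
    also have "\<dots> \<le> ennreal (5 / a) * (\<integral>\<^sup>+x. nsq (wave h t x) \<partial>lborel)"
      by (intro mult_left_mono nn_integral_mono) (auto split: split_indicator)
    also have "\<dots> \<le> ennreal (5 / a) * (ennreal ((2 * pi)\<^sup>2) * mass h)"
      by (intro mult_left_mono wave_energy band_integrable[OF h]) auto
    also have "\<dots> = ennreal (5 / a * (2 * pi)\<^sup>2) * mass h"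
      using a by (simp only: mult.assoc[symmetric] ennreal_mult'' zero_le_power2)
    also have "5 / a * (2 * pi)\<^sup>2 = 20 * pi\<^sup>2 / a"
      by (simp add: power_mult_distrib)
    finally show "(\<integral>\<^sup>+p. annulus a b p * nsq (wave h t (polar p)) \<partial>(lborel \<Otimes>\<^sub>M lborel))
        \<le> ennreal (20 * pi\<^sup>2 / a) * mass h" .
  qed (use a in auto)
  also have "3 * N * (20 * pi\<^sup>2 / a) = 60 * pi\<^sup>2 * N / a" by simp
  finally show ?thesis .
qed

lemma shell_0_le:
  assumes g: "band_limited N g" and N: "0 < N"
  shows "shell N g 0 (1 / N) t \<le> ennreal (24 * pi * N\<^sup>2) * mass g"
proof -
  have "shell N g 0 (1 / N) t \<le> ennreal (3 * N * (8 * pi * N)) * mass g"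
    unfolding shell_def
  proof (rule nn_integral_edens_le[OF g N])
    fix h assume "h = g \<or> h = grad_symbol 1 g \<or> h = grad_symbol 2 g"
    then have h: "band_limited N h" by (rule band_dmul_cases[OF g])
    have "(\<integral>\<^sup>+p. annulus 0 (1 / N) p * nsq (wave h t (polar p)) \<partial>(lborel \<Otimes>\<^sub>M lborel))
       \<le> (\<integral>\<^sup>+p. annulus 0 (1 / N) p * (ennreal (4 * N\<^sup>2) * mass h) \<partial>(lborel \<Otimes>\<^sub>M lborel))"
      using N by (intro nn_integral_mono mult_left_mono wave_sup_le[OF h]) auto
    also have "\<dots> = ennreal (2 * pi * (1 / N - 0)) * (ennreal (4 * N\<^sup>2) * mass h)"
      using N by (intro nn_integral_annulus_const) auto
    also have "\<dots> = ennreal (2 * pi * (1 / N - 0) * (4 * N\<^sup>2)) * mass h"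
      using N by (simp only: mult.assoc[symmetric] ennreal_mult'' zero_le_power2 mult_nonneg_nonneg
          zero_le_numeral)
    also have "2 * pi * (1 / N - 0) * (4 * N\<^sup>2) = 8 * pi * N"
      using N by (simp add: power2_eq_square)
    finally show "(\<integral>\<^sup>+p. annulus 0 (1 / N) p * nsq (wave h t (polar p)) \<partial>(lborel \<Otimes>\<^sub>M lborel))
        \<le> ennreal (8 * pi * N) * mass h" .
  qed (use N in auto)
  also have "3 * N * (8 * pi * N) = 24 * pi * N\<^sup>2" by (simp add: power2_eq_square)
  finally show ?thesis .
qed

lemma nn_integral_shell:
  assumes g: "band_limited N g"
  shows "(\<integral>\<^sup>+t. shell N g a b t \<partial>lborel)
    = (\<integral>\<^sup>+z. annulus a b (snd z) * ennreal (energy_density N g (fst z) (polar (snd z))) \<partial>(lborel \<Otimes>\<^sub>M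
      (lborel \<Otimes>\<^sub>M lborel)))"
proof -
  have sf: "sigma_finite_measure (lborel \<Otimes>\<^sub>M lborel :: (real \<times> real) measure)"
    by (simp only: lborel_prod sigma_finite_lborel)
  show ?thesis unfolding shell_def
    using g by (subst sigma_finite_measure.nn_integral_fst[OF sf, symmetric]) auto
qed

lemma shell_measurable [measurable]:
  assumes g: "band_limited N g"
  shows "shell N g a b \<in> borel_measurable borel"
proof -
  have sf: "sigma_finite_measure (lborel \<Otimes>\<^sub>M lborel :: (real \<times> real) measure)"
    by (simp only: lborel_prod sigma_finite_lborel)
  have "(\<lambda>t. \<integral>\<^sup>+p. annulus a b p * ennreal (energy_density N g t (polar p)) \<partial>(lborel \<Otimes>\<^sub>M lborel)) \<in>
      borel_measurable borel"
    using g by (intro sigma_finite_measure.borel_measurable_nn_integral[OF sf]) measurable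
  then show ?thesis by (simp add: shell_def[abs_def])
qed

lemma nn_integral_shell_le:
  assumes g: "band_limited N g" and N: "0 < N" and c: "0 \<le> c"
    and le: "\<And>h. band_limited N h \<Longrightarrow> (\<integral>\<^sup>+t. \<integral>\<^sup>+p. annulus a b p
        * nsq (wave h t (polar p)) \<partial>(lborel \<Otimes>\<^sub>M lborel) \<partial>lborel) \<le> ennreal c * mass h"
  shows "(\<integral>\<^sup>+t. shell N g a b t \<partial>lborel) \<le> ennreal (3 * N * c) * mass g"
  unfolding nn_integral_shell[OF g]
proof (rule nn_integral_edens_le[OF g N c])
  fix h assume "h = g \<or> h = grad_symbol 1 g \<or> h = grad_symbol 2 g"
  then have h: "band_limited N h" by (rule band_dmul_cases[OF g])
  have [measurable]: "h \<in> borel_measurable borel" using h by (rule band_measurable)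
  have sf: "sigma_finite_measure (lborel \<Otimes>\<^sub>M lborel :: (real \<times> real) measure)"
    by (simp only: lborel_prod sigma_finite_lborel)
  have "(\<integral>\<^sup>+z. annulus a b (snd z) * nsq (wave h (fst z) (polar (snd z))) \<partial>(lborel \<Otimes>\<^sub>M (lborel \<Otimes>\<^sub>M lborel)))
      = (\<integral>\<^sup>+t. \<integral>\<^sup>+p. annulus a b p * nsq (wave h t (polar p)) \<partial>(lborel \<Otimes>\<^sub>M lborel) \<partial>lborel)"
    by (subst sigma_finite_measure.nn_integral_fst[OF sf, symmetric]) auto
  then show "(\<integral>\<^sup>+z. annulus a b (snd z) * nsq (wave h (fst z) (polar (snd z))) \<partial>(lborel \<Otimes>\<^sub>M
      (lborel \<Otimes>\<^sub>M lborel))) \<le> ennreal c * mass h"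
    using le[OF h] by simp
qed auto

lemma nn_integral_shell_pos_le:
  assumes g: "band_limited N g" and N: "0 < N" and a: "0 < a" and b: "0 \<le> b" "b \<le> 2 * a"
  shows "(\<integral>\<^sup>+t. shell N g a b t \<partial>lborel) \<le> ennreal (3840 * pi\<^sup>2 * N) * mass g"
proof -
  have "(\<integral>\<^sup>+t. shell N g a b t \<partial>lborel) \<le> ennreal (3 * N * (1280 * pi\<^sup>2)) * mass g"
  proof (rule nn_integral_shell_le[OF g N])
    fix h assume h: "band_limited N h"
    have [measurable]: "h \<in> borel_measurable borel" using h by (rule band_measurable)
    have "(\<integral>\<^sup>+t. \<integral>\<^sup>+p. annulus a b p * nsq (wave h t (polar p)) \<partial>(lborel \<Otimes>\<^sub>M lborel) \<partial>lborel)
       \<le> (\<integral>\<^sup>+t. ennreal (5 / a) * (\<integral>\<^sup>+x\<in>{x. norm x \<le> b}. nsq (wave h t x) \<partial>lborel) \<partial>lborel)"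
      by (intro nn_integral_mono nn_integral_annulus_le[OF _ a]) measurable
    also have "\<dots> = ennreal (5 / a) * (\<integral>\<^sup>+t. (\<integral>\<^sup>+x\<in>{x. norm x \<le> b}. nsq (wave h t x) \<partial>lborel) \<partial>lborel)"
      by (rule nn_integral_cmult) measurable
    also have "\<dots> \<le> ennreal (5 / a) * (ennreal (128 * pi\<^sup>2 * b) * mass h)"
      by (intro mult_left_mono local_smoothing[OF h b(1)]) auto
    also have "\<dots> = ennreal (5 / a * (128 * pi\<^sup>2 * b)) * mass h"
      using a b by (subst ennreal_mult) (auto simp: mult.assoc)
    also have "\<dots> \<le> ennreal (1280 * pi\<^sup>2) * mass h"
    proof (intro mult_right_mono ennreal_leI)
      have "5 / a * (128 * pi\<^sup>2 * b) = 640 * pi\<^sup>2 * (b / a)" by simp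
      also have "\<dots> \<le> 640 * pi\<^sup>2 * 2"
        using a b by (intro mult_left_mono) (auto simp: divide_simps)
      finally show "5 / a * (128 * pi\<^sup>2 * b) \<le> 1280 * pi\<^sup>2" by simp
    qed auto
    finally show "(\<integral>\<^sup>+t. \<integral>\<^sup>+p. annulus a b p * nsq (wave h t (polar p)) \<partial>(lborel \<Otimes>\<^sub>M lborel) \<partial>lborel)
        \<le> ennreal (1280 * pi\<^sup>2) * mass h" .
  qed auto
  then show ?thesis by (simp add: mult_ac)
qed

lemma nn_integral_shell_0_le:
  assumes g: "band_limited N g" and N: "0 < N"
  shows "(\<integral>\<^sup>+t. shell N g 0 (1 / N) t \<partial>lborel) \<le> ennreal (1152 * pi ^ 3 * N) * mass g"
proof -
  have "(\<integral>\<^sup>+t. shell N g 0 (1 / N) t \<partial>lborel) \<le> ennreal (3 * N * (384 * pi ^ 3)) * mass g"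
  proof (rule nn_integral_shell_le[OF g N])
    fix h assume h: "band_limited N h"
    have [measurable]: "h \<in> borel_measurable borel" using h by (rule band_measurable)
    have ps: "pair_sigma_finite (lborel :: real measure) (lborel \<Otimes>\<^sub>M lborel :: (real \<times> real) measure)"
      unfolding lborel_prod pair_sigma_finite_def by (simp add: sigma_finite_lborel)
    have "(\<integral>\<^sup>+t. \<integral>\<^sup>+p. annulus 0 (1 / N) p * nsq (wave h t (polar p)) \<partial>(lborel \<Otimes>\<^sub>M lborel) \<partial>lborel)
       = (\<integral>\<^sup>+p. \<integral>\<^sup>+t. annulus 0 (1 / N) p * nsq (wave h t (polar p)) \<partial>lborel \<partial>(lborel \<Otimes>\<^sub>M lborel))"
      by (rule pair_sigma_finite.Fubini'[OF ps, symmetric]) measurable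
    also have "\<dots> \<le> (\<integral>\<^sup>+p. annulus 0 (1 / N) p * (ennreal (192 * pi\<^sup>2 * N) * mass h) \<partial>(lborel \<Otimes>\<^sub>M lborel))"
      using pointwise_smoothing[OF h N]
      by (intro nn_integral_mono) (auto simp: nn_integral_cmult intro!: mult_left_mono)
    also have "\<dots> = ennreal (2 * pi * (1 / N - 0)) * (ennreal (192 * pi\<^sup>2 * N) * mass h)"
      using N by (intro nn_integral_annulus_const) auto
    also have "\<dots> = ennreal (2 * pi * (1 / N - 0) * (192 * pi\<^sup>2 * N)) * mass h"
      using N by (subst (3) ennreal_mult) (auto simp: mult.assoc)
    also have "2 * pi * (1 / N - 0) * (192 * pi\<^sup>2 * N) = 384 * pi ^ 3"
      using N by (simp add: power2_eq_square power3_eq_cube)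
    finally show "(\<integral>\<^sup>+t. \<integral>\<^sup>+p. annulus 0 (1 / N) p * nsq
        (wave h t (polar p)) \<partial>(lborel \<Otimes>\<^sub>M lborel) \<partial>lborel) \<le> ennreal (384 * pi ^ 3) * mass h" .
  qed auto
  then show ?thesis by (simp add: mult_ac)
qed

text \<open>Annulus \<open>0\<close> is the disc of radius \<open>1 / N\<close>; each annulus has at least the width \<open>1 / N\<close> that
\<open>circle_le_shell\<close> asks for.\<close>

definition shells :: "real \<Rightarrow> (real^2 \<Rightarrow> complex) \<Rightarrow> nat \<Rightarrow> real \<Rightarrow> ennreal" where
  "shells N g l = (if l = 0 then shell N g 0 (1 / N) else shell N g (2 ^ (l - 1) / N) (2 ^ l / N))"

text \<open>A common upper bound for the constants in the four estimates above.\<close>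

definition shell_const :: real where "shell_const = 100000"

lemma shells_measurable: "band_limited N g \<Longrightarrow> shells N g l \<in> borel_measurable borel"
  unfolding shells_def by (auto intro: shell_measurable)

lemma pi_powers: "pi\<^sup>2 \<le> 16" "pi ^ 3 \<le> 64"
  using power_mono[of pi 4 2] power_mono[of pi 4 3] pi_less_4 by auto

text \<open>Beyond the radius \<open>1 / N\<close>, take the first \<open>l\<close> with \<open>r * N \<le> 2 ^ l\<close>.\<close>

lemma circle_le_shells:
  assumes g: "band_limited N g" and N: "0 < N" and r: "0 < r"
  shows "\<exists>l. (\<integral>\<^sup>+\<theta>\<in>{0..2*pi}. nsq (wave g t (polar (\<theta>, r))) \<partial>lborel) \<le> shells N g l t"
proof (cases "r \<le> 1 / N")
  case True
  then show ?thesis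
    using circle_le_shell[OF g N, of "1/N" 0 r t] r N by (intro exI[of _ 0]) (auto simp: shells_def)
next
  case False
  define l where "l = (LEAST l. r * N \<le> 2 ^ l)"
  have ex: "\<exists>l. r * N \<le> 2 ^ l"
    using real_arch_pow[of 2 "r * N"] by (auto intro: less_imp_le)
  have l1: "r * N \<le> 2 ^ l" unfolding l_def using ex by (rule LeastI_ex)
  have l0: "l \<noteq> 0"
  proof
    assume "l = 0"
    then show False using l1 False N by (simp add: field_simps)
  qed
  have l2: "2 ^ (l - 1) < r * N"
    using not_less_Least[of "l - 1" "\<lambda>l. r * N \<le> 2 ^ l"] l0 by (simp add: l_def[symmetric])
  have "(2::real) ^ l = 2 ^ (l - 1) + 2 ^ (l - 1)"
    using l0 by (cases l) auto
  then have "2 ^ l / N - 2 ^ (l - 1) / N = 2 ^ (l - 1) / N" by (simp add: diff_divide_distrib[symmetric])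
  moreover have "1 / N \<le> 2 ^ (l - 1) / N" using N by (intro divide_right_mono) auto
  ultimately have "1 / N \<le> 2 ^ l / N - 2 ^ (l - 1) / N" by linarith
  moreover have "r \<in> {2 ^ (l - 1) / N..2 ^ l / N}"
    using l1 l2 N by (auto simp: field_simps)
  ultimately show ?thesis
    using circle_le_shell[OF g N] l0 by (intro exI[of _ l]) (auto simp: shells_def)
qed

text \<open>The energy at a fixed time decays like the inverse of the radius \<open>2 ^ l / N\<close>.\<close>

lemma shells_le:
  assumes g: "band_limited N g" and N: "0 < N"
  shows "shells N g l t \<le> ennreal (shell_const * N\<^sup>2 / 2 ^ l) * mass g"
proof (cases l)
  case 0
  have "shells N g l t \<le> ennreal (24 * pi * N\<^sup>2) * mass g"
    using shell_0_le[OF g N] 0 by (simp add: shells_def)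
  also have "\<dots> \<le> ennreal (shell_const * N\<^sup>2 / 2 ^ l) * mass g"
    using mult_right_mono[of "24 * pi" shell_const "N\<^sup>2"] pi_less_4 0
    by (intro mult_right_mono ennreal_leI) (auto simp: shell_const_def)
  finally show ?thesis .
next
  case (Suc m)
  have "shells N g l t \<le> ennreal (60 * pi\<^sup>2 * N / (2 ^ m / N)) * mass g"
    using shell_le[OF g N, of "2 ^ m / N" "2 ^ l / N"] N Suc by (simp add: shells_def)
  also have "60 * pi\<^sup>2 * N / (2 ^ m / N) = (120 * pi\<^sup>2) * (N\<^sup>2 / 2 ^ l)"
    using Suc by (simp add: power2_eq_square)
  also have "ennreal \<dots> * mass g \<le> ennreal (shell_const * (N\<^sup>2 / 2 ^ l)) * mass g"
    using pi_powers by (intro mult_right_mono ennreal_leI) (auto simp: shell_const_def)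
  finally show ?thesis by simp
qed

text \<open>Over all times every annulus carries the same amount of energy, up to a constant.\<close>

lemma nn_integral_shells_le:
  assumes g: "band_limited N g" and N: "0 < N"
  shows "(\<integral>\<^sup>+t. shells N g l t \<partial>lborel) \<le> ennreal (shell_const * N) * mass g"
proof (cases l)
  case 0
  have "(\<integral>\<^sup>+t. shells N g l t \<partial>lborel) \<le> ennreal (1152 * pi ^ 3 * N) * mass g"
    using nn_integral_shell_0_le[OF g N] 0 by (simp add: shells_def)
  also have "\<dots> \<le> ennreal (shell_const * N) * mass g"
    using pi_powers N by (intro mult_right_mono ennreal_leI) (auto simp: shell_const_def)
  finally show ?thesis .
next
  case (Suc m)
  have "(\<integral>\<^sup>+t. shells N g l t \<partial>lborel) \<le> ennreal (3840 * pi\<^sup>2 * N) * mass g"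
    using nn_integral_shell_pos_le[OF g N, of "2 ^ m / N" "2 ^ l / N"] N Suc by (simp add: shells_def)
  also have "\<dots> \<le> ennreal (shell_const * N) * mass g"
    using pi_powers N by (intro mult_right_mono ennreal_leI) (auto simp: shell_const_def)
  finally show ?thesis .
qed

section \<open>The envelope over all radii\<close>

definition envelope :: "real \<Rightarrow> (real^2 \<Rightarrow> complex) \<Rightarrow> real \<Rightarrow> ennreal" where
  "envelope N g t = (SUP l. shells N g l t)"

lemma env_measurable: "band_limited N g \<Longrightarrow> envelope N g \<in> borel_measurable borel"
  unfolding envelope_def[abs_def] using shells_measurable by (intro borel_measurable_SUP) auto

lemma circle_le_env:
  assumes "band_limited N g" "0 < N" "0 < r"
  shows "(\<integral>\<^sup>+\<theta>\<in>{0..2*pi}. nsq (wave g t (polar (\<theta>, r))) \<partial>lborel) \<le> envelope N g t"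
  using circle_le_shells[OF assms, of t] unfolding envelope_def by (auto intro: SUP_upper2)

lemma env_le:
  assumes g: "band_limited N g" and N: "0 < N"
  shows "envelope N g t \<le> ennreal (shell_const * N\<^sup>2) * mass g"
  unfolding envelope_def
proof (rule SUP_least)
  fix l
  have "shells N g l t \<le> ennreal (shell_const * N\<^sup>2 / 2 ^ l) * mass g" by (rule shells_le[OF g N])
  also have "\<dots> \<le> ennreal (shell_const * N\<^sup>2) * mass g"
  proof (intro mult_right_mono ennreal_leI)
    show "shell_const * N\<^sup>2 / 2 ^ l \<le> shell_const * N\<^sup>2"
      using mult_left_mono[of 1 "2 ^ l" "shell_const * N\<^sup>2"] by (simp add: divide_simps shell_const_def)
  qed simp
  finally show "shells N g l t \<le> ennreal (shell_const * N\<^sup>2) * mass g" .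
qed

text \<open>The annuli of radius up to about \<open>T\<close> are counted by \<open>nn_integral_shells_le\<close>; there are about
\<open>log 2 (2 + N * T)\<close> of them.  The outer ones are estimated together, by the fixed-time bound
\<open>shells_le\<close> at the radius \<open>T\<close> integrated over a time interval of length \<open>T\<close>.\<close>

lemma env_L2:
  assumes g: "band_limited N g" and N: "0 < N" and T: "0 < T"
  shows "(\<integral>\<^sup>+t\<in>{0..T}. envelope N g t \<partial>lborel) \<le> ennreal (8 * shell_const * N * ln (2 + N * T)) * mass g"
proof -
  have [measurable]: "shells N g l \<in> borel_measurable borel" for l by (rule shells_measurable[OF g])
  define x where "x = 2 + N * T"
  have x: "2 \<le> x" using N T by (simp add: x_def)
  \<comment> \<open>The first annulus beyond the radius \<open>T\<close>, up to a constant factor.\<close>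
  define L where "L = nat \<lceil>log 2 x\<rceil>"
  have lx: "1 \<le> log 2 x" using x by simp
  have L1: "real L \<le> log 2 x + 1" using lx unfolding L_def by linarith
  have "x = 2 powr (log 2 x)" using x by simp
  also have "\<dots> \<le> 2 powr real L" using lx unfolding L_def by (intro powr_mono) linarith+
  finally have L2: "x \<le> 2 ^ L" by (simp add: powr_realpow)
  have shell_const: "0 < shell_const" by (simp add: shell_const_def)
  let ?c = "ennreal (shell_const * N\<^sup>2 / 2 ^ L) * mass g"
  have bd: "envelope N g t \<le> (\<Sum>l\<le>L. shells N g l t) + ?c" for t
    unfolding envelope_def
  proof (rule SUP_least)
    fix l
    show "shells N g l t \<le> (\<Sum>l\<le>L. shells N g l t) + ?c"
    proof (cases "l \<le> L")
      case True
      then have "shells N g l t \<le> (\<Sum>l\<le>L. shells N g l t)" by (intro member_le_sum) auto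
      then show ?thesis by (simp add: add_increasing2)
    next
      case False
      have "shell_const * N\<^sup>2 / 2 ^ l \<le> shell_const * N\<^sup>2 / 2 ^ L"
        using False shell_const by (intro divide_left_mono power_increasing) auto
      then have "shells N g l t \<le> ?c"
        by (intro order_trans[OF shells_le[OF g N]] mult_right_mono ennreal_leI) auto
      then show ?thesis by (simp add: add_increasing)
    qed
  qed
  have "(\<integral>\<^sup>+t\<in>{0..T}. envelope N g t \<partial>lborel) \<le> (\<integral>\<^sup>+t. (\<Sum>l\<le>L. shells N g l t) + ?c
      * indicator {0..T} t \<partial>lborel)"
    using bd by (intro nn_integral_mono) (auto split: split_indicator)
  also have "\<dots> = (\<Sum>l\<le>L. \<integral>\<^sup>+t. shells N g l t \<partial>lborel) + ?c * ennreal T"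
    using T by (simp add: nn_integral_add nn_integral_sum nn_integral_cmult_indicator)
  also have "\<dots> \<le> (\<Sum>l\<le>L. ennreal (shell_const * N) * mass g) + ?c * ennreal T"
    by (intro add_right_mono sum_mono nn_integral_shells_le[OF g N])
  also have "\<dots> = ennreal (real (L + 1) * (shell_const * N)) * mass g
      + ennreal (shell_const * N\<^sup>2 / 2 ^ L * T) * mass g"
  proof -
    have "(\<Sum>l\<le>L. ennreal (shell_const * N) * mass g) = ennreal (real (L + 1))
        * (ennreal (shell_const * N) * mass g)"
      by (simp add: ennreal_of_nat_eq_real_of_nat add.commute)
    also have "\<dots> = ennreal (real (L + 1) * (shell_const * N)) * mass g"
      using shell_const N by (subst ennreal_mult) (auto simp: mult.assoc)
    finally have 1: "(\<Sum>l\<le>L. ennreal (shell_const * N) * mass g)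
        = ennreal (real (L + 1) * (shell_const * N)) * mass g" .
    have "?c * ennreal T = ennreal (shell_const * N\<^sup>2 / 2 ^ L) * ennreal T * mass g"
      by (simp only: mult_ac)
    also have "\<dots> = ennreal (shell_const * N\<^sup>2 / 2 ^ L * T) * mass g"
      using shell_const N T by (subst ennreal_mult[symmetric]) auto
    finally show ?thesis using 1 by simp
  qed
  also have "\<dots> = ennreal (real (L + 1) * (shell_const * N) + shell_const * N\<^sup>2 / 2 ^ L * T) * mass g"
    using shell_const N T by (subst ennreal_plus) (auto simp: distrib_right)
  also have "\<dots> \<le> ennreal (8 * shell_const * N * ln x) * mass g"
  proof (intro mult_right_mono ennreal_leI)
    have "N * T \<le> 2 ^ L" using L2 by (simp add: x_def)
    then have "shell_const * N\<^sup>2 / 2 ^ L * T \<le> shell_const * N"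
      using shell_const N by (simp add: divide_simps power2_eq_square)
    then have "real (L + 1) * (shell_const * N) + shell_const * N\<^sup>2 / 2 ^ L * T
        \<le> (real L + 2) * (shell_const * N)"
      by (simp add: algebra_simps)
    also have "\<dots> \<le> (4 * log 2 x) * (shell_const * N)"
      using L1 lx shell_const N by (intro mult_right_mono) auto
    also have "\<dots> \<le> (8 * ln x) * (shell_const * N)"
    proof (intro mult_right_mono)
      have "1 / 2 \<le> ln (2::real)" using ln2_ge_two_thirds by simp
      then show "4 * log 2 x \<le> 8 * ln x"
        using x by (simp add: log_def divide_simps mult_le_cancel_left1)
    qed (use shell_const N in auto)
    finally show "real (L + 1) * (shell_const * N) + shell_const * N\<^sup>2 / 2 ^ L * T \<le> 8 * shell_const * N * ln x"
      by (simp add: mult_ac)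
  qed simp
  finally show ?thesis by (simp add: x_def)
qed

text \<open>For one annulus, the \<open>p\<close>-th power is the product of the fixed-time bound to the power \<open>p - 1\<close> and
of the energy itself, whose integral over time is bounded.  The first factor decays like
\<open>2 powr (l * (1 - p))\<close>, so that the sum over the annuli converges.\<close>

lemma env_Lp:
  assumes g: "band_limited N g" and N: "0 < N" and p: "1 < p" and m: "mass g = ennreal m" "0 \<le> m"
  shows "(\<integral>\<^sup>+t. ennreal (enn2real (envelope N g t) powr p) \<partial>lborel)
    \<le> ennreal (shell_const powr p * N powr (2 * p - 1) * m powr p / (1 - 2 powr (1 - p)))"
proof -
  have [measurable]: "shells N g l \<in> borel_measurable borel" for l by (rule shells_measurable[OF g])
  have shell_const: "0 < shell_const" by (simp add: shell_const_def)
  define s where "s = (\<lambda>l t. enn2real (shells N g l t))"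
  have [measurable]: "s l \<in> borel_measurable borel" for l unfolding s_def by measurable
  have bd: "shells N g l t \<le> ennreal (shell_const * N\<^sup>2 / 2 ^ l * m)" for l t
    using shells_le[OF g N, of l t] shell_const N m by (simp add: ennreal_mult[symmetric])
  have fin: "shells N g l t = ennreal (s l t)" for l t
    using le_less_trans[OF bd[of l t] ennreal_less_top] unfolding s_def by simp
  have s0: "0 \<le> s l t" for l t by (simp add: s_def)
  have sb: "s l t \<le> shell_const * N\<^sup>2 / 2 ^ l * m" for l t
    using bd[of l t] shell_const N m unfolding fin by (simp add: s0)
  have envfin: "envelope N g t = ennreal (enn2real (envelope N g t))" for t
  proof -
    have "envelope N g t \<le> ennreal (shell_const * N\<^sup>2 * m)"
      using env_le[OF g N, of t] shell_const N m by (simp add: ennreal_mult)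
    then show ?thesis using le_less_trans[OF _ ennreal_less_top] by simp
  qed
  \<comment> \<open>A supremum of powers is at most their sum.\<close>
  have sum: "ennreal (enn2real (envelope N g t) powr p) \<le> (\<Sum>l. ennreal (s l t powr p))" (is "_ \<le> ?S") for t
  proof (cases ?S)
    case (real S)
    have "s l t \<le> S powr (1 / p)" for l
    proof -
      have "(\<Sum>l\<in>{l}. ennreal (s l t powr p)) \<le> ?S"
        by (rule sum_le_suminf[OF summableI]) simp_all
      then have "ennreal (s l t powr p) \<le> ?S" by simp
      then have "s l t powr p \<le> S" using real by simp
      then have "(s l t powr p) powr (1 / p) \<le> S powr (1 / p)"
        using p by (intro powr_mono2) auto
      then show ?thesis using p s0[of l t] by (simp add: powr_powr)
    qed
    then have "envelope N g t \<le> ennreal (S powr (1 / p))"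
      unfolding envelope_def by (intro SUP_least) (simp add: fin ennreal_leI)
    then have "enn2real (envelope N g t) \<le> S powr (1 / p)"
      by (subst (asm) envfin) simp
    then have "enn2real (envelope N g t) powr p \<le> (S powr (1 / p)) powr p"
      using p by (intro powr_mono2) auto
    then show ?thesis using real p by (simp add: powr_powr ennreal_leI)
  qed simp
  let ?r = "2 powr (1 - p) :: real"
  define A where "A = (shell_const * N\<^sup>2 * m) powr (p - 1) * (shell_const * N * m)"
  have A0: "0 \<le> A" using shell_const N m by (simp add: A_def)
  have bound: "(\<integral>\<^sup>+t. ennreal (s l t powr p) \<partial>lborel) \<le> ennreal (A * ?r ^ l)" for l
  proof -
    have "(\<integral>\<^sup>+t. ennreal (s l t powr p) \<partial>lborel) \<le> (\<integral>\<^sup>+t. ennreal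
        ((shell_const * N\<^sup>2 / 2 ^ l * m) powr (p - 1)) * shells N g l t \<partial>lborel)"
    proof (rule nn_integral_mono)
      fix t
      have "s l t powr p = s l t powr (p - 1) * s l t"
        using s0[of l t] by (cases "s l t = 0") (auto simp: powr_diff)
      also have "\<dots> \<le> (shell_const * N\<^sup>2 / 2 ^ l * m) powr (p - 1) * s l t"
        using sb[of l t] s0[of l t] p by (intro mult_right_mono powr_mono2) auto
      finally show "ennreal (s l t powr p) \<le> ennreal ((shell_const * N\<^sup>2 / 2 ^ l * m) powr (p - 1))
          * shells N g l t"
        unfolding fin by (subst ennreal_mult'[symmetric]) (auto intro: ennreal_leI)
    qed
    also have "\<dots> = ennreal ((shell_const * N\<^sup>2 / 2 ^ l * m) powr (p - 1)) * (\<integral>\<^sup>+t. shells N g l t \<partial>lborel)"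
      by (rule nn_integral_cmult) measurable
    also have "\<dots> \<le> ennreal ((shell_const * N\<^sup>2 / 2 ^ l * m) powr (p - 1))
        * (ennreal (shell_const * N) * ennreal m)"
      using nn_integral_shells_le[OF g N, of l] m by (intro mult_left_mono) auto
    also have "\<dots> = ennreal ((shell_const * N\<^sup>2 / 2 ^ l * m) powr (p - 1) * (shell_const * N * m))"
      using shell_const N m by (simp add: ennreal_mult[symmetric])
    also have "(shell_const * N\<^sup>2 / 2 ^ l * m) powr (p - 1) * (shell_const * N * m) = A * ?r ^ l"
    proof -
      have "shell_const * N\<^sup>2 / 2 ^ l * m = (shell_const * N\<^sup>2 * m) * (1 / 2 ^ l)" by simp
      also have "\<dots> powr (p - 1) = (shell_const * N\<^sup>2 * m) powr (p - 1) * (1 / 2 ^ l) powr (p - 1)"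
        by (rule powr_mult)
      also have "(1 / 2 ^ l) powr (p - 1) = ?r ^ l"
      proof -
        have "(1 / 2 ^ l :: real) = 2 powr (- real l)" by (simp add: powr_minus powr_realpow divide_inverse)
        then have "(1 / 2 ^ l :: real) powr (p - 1) = 2 powr (- real l * (p - 1))" by (simp add: powr_powr)
        also have "- real l * (p - 1) = (1 - p) * real l" by (simp add: algebra_simps)
        finally show ?thesis by (simp add: powr_powr[symmetric] powr_realpow)
      qed
      finally show ?thesis by (simp add: A_def)
    qed
    finally show ?thesis .
  qed
  have r: "0 \<le> ?r" "?r < 1" using p by (auto simp: powr_less_one)
  have "(\<integral>\<^sup>+t. ennreal (enn2real (envelope N g t) powr p) \<partial>lborel)
      \<le> (\<integral>\<^sup>+t. (\<Sum>l. ennreal (s l t powr p)) \<partial>lborel)"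
    by (intro nn_integral_mono sum)
  also have "\<dots> = (\<Sum>l. \<integral>\<^sup>+t. ennreal (s l t powr p) \<partial>lborel)"
    by (rule nn_integral_suminf) measurable
  also have "\<dots> \<le> (\<Sum>l. ennreal (A * ?r ^ l))"
    by (intro suminf_le bound) auto
  also have "\<dots> = ennreal (\<Sum>l. A * ?r ^ l)"
    using A0 r by (intro suminf_ennreal2 summable_mult summable_geometric) auto
  also have "(\<Sum>l. A * ?r ^ l) = A / (1 - ?r)"
    using r by (subst suminf_mult) (auto simp: suminf_geometric summable_geometric)
  also have "A = shell_const powr p * N powr (2 * p - 1) * m powr p"
  proof (cases "m = 0")
    case True
    then show ?thesis by (simp add: A_def)
  next
    case False
    then have m: "0 < m" using m by simp
    have "A = (shell_const powr (p - 1) * (N powr 2) powr (p - 1) * m powr (p - 1))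
        * (shell_const powr 1 * N powr 1 * m powr 1)"
      using shell_const N m unfolding A_def by (simp add: powr_mult)
    also have "\<dots> = (shell_const powr (p - 1) * shell_const powr 1) * (N powr (2 * (p - 1)) * N powr 1)
        * (m powr (p - 1) * m powr 1)"
      by (simp only: powr_powr mult_ac)
    also have "\<dots> = shell_const powr p * N powr (2 * p - 1) * m powr p"
      by (simp only: powr_add[symmetric]) (simp add: algebra_simps)
    finally show ?thesis .
  qed
  finally show ?thesis by simp
qed

section \<open>Gaussians are Schwartz functions\<close>

inductive polyfn :: "(real^2 \<Rightarrow> real) \<Rightarrow> bool" where
  const: "polyfn (\<lambda>x. c)"
| coord: "polyfn (\<lambda>x. x $ i)"
| add: "polyfn P \<Longrightarrow> polyfn Q \<Longrightarrow> polyfn (\<lambda>x. P x + Q x)"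
| mult: "polyfn P \<Longrightarrow> polyfn Q \<Longrightarrow> polyfn (\<lambda>x. P x * Q x)"

lemma polyfn_derivative:
  "polyfn P \<Longrightarrow> \<exists>Q1 Q2. polyfn Q1 \<and> polyfn Q2 \<and>
     (\<forall>x. (P has_derivative (\<lambda>h. Q1 x * h $ 1 + Q2 x * h $ 2)) (at x))"
proof (induction rule: polyfn.induct)
  case (const c)
  show ?case
    by (intro exI[of _ "\<lambda>x. 0"]) (auto intro: polyfn.const)
next
  case (coord i)
  have d: "((\<lambda>x::real^2. x $ i) has_derivative (\<lambda>h. h $ i)) (at x)" for x
    by (intro bounded_linear_imp_has_derivative bounded_linear_vec_nth)
  show ?case
    by (rule exI[of _ "\<lambda>x. if i = 1 then 1 else 0"], rule exI[of _ "\<lambda>x. if i = 2 then 1 else 0"])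
       (use d exhaust_2[of i] in \<open>auto intro: polyfn.const\<close>)
next
  case (add P Q)
  then obtain P1 P2 Q1 Q2 where *: "polyfn P1" "polyfn P2" "polyfn Q1" "polyfn Q2"
    "\<And>x. (P has_derivative (\<lambda>h. P1 x * h $ 1 + P2 x * h $ 2)) (at x)"
    "\<And>x. (Q has_derivative (\<lambda>h. Q1 x * h $ 1 + Q2 x * h $ 2)) (at x)" by blast
  have "((\<lambda>x. P x + Q x) has_derivative (\<lambda>h. (P1 x + Q1 x) * h $ 1 + (P2 x + Q2 x) * h $ 2)) (at x)" for x
    using has_derivative_add[OF *(5)[of x] *(6)[of x]] by (simp add: algebra_simps)
  then show ?case using * by (blast intro: polyfn.add)
next
  case (mult P Q)
  then obtain P1 P2 Q1 Q2 where *: "polyfn P1" "polyfn P2" "polyfn Q1" "polyfn Q2"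
    "\<And>x. (P has_derivative (\<lambda>h. P1 x * h $ 1 + P2 x * h $ 2)) (at x)"
    "\<And>x. (Q has_derivative (\<lambda>h. Q1 x * h $ 1 + Q2 x * h $ 2)) (at x)" by blast
  have d: "((\<lambda>x. P x * Q x) has_derivative (\<lambda>h. (P x * Q1 x + P1 x * Q x) * h $ 1
      + (P x * Q2 x + P2 x * Q x) * h $ 2)) (at x)" for x
    using has_derivative_mult[OF *(5)[of x] *(6)[of x]] by (simp add: algebra_simps)
  have "polyfn (\<lambda>x. P x * Q1 x + P1 x * Q x)" "polyfn (\<lambda>x. P x * Q2 x + P2 x * Q x)"
    using * mult.hyps by (auto intro!: polyfn.add polyfn.mult)
  then show ?case using d by blast
qed

lemma polyfn_bound:
  "polyfn P \<Longrightarrow> \<exists>C m. 0 \<le> C \<and> (\<forall>x. \<bar>P x\<bar> \<le> C * (1 + norm x) ^ m)"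
proof (induction rule: polyfn.induct)
  case (const c)
  show ?case by (rule exI[of _ "\<bar>c\<bar>"], rule exI[of _ 0]) auto
next
  case (coord i)
  have "\<bar>x $ i\<bar> \<le> 1 * (1 + norm x) ^ 1" for x :: "real^2"
    using component_le_norm_cart[of x i] by simp
  then show ?case by (intro exI[of _ 1]) auto
next
  case (add P Q)
  then obtain C m D n where *: "0 \<le> C" "\<And>x. \<bar>P x\<bar> \<le> C * (1 + norm x) ^ m" "0 \<le> D" "\<And>x. \<bar>Q x\<bar>
      \<le> D * (1 + norm x) ^ n" by blast
  have "\<bar>P x + Q x\<bar> \<le> (C + D) * (1 + norm x) ^ (m + n)" for x
  proof -
    have "(1 + norm x) ^ m \<le> (1 + norm x) ^ (m + n)" "(1 + norm x) ^ n \<le> (1 + norm x) ^ (m + n)"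
      by (intro power_increasing; simp)+
    then have "C * (1 + norm x) ^ m \<le> C * (1 + norm x) ^ (m + n)" "D * (1 + norm x) ^ n
        \<le> D * (1 + norm x) ^ (m + n)"
      using * by (auto intro: mult_left_mono)
    then show ?thesis using *(2)[of x] *(4)[of x] unfolding distrib_right by linarith
  qed
  then show ?case using * by (intro exI[of _ "C + D"] exI[of _ "m + n"]) auto
next
  case (mult P Q)
  then obtain C m D n where *: "0 \<le> C" "\<And>x. \<bar>P x\<bar> \<le> C * (1 + norm x) ^ m" "0 \<le> D" "\<And>x. \<bar>Q x\<bar>
      \<le> D * (1 + norm x) ^ n" by blast
  have "\<bar>P x * Q x\<bar> \<le> (C * D) * (1 + norm x) ^ (m + n)" for x
  proof -
    have "\<bar>P x\<bar> * \<bar>Q x\<bar> \<le> (C * (1 + norm x) ^ m) * (D * (1 + norm x) ^ n)"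
      using * by (intro mult_mono) auto
    then show ?thesis by (simp add: abs_mult power_add mult_ac)
  qed
  then show ?case using * by (intro exI[of _ "C * D"] exI[of _ "m + n"]) auto
qed

definition gauss :: "real \<Rightarrow> real^2 \<Rightarrow> real^2 \<Rightarrow> real" where
  "gauss \<alpha> b x = exp (b \<bullet> x - \<alpha> * (x \<bullet> x))"

lemma gauss_derivative:
  "(gauss \<alpha> b has_derivative (\<lambda>h. (b $ 1 - 2 * \<alpha> * x $ 1) * gauss \<alpha> b x * h $ 1 + (b $ 2 - 2 * \<alpha> * x $ 2)
      * gauss \<alpha> b x * h $ 2)) (at x)"
proof -
  have "((\<lambda>x. exp (b \<bullet> x - \<alpha> * (x \<bullet> x))) has_derivative (\<lambda>h. (b \<bullet> h - \<alpha> * (x \<bullet> h + h \<bullet> x))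
      * exp (b \<bullet> x - \<alpha> * (x \<bullet> x)))) (at x)"
    by (auto intro!: derivative_eq_intros)
  then show ?thesis
    by (simp add: gauss_def[abs_def] inner_pt algebra_simps)
qed

text \<open>Polynomials times a fixed Gaussian are closed under partial derivatives.\<close>

lemma iter_partial_gauss:
  "\<exists>P. polyfn P \<and> iter_partial is (\<lambda>x. complex_of_real (gauss \<alpha> b x))
      = (\<lambda>x. complex_of_real (P x * gauss \<alpha> b x))"
proof (induction "is")
  case Nil
  show ?case by (intro exI[of _ "\<lambda>x. 1"]) (auto intro: polyfn.const)
next
  case (Cons i "is")
  then obtain P where P: "polyfn P" and eq: "iter_partial is (\<lambda>x. complex_of_real (gauss \<alpha> b x))
      = (\<lambda>x. complex_of_real (P x * gauss \<alpha> b x))" by blast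
  obtain P1 P2 where P12: "polyfn P1" "polyfn P2" "\<And>x. (P has_derivative (\<lambda>h. P1 x * h $ 1 + P2 x
      * h $ 2)) (at x)"
    using polyfn_derivative[OF P] by blast
  define R where "R = (\<lambda>(i::2) x. (if i = 1 then P1 x else P2 x) + P x * (b $ i + (- 2 * \<alpha>) * x $ i))"
  have R: "polyfn (R i)" for i
  proof -
    have l: "polyfn (\<lambda>x. b $ i + (- 2 * \<alpha>) * x $ i)" by (intro polyfn.intros)
    show ?thesis
      unfolding R_def using P12(1,2) by (intro polyfn.add polyfn.mult P l) (cases "i = 1"; simp)
  qed
  have d: "((\<lambda>x. P x * gauss \<alpha> b x) has_derivative (\<lambda>h. R 1 x * gauss \<alpha> b x * h $ 1 + R 2 x * gauss \<alpha> b x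
      * h $ 2)) (at x)" for x
    using has_derivative_mult[OF P12(3)[of x] gauss_derivative[of \<alpha> b x]]
    by (rule has_derivative_eq_rhs) (auto simp: R_def algebra_simps)
  have "((\<lambda>x. complex_of_real (P x * gauss \<alpha> b x)) has_derivative
      (\<lambda>h. complex_of_real (R 1 x * gauss \<alpha> b x * h $ 1 + R 2 x * gauss \<alpha> b x * h $ 2))) (at x)" for x
    by (rule has_derivative_of_real[OF d])
  then have "frechet_derivative (\<lambda>x. complex_of_real (P x * gauss \<alpha> b x)) (at x)
      = (\<lambda>h. complex_of_real (R 1 x * gauss \<alpha> b x * h $ 1 + R 2 x * gauss \<alpha> b x * h $ 2))" for x
    by (rule frechet_derivative_at[symmetric])
  then have "iter_partial (i # is) (\<lambda>x. complex_of_real (gauss \<alpha> b x))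
      = (\<lambda>x. complex_of_real (R i x * gauss \<alpha> b x))"
    using exhaust_2[of i] by (auto simp: eq axis_def)
  then show ?case using R by blast
qed

text \<open>With \<open>r = norm x\<close>, first \<open>(1 + r) ^ k \<le> fact k * exp (1 + r)\<close>; then the exponent is a quadratic
polynomial in \<open>r\<close> with negative leading coefficient, and it remains to complete the square.\<close>

lemma gauss_decay:
  assumes "0 < \<alpha>"
  shows "\<exists>B. \<forall>x. (1 + norm x) ^ k * gauss \<alpha> b x \<le> B"
proof (intro exI allI)
  fix x :: "real^2"
  let ?r = "norm x" and ?\<beta> = "norm b"
  have "(1 + ?r) ^ k / fact k \<le> exp (1 + ?r)"
  proof -
    have "(\<Sum>i\<in>{k}. (1 + ?r) ^ i /\<^sub>R fact i) \<le> (\<Sum>i. (1 + ?r) ^ i /\<^sub>R fact i)"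
      by (intro sum_le_suminf summable_exp_generic) auto
    then show ?thesis by (simp add: exp_def divide_inverse mult.commute)
  qed
  then have 1: "(1 + ?r) ^ k \<le> fact k * exp (1 + ?r)" by (simp add: field_simps)
  have 2: "gauss \<alpha> b x \<le> exp (?\<beta> * ?r - \<alpha> * ?r\<^sup>2)"
    unfolding gauss_def using norm_cauchy_schwarz[of b x] by (simp add: power2_norm_eq_inner)
  have "(1 + ?r) ^ k * gauss \<alpha> b x \<le> (fact k * exp (1 + ?r)) * exp (?\<beta> * ?r - \<alpha> * ?r\<^sup>2)"
    by (intro mult_mono 1 2) (auto simp: gauss_def)
  also have "\<dots> = fact k * exp (1 + (1 + ?\<beta>) * ?r - \<alpha> * ?r\<^sup>2)"
    by (simp add: exp_add[symmetric] algebra_simps)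
  also have "\<dots> \<le> fact k * exp (1 + (1 + ?\<beta>)\<^sup>2 / (4 * \<alpha>))"
  proof -
    have "0 \<le> \<alpha> * (?r - (1 + ?\<beta>) / (2 * \<alpha>))\<^sup>2" using assms by simp
    also have "\<dots> = \<alpha> * ?r\<^sup>2 - (1 + ?\<beta>) * ?r + (1 + ?\<beta>)\<^sup>2 / (4 * \<alpha>)"
      using assms by (simp add: power2_eq_square field_simps)
    finally show ?thesis by simp
  qed
  finally show "(1 + ?r) ^ k * gauss \<alpha> b x \<le> fact k * exp (1 + (1 + ?\<beta>)\<^sup>2 / (4 * \<alpha>))" .
qed

lemma schwartz_gauss:
  assumes "0 < \<alpha>"
  shows "schwartz (\<lambda>x. complex_of_real (gauss \<alpha> b x))"
  unfolding schwartz_def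
proof (intro conjI allI)
  fix "is" x
  obtain P where P: "polyfn P" and eq: "iter_partial is (\<lambda>x. complex_of_real (gauss \<alpha> b x))
      = (\<lambda>x. complex_of_real (P x * gauss \<alpha> b x))"
    using iter_partial_gauss by blast
  obtain P1 P2 where "\<And>x. (P has_derivative (\<lambda>h. P1 x * h $ 1 + P2 x * h $ 2)) (at x)"
    using polyfn_derivative[OF P] by blast
  from has_derivative_of_real[OF has_derivative_mult[OF this gauss_derivative]]
  show "iter_partial is (\<lambda>x. complex_of_real (gauss \<alpha> b x)) differentiable at x"
    unfolding eq differentiable_def by blast
next
  fix "is" :: "2 list" and N :: nat
  obtain P where P: "polyfn P" and eq: "iter_partial is (\<lambda>x. complex_of_real (gauss \<alpha> b x))
      = (\<lambda>x. complex_of_real (P x * gauss \<alpha> b x))"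
    using iter_partial_gauss by blast
  obtain C m where C: "0 \<le> C" "\<And>x. \<bar>P x\<bar> \<le> C * (1 + norm x) ^ m"
    using polyfn_bound[OF P] by blast
  obtain B where B: "\<And>x. (1 + norm x) ^ (N + m) * gauss \<alpha> b x \<le> B"
    using gauss_decay[OF assms] by blast
  show "bounded (range (\<lambda>x. (1 + norm x) ^ N * norm (iter_partial is (\<lambda>x. complex_of_real (gauss \<alpha> b x)) x)))"
    unfolding bounded_iff eq
  proof (intro exI ballI)
    fix y assume "y \<in> range (\<lambda>x. (1 + norm x) ^ N * norm (complex_of_real (P x * gauss \<alpha> b x)))"
    then obtain x where y: "y = (1 + norm x) ^ N * (\<bar>P x\<bar> * gauss \<alpha> b x)"
      by (auto simp: norm_mult gauss_def)
    have "norm y \<le> (1 + norm x) ^ N * ((C * (1 + norm x) ^ m) * gauss \<alpha> b x)"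
      unfolding y using C by (auto simp: abs_mult gauss_def intro!: mult_left_mono mult_right_mono)
    also have "\<dots> = C * ((1 + norm x) ^ (N + m) * gauss \<alpha> b x)"
      by (simp add: power_add mult_ac)
    also have "\<dots> \<le> C * B" by (intro mult_left_mono B C)
    finally show "norm y \<le> C * B" .
  qed
qed

section \<open>Integrability of Schwartz functions\<close>

lemma nn_integral_inverse_square: "(\<integral>\<^sup>+x. ennreal (inverse (1 + x\<^sup>2)) \<partial>lborel) < top"
proof -
  have "set_integrable lborel (einterval (-\<infinity>) \<infinity>) (\<lambda>x. inverse (1 + x\<^sup>2))"
    by (rule integrable_inverse_1_plus_square)
  then have "integrable lborel (\<lambda>x. inverse (1 + x\<^sup>2) :: real)"
    by (simp add: set_integrable_def)
  then show ?thesis by (simp add: integrable_iff_bounded less_top)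
qed

lemma schwartz_measurable [measurable_dest]:
  assumes "schwartz \<phi>"
  shows "\<phi> \<in> borel_measurable borel"
proof -
  have "iter_partial [] \<phi> differentiable at x" for x using assms unfolding schwartz_def by blast
  then have "continuous_on UNIV \<phi>"
    by (auto intro!: continuous_at_imp_continuous_on differentiable_imp_continuous_within)
  then show ?thesis by (rule borel_measurable_continuous_onI)
qed

text \<open>The product form is integrable over the plane by Fubini.\<close>

lemma schwartz_decay:
  assumes "schwartz \<phi>"
  shows "\<exists>C\<ge>0. \<forall>x. norm (\<phi> x) \<le> C * (inverse (1 + (x $ 1)\<^sup>2) * inverse (1 + (x $ 2)\<^sup>2)) \<and> norm (\<phi> x) \<le> C"
proof -
  have "bounded (range (\<lambda>x. (1 + norm x) ^ 4 * norm (iter_partial [] \<phi> x)))"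
    using assms unfolding schwartz_def by blast
  then obtain C where C: "\<And>x. norm ((1 + norm x) ^ 4 * norm (\<phi> x)) \<le> C"
    unfolding bounded_iff by auto
  have C0: "0 \<le> C" using order_trans[OF norm_ge_zero C[of 0]] .
  have "norm (\<phi> x) \<le> C * (inverse (1 + (x $ 1)\<^sup>2) * inverse (1 + (x $ 2)\<^sup>2)) \<and> norm (\<phi> x) \<le> C" for x
  proof -
    have sq: "1 + (x $ i)\<^sup>2 \<le> (1 + norm x)\<^sup>2" for i
    proof -
      have "(x $ i)\<^sup>2 \<le> (norm x)\<^sup>2"
        using power_mono[OF component_le_norm_cart[of x i], of 2] by simp
      then show ?thesis by (simp add: power2_sum) (smt (verit) norm_ge_zero)
    qed
    have "(1 + (x $ 1)\<^sup>2) * (1 + (x $ 2)\<^sup>2) \<le> (1 + norm x)\<^sup>2 * (1 + norm x)\<^sup>2"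
      by (intro mult_mono sq) auto
    also have "\<dots> = (1 + norm x) ^ 4" by (simp flip: power_add)
    finally have "((1 + (x $ 1)\<^sup>2) * (1 + (x $ 2)\<^sup>2)) * norm (\<phi> x) \<le> (1 + norm x) ^ 4 * norm (\<phi> x)"
      by (intro mult_right_mono) auto
    also have "\<dots> \<le> C" using C[of x] by simp
    finally have *: "((1 + (x $ 1)\<^sup>2) * (1 + (x $ 2)\<^sup>2)) * norm (\<phi> x) \<le> C" .
    have pos: "0 < 1 + (x $ i)\<^sup>2" for i by (simp add: add_pos_nonneg)
    have "norm (\<phi> x) \<le> C / ((1 + (x $ 1)\<^sup>2) * (1 + (x $ 2)\<^sup>2))"
      using * pos by (subst pos_le_divide_eq) (auto simp: mult.commute)
    moreover have "1 * norm (\<phi> x) \<le> (1 + norm x) ^ 4 * norm (\<phi> x)"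
      by (intro mult_right_mono one_le_power) auto
    ultimately show ?thesis using C[of x] by (simp add: divide_inverse)
  qed
  then show ?thesis using C0 by blast
qed

lemma schwartz_integrable:
  assumes s: "schwartz \<phi>"
  shows "integrable lborel \<phi>" and "mass \<phi> < top"
proof -
  have [measurable]: "\<phi> \<in> borel_measurable borel" using s by (rule schwartz_measurable)
  obtain C where C: "0 \<le> C" "\<And>x. norm (\<phi> x) \<le> C * (inverse (1 + (x $ 1)\<^sup>2) * inverse (1 + (x $ 2)\<^sup>2))"
      "\<And>x. norm (\<phi> x) \<le> C"
    using schwartz_decay[OF s] by blast
  have "(\<integral>\<^sup>+x. ennreal (norm (\<phi> x)) \<partial>lborel) \<le> (\<integral>\<^sup>+x. ennreal C
      * (ennreal (inverse (1 + (x $ 1)\<^sup>2)) * ennreal (inverse (1 + ((x::real^2) $ 2)\<^sup>2))) \<partial>lborel)"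
    using C by (intro nn_integral_mono) (auto simp: ennreal_mult[symmetric] intro!: ennreal_leI)
  also have "\<dots> = ennreal C * ((\<integral>\<^sup>+x. ennreal (inverse (1 + x\<^sup>2)) \<partial>lborel)
      * (\<integral>\<^sup>+x. ennreal (inverse (1 + x\<^sup>2)) \<partial>lborel))"
    by (subst nn_integral_real2) (auto simp: nn_integral_cmult nn_integral_multc)
  also have "\<dots> < top" using nn_integral_inverse_square by (simp add: ennreal_mult_less_top)
  finally show i: "integrable lborel \<phi>" by (intro integrableI_bounded) (auto simp: less_top)
  have "mass \<phi> \<le> (\<integral>\<^sup>+x. ennreal C * ennreal (norm (\<phi> x)) \<partial>lborel)"
    using C by (intro nn_integral_mono) (auto simp: ennreal_mult'[symmetric] power2_eq_square intro!:
        ennreal_leI mult_right_mono)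
  also have "\<dots> = ennreal C * (\<integral>\<^sup>+x. ennreal (norm (\<phi> x)) \<partial>lborel)"
    by (rule nn_integral_cmult) measurable
  also have "\<dots> < top" using i by (simp add: integrable_iff_bounded ennreal_mult_less_top less_top)
  finally show "mass \<phi> < top" .
qed

text \<open>These bounds suffice to integrate \<open>inv_fourier \<phi>\<close> against the Fourier transforms that occur: near
the origin these are integrable, away from it square integrable.\<close>

lemma inv_fourier_schwartz:
  assumes s: "schwartz \<phi>"
  shows "inv_fourier \<phi> \<in> borel_measurable borel" "norm (inv_fourier \<phi> \<xi>) \<le> (LINT x|lborel. norm (\<phi> x))"
    "mass (inv_fourier \<phi>) < top"
proof -
  have [measurable]: "\<phi> \<in> borel_measurable borel" using s by (rule schwartz_measurable)
  let ?c = "complex_of_real ((2 * pi)\<^sup>2)"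
  have eq: "inv_fourier \<phi> x = wave \<phi> 0 x / ?c" for x
    by (simp add: inv_fourier_def wave_def)
  have [measurable]: "wave \<phi> 0 \<in> borel_measurable borel" by measurable
  show "inv_fourier \<phi> \<in> borel_measurable borel" unfolding eq[abs_def] by measurable
  have "1 \<le> 2 * pi" using pi_gt3 by simp
  then have one: "1 \<le> (2 * pi)\<^sup>2" by (rule one_le_power)
  have le: "norm (inv_fourier \<phi> x) \<le> norm (wave \<phi> 0 x)" for x
  proof -
    have "norm (inv_fourier \<phi> x) = norm (wave \<phi> 0 x) / (2 * pi)\<^sup>2"
      by (simp add: eq norm_divide norm_power norm_mult)
    also have "\<dots> \<le> norm (wave \<phi> 0 x) / 1" using one by (intro divide_left_mono) auto
    finally show ?thesis by simp
  qed
  show "norm (inv_fourier \<phi> \<xi>) \<le> (LINT x|lborel. norm (\<phi> x))"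
    using le norm_wave_le[OF schwartz_integrable(1)[OF s]] by (rule order_trans)
  have "mass (inv_fourier \<phi>) \<le> mass (wave \<phi> 0)"
    using le by (intro nn_integral_mono ennreal_leI power_mono) auto
  also have "\<dots> \<le> ennreal ((2 * pi)\<^sup>2) * mass \<phi>"
    by (rule wave_energy[OF schwartz_integrable(1)[OF s]])
  also have "\<dots> < top" using schwartz_integrable(2)[OF s] by (simp add: ennreal_mult_less_top)
  finally show "mass (inv_fourier \<phi>) < top" .
qed

section \<open>Uniqueness of representing functions\<close>

lemma integral_affine_plane:
  fixes f :: "real^2 \<Rightarrow> real"
  assumes [measurable]: "f \<in> borel_measurable borel" and m: "0 < m"
  shows "(LINT z|lborel. f z) = (LINT w|lborel. f (x + (1 / m) *\<^sub>R w)) / m\<^sup>2"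
proof -
  have m0: "1 / m \<noteq> 0" using m by simp
  have "(LINT z|lborel. f z) = (LINT z|density (distr lborel borel (\<lambda>w. x + (1 / m) *\<^sub>R w))
      (\<lambda>_. \<bar>1 / m\<bar> ^ DIM(real^2)). f z)"
    using lborel_affine[OF m0, of x] by simp
  also have "\<dots> = (LINT w|lborel. (1 / m)\<^sup>2 * f (x + (1 / m) *\<^sub>R w))"
    using m by (subst integral_density) (auto simp: integral_distr DIM_cart)
  also have "\<dots> = (LINT w|lborel. f (x + (1 / m) *\<^sub>R w)) / m\<^sup>2"
    by (simp add: power_divide)
  finally show ?thesis .
qed

lemma gauss_bump_properties:
  "integrable lborel (gauss 1 0)" "0 < (LINT w|lborel. gauss 1 0 w)" "gauss 1 0 x \<le> 1" "0 < gauss \<alpha> b x"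
  "gauss \<alpha> b \<in> borel_measurable borel"
proof -
  show m: "gauss \<alpha> b \<in> borel_measurable borel" for \<alpha> b unfolding gauss_def[abs_def] by measurable
  have "integrable lborel (\<lambda>x. complex_of_real (gauss 1 0 x))"
    by (intro schwartz_integrable schwartz_gauss) simp
  then show i: "integrable lborel (gauss 1 0)" by (simp only: complex_of_real_integrable_eq)
  show pos: "0 < gauss \<alpha> b x" for \<alpha> b x by (simp add: gauss_def)
  have "(LINT w|lborel. gauss 1 0 w) \<noteq> 0"
  proof
    assume "(LINT w|lborel. gauss 1 0 w) = 0"
    then have "AE w in lborel. gauss 1 0 w = 0"
      using integral_nonneg_eq_0_iff_AE[OF i] pos by (auto simp: less_imp_le)
    then have "AE w::real^2 in lborel. False" by eventually_elim (use pos in \<open>auto simp: less_le\<close>)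
    then have "(UNIV :: (real^2) set) \<in> null_sets lborel" by (simp add: AE_iff_null)
    then show False by (simp add: null_sets_def)
  qed
  moreover have "0 \<le> (LINT w|lborel. gauss 1 0 w)"
    using pos by (intro Bochner_Integration.integral_nonneg) (auto simp: less_imp_le)
  ultimately show "0 < (LINT w|lborel. gauss 1 0 w)" by simp
  show "gauss 1 0 x \<le> 1" by (simp add: gauss_def)
qed

text \<open>Integrate the hypothesis over all \<open>z\<close> in the box.  The function \<open>u\<close> is then integrated against the
convolution of the indicator of the box with a Gaussian of width \<open>1 / m\<close>, which converges to a
multiple of the indicator outside the boundary of the box as \<open>m\<close> tends to infinity.\<close>

lemma integral_box_eq_0:
  fixes u :: "real^2 \<Rightarrow> complex"
  assumes u: "integrable lborel u"
    and z: "\<And>(m::real) z. 0 < m \<Longrightarrow> (LINT x|lborel. u x * complex_of_real (gauss 1 0 (m *\<^sub>R (z - x)))) = 0"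
  shows "(LINT x:box l r|lborel. u x) = 0"
proof -
  let ?B = "box l r"
  let ?g = "gauss 1 0" and ?c = "LINT w|lborel. gauss 1 0 w"
  have [measurable]: "u \<in> borel_measurable borel" using u by auto
  have [measurable]: "?g \<in> borel_measurable borel" by (rule gauss_bump_properties)
  have g0: "0 \<le> ?g x" for x using gauss_bump_properties(4)[of 1 0 x] by simp
  \<comment> \<open>The mollified indicator of the box, after rescaling the Gaussian to unit width.\<close>
  define K where "K = (\<lambda>n x. LINT w|lborel. ?g w * indicator ?B (x + (1 / real (Suc n)) *\<^sub>R w))"
  have Kint: "integrable lborel (\<lambda>w. ?g w * indicator ?B (x + (1 / real (Suc n)) *\<^sub>R w))" for n x
    by (rule Bochner_Integration.integrable_bound[OF gauss_bump_properties(1)]) (auto split: split_indicator)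
  have Kbd: "norm (K n x) \<le> ?c" for n x
  proof -
    have "K n x \<le> ?c" unfolding K_def
      using Kint gauss_bump_properties(1) g0 by (intro integral_mono) (auto split: split_indicator)
    moreover have "0 \<le> K n x" unfolding K_def using g0 by (intro Bochner_Integration.integral_nonneg) auto
    ultimately show ?thesis by simp
  qed
  have [measurable]: "K n \<in> borel_measurable borel" for n unfolding K_def by measurable
  have Keq: "K n x = (real (Suc n))\<^sup>2 * (LINT z|lborel. ?g (real (Suc n) *\<^sub>R (z - x)) * indicator ?B z)" for n x
    by (subst integral_affine_plane[where m="real (Suc n)" and x=x]) (auto simp: K_def)
  have zero: "(LINT x|lborel. u x * complex_of_real (K n x)) = 0" for n
  proof -
    let ?m = "real (Suc n)"
    let ?F = "\<lambda>x z. u x * complex_of_real (?g (?m *\<^sub>R (z - x)) * indicator ?B z)"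
    have "integrable lborel (\<lambda>z. complex_of_real (indicator ?B z))"
      by (intro integrable_of_real integrable_real_indicator) (auto simp: emeasure_lborel_box_eq)
    then have iB: "integrable lborel (\<lambda>z. indicator ?B z :: complex)"
      by (simp only: of_real_indicator)
    have iF: "integrable (lborel \<Otimes>\<^sub>M lborel) (\<lambda>(x, z). ?F x z)"
    proof (rule Bochner_Integration.integrable_bound[OF integrable_times_pair[OF u iB]])
      show "AE p in lborel \<Otimes>\<^sub>M lborel. norm (case p of (x, z) \<Rightarrow> ?F x z)
          \<le> norm (case p of (x, z) \<Rightarrow> u x * indicator ?B z)"
        using g0 gauss_bump_properties(3)
        by (intro AE_I2) (auto simp: norm_mult split: split_indicator intro!: mult_left_le)
    qed measurable
    have K: "complex_of_real (K n x) = complex_of_real (?m\<^sup>2) *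
        (LINT z|lborel. complex_of_real (?g (?m *\<^sub>R (z - x)) * indicator ?B z))" for x
      by (subst integral_complex_of_real) (simp only: Keq of_real_mult)
    have "(LINT x|lborel. u x * complex_of_real (K n x))
        = (LINT x|lborel. complex_of_real (?m\<^sup>2) * (LINT z|lborel. ?F x z))"
      by (simp only: K integral_mult_right_zero mult.left_commute[of "u _"])
    also have "\<dots> = complex_of_real (?m\<^sup>2) * (LINT x|lborel. LINT z|lborel. ?F x z)"
      by (rule integral_mult_right_zero)
    also have "(LINT x|lborel. LINT z|lborel. ?F x z) = (LINT z|lborel. LINT x|lborel. ?F x z)"
      by (rule lborel_pair.Fubini_integral[OF iF, symmetric])
    also have "\<dots> = (LINT z|lborel. (LINT x|lborel. u x * complex_of_real (?g (?m *\<^sub>R (z - x))))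
        * indicator ?B z)"
      by (simp only: of_real_mult of_real_indicator mult.assoc[symmetric] integral_mult_left_zero)
    also have "\<dots> = 0" using z[of ?m] by simp
    finally show ?thesis by simp
  qed
  have front: "AE x in lborel. x \<notin> cbox l r - ?B"
  proof -
    have "cbox l r - ?B \<in> null_sets lborel"
      using negligible_frontier_interval[of l r] by (simp add: negligible_iff_null_sets
          null_sets_completion_iff)
    then show ?thesis by (rule AE_not_in)
  qed
  have lim: "(\<lambda>n. K n x) \<longlonglongrightarrow> ?c * indicator ?B x" if x: "x \<notin> cbox l r - ?B" for x
  proof -
    have "(\<lambda>n. K n x) \<longlonglongrightarrow> (LINT w|lborel. ?g w * indicator ?B x)"
      unfolding K_def
    proof (rule integral_dominated_convergence[where w="?g"])
      show "AE w in lborel. (\<lambda>n. ?g w * indicator ?B (x + (1 / real (Suc n)) *\<^sub>R w)) \<longlonglongrightarrow> ?g w * indicator ?B x"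
      proof (intro AE_I2 tendsto_mult tendsto_const)
        fix w :: "real^2"
        have t: "(\<lambda>n. x + (1 / real (Suc n)) *\<^sub>R w) \<longlonglongrightarrow> x + 0 *\<^sub>R w"
          using LIMSEQ_inverse_real_of_nat by (intro tendsto_intros) (simp add: inverse_eq_divide)
        show "(\<lambda>n. indicator ?B (x + (1 / real (Suc n)) *\<^sub>R w)) \<longlonglongrightarrow> (indicator ?B x :: real)"
        proof (cases "x \<in> ?B")
          case True
          have "eventually (\<lambda>n. x + (1 / real (Suc n)) *\<^sub>R w \<in> ?B) sequentially"
            using topological_tendstoD[OF t open_box] True by simp
          then have "eventually (\<lambda>n. indicator ?B (x + (1 / real (Suc n)) *\<^sub>R w) = (1::real)) sequentially"
            by eventually_elim simp
          then show ?thesis using True by (simp add: tendsto_eventually)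
        next
          case False
          then have x': "x \<in> - cbox l r" using x by auto
          have "open (- cbox l r)" by (simp add: open_Compl closed_cbox)
          then have "eventually (\<lambda>n. x + (1 / real (Suc n)) *\<^sub>R w \<in> - cbox l r) sequentially"
            using topological_tendstoD[OF t, of "- cbox l r"] x' by simp
          then have "eventually (\<lambda>n. indicator ?B (x + (1 / real (Suc n)) *\<^sub>R w) = (0::real)) sequentially"
            by eventually_elim (use box_subset_cbox in \<open>auto split: split_indicator\<close>)
          then show ?thesis using False by (simp add: tendsto_eventually)
        qed
      qed
      show "AE w in lborel. norm (?g w * indicator ?B (x + (1 / real (Suc n)) *\<^sub>R w)) \<le> ?g w" for n
        using g0 by (auto split: split_indicator)
    qed (use gauss_bump_properties in auto)
    then show ?thesis by simp
  qed
  have "(\<lambda>n. LINT x|lborel. u x * complex_of_real (K n x)) \<longlonglongrightarrow> (LINT x|lborel. u x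
      * complex_of_real (?c * indicator ?B x))"
  proof (rule integral_dominated_convergence[where w="\<lambda>x. norm (u x) * ?c"])
    show "AE x in lborel. (\<lambda>n. u x * complex_of_real (K n x)) \<longlonglongrightarrow> u x * complex_of_real (?c * indicator ?B x)"
      using front by eventually_elim (intro tendsto_mult tendsto_const tendsto_of_real lim)
    show "AE x in lborel. norm (u x * complex_of_real (K n x)) \<le> norm (u x) * ?c" for n
      using Kbd by (intro AE_I2) (auto simp: norm_mult intro!: mult_left_mono)
  qed (use u in auto)
  then have "(LINT x|lborel. u x * complex_of_real (?c * indicator ?B x)) = 0"
    unfolding zero by (simp add: LIMSEQ_const_iff)
  also have "(\<lambda>x. u x * complex_of_real (?c * indicator ?B x))
      = (\<lambda>x. complex_of_real ?c * (indicator ?B x *\<^sub>R u x))"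
    by (auto split: split_indicator)
  finally have "complex_of_real ?c * (LINT x:box l r|lborel. u x) = 0"
    by (simp only: set_lebesgue_integral_def integral_mult_right_zero)
  then show ?thesis using gauss_bump_properties(2) by simp
qed

text \<open>The boxes generate the Borel sets and are closed under intersections, so all set integrals of \<open>u\<close>
vanish.\<close>

lemma AE_0_of_gaussians:
  fixes u :: "real^2 \<Rightarrow> complex"
  assumes u: "integrable lborel u"
    and z: "\<And>(m::real) z. 0 < m \<Longrightarrow> (LINT x|lborel. u x * complex_of_real (gauss 1 0 (m *\<^sub>R (z - x)))) = 0"
  shows "AE x in lborel. u x = 0"
proof (rule sigma_finite_measure.density_zero[OF sigma_finite_lborel u])
  have [measurable]: "u \<in> borel_measurable borel" using u by auto
  have si: "set_integrable lborel A u" if "A \<in> sets borel" for A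
    using that u unfolding set_integrable_def by (intro integrable_mult_indicator) auto
  have box: "(LINT x:box l r|lborel. u x) = 0" for l r
    by (rule integral_box_eq_0[OF u z])
  have total: "(LINT x|lborel. u x) = 0"
  proof -
    let ?B = "\<lambda>i::nat. box (- (real i *\<^sub>R One)) (real i *\<^sub>R One) :: (real^2) set"
    have "(\<lambda>i. LINT x|lborel. indicator (?B i) x *\<^sub>R u x) \<longlonglongrightarrow> (LINT x|lborel. u x)"
    proof (rule integral_dominated_convergence[where w="\<lambda>x. norm (u x)"])
      show "AE x in lborel. (\<lambda>i. indicator (?B i) x *\<^sub>R u x) \<longlonglongrightarrow> u x"
      proof (rule AE_I2)
        fix x :: "real^2"
        obtain i where i: "x \<in> ?B i" using UN_box_eq_UNIV by blast
        have "eventually (\<lambda>j. indicator (?B j) x *\<^sub>R u x = u x) sequentially"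
        proof (rule eventually_sequentiallyI[of i])
          fix j assume j: "i \<le> j"
          have "?B i \<subseteq> ?B j" using j by (intro subset_box_imp) auto
          then show "indicator (?B j) x *\<^sub>R u x = u x" using i by auto
        qed
        then show "(\<lambda>i. indicator (?B i) x *\<^sub>R u x) \<longlonglongrightarrow> u x" by (rule tendsto_eventually)
      qed
    qed (use u in \<open>auto split: split_indicator\<close>)
    moreover have "(LINT x|lborel. indicator (?B i) x *\<^sub>R u x) = 0" for i
      using box by (simp add: set_lebesgue_integral_def)
    ultimately show ?thesis by (simp add: LIMSEQ_const_iff)
  qed
  fix A :: "(real^2) set" assume "A \<in> sets lborel"
  then have A: "A \<in> sigma_sets UNIV (range (\<lambda>(a, b). box a b))"
    by (simp add: borel_eq_box)
  have IS: "Int_stable (range (\<lambda>(a, b). box a b :: (real^2) set))"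
    by (auto simp: Int_stable_def box_Int_box)
  have sb: "B \<in> sets borel" if "B \<in> sigma_sets UNIV (range (\<lambda>(a, b). box a b :: (real^2) set))" for B
    using that by (simp add: borel_eq_box)
  show "set_lebesgue_integral lborel A u = 0"
  proof (rule sigma_sets_induct_disjoint[OF IS _ A])
    show "set_lebesgue_integral lborel B u = 0" if "B \<in> range (\<lambda>(a, b). box a b)" for B
      using that box by auto
    show "set_lebesgue_integral lborel (UNIV - B) u = 0"
      if B: "B \<in> sigma_sets UNIV (range (\<lambda>(a, b). box a b))" and 0: "set_lebesgue_integral lborel B u = 0" for B
    proof -
      have "set_lebesgue_integral lborel (B \<union> (UNIV - B)) u
          = set_lebesgue_integral lborel B u + set_lebesgue_integral lborel (UNIV - B) u"
        using sb[OF B] by (intro set_integral_Un si) auto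
      moreover have "B \<union> (UNIV - B) = UNIV" by auto
      ultimately show ?thesis using 0 total by (simp add: set_lebesgue_integral_def)
    qed
    show "set_lebesgue_integral lborel (\<Union>i::nat. B i) u = 0"
      if d: "disjoint_family B" and r: "range B \<subseteq> sigma_sets UNIV (range (\<lambda>(a, b). box a b))" and 0: "\<And>i.
          set_lebesgue_integral lborel (B i) u = 0" for B
    proof -
      have "B i \<in> sets lborel" for i using sb r by auto
      then have "(\<Sum>i. set_lebesgue_integral lborel (B i) u) = set_lebesgue_integral lborel (\<Union>i. B i) u"
        using d by (intro lebesgue_integral_countable_add[symmetric] si)
          (auto simp: disjoint_family_on_def)
      then show ?thesis using 0 by simp
    qed
  qed (auto simp: set_lebesgue_integral_def)
qed

text \<open>Multiplication with one Gaussian makes the difference integrable, and the product of this Gaussian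
with a translated one is again a Gaussian, hence a Schwartz function.\<close>

lemma represented_by_unique:
  assumes g: "represented_by S g" and g': "represented_by S g'"
  shows "AE x in lborel. g x = g' x"
proof -
  have sch: "schwartz (\<lambda>x. complex_of_real (gauss \<alpha> b x))" if "0 < \<alpha>" for \<alpha> b
    using that by (rule schwartz_gauss)
  let ?G = "\<lambda>\<alpha> b x. complex_of_real (gauss \<alpha> b x)"
  define u where "u = (\<lambda>x. (g x - g' x) * ?G 1 0 x)"
  have i: "integrable lborel (\<lambda>x. g x * ?G \<alpha> b x)" "integrable lborel (\<lambda>x. g' x * ?G \<alpha> b x)"
    "(LINT x|lborel. g x * ?G \<alpha> b x) = (LINT x|lborel. g' x * ?G \<alpha> b x)" if "0 < \<alpha>" for \<alpha> b
    using g g' sch[OF that, of b] unfolding represented_by_def by metis+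
  have iu: "integrable lborel u"
    using Bochner_Integration.integrable_diff[OF i(1,2)[of 1 0]] by (simp add: u_def left_diff_distrib)
  have "AE x in lborel. u x = 0"
  proof (rule AE_0_of_gaussians[OF iu])
    fix m :: real and z :: "real^2"
    assume m: "0 < m"
    let ?\<alpha> = "1 + m\<^sup>2" and ?b = "(2 * m\<^sup>2) *\<^sub>R z"
    have \<alpha>: "0 < ?\<alpha>" by (simp add: add_pos_nonneg)
    have e: "gauss 1 0 x * gauss 1 0 (m *\<^sub>R (z - x)) = gauss ?\<alpha> ?b x * exp (- (m\<^sup>2 * (z \<bullet> z)))" for x
      by (simp add: gauss_def exp_add[symmetric] inner_diff_left inner_diff_right inner_commute
          power2_eq_square algebra_simps)
    have "u x * complex_of_real (gauss 1 0 (m *\<^sub>R (z - x)))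
        = (g x * ?G ?\<alpha> ?b x - g' x * ?G ?\<alpha> ?b x) * complex_of_real (exp (- (m\<^sup>2 * (z \<bullet> z))))" for x
    proof -
      have "u x * complex_of_real (gauss 1 0 (m *\<^sub>R (z - x)))
          = (g x - g' x) * complex_of_real (gauss 1 0 x * gauss 1 0 (m *\<^sub>R (z - x)))"
        by (simp add: u_def)
      also have "\<dots> = (g x - g' x) * complex_of_real (gauss ?\<alpha> ?b x * exp (- (m\<^sup>2 * (z \<bullet> z))))"
        by (simp only: e)
      finally show ?thesis by (simp only: of_real_mult left_diff_distrib mult.assoc)
    qed
    then have "(LINT x|lborel. u x * complex_of_real (gauss 1 0 (m *\<^sub>R (z - x))))
       = (LINT x|lborel. g x * ?G ?\<alpha> ?b x - g' x * ?G ?\<alpha> ?b x) * complex_of_real (exp (- (m\<^sup>2 * (z \<bullet> z))))"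
      by (simp only: integral_mult_left_zero)
    also have "(LINT x|lborel. g x * ?G ?\<alpha> ?b x - g' x * ?G ?\<alpha> ?b x) = 0"
      using i[OF \<alpha>, of ?b] by simp
    finally show "(LINT x|lborel. u x * complex_of_real (gauss 1 0 (m *\<^sub>R (z - x)))) = 0" by simp
  qed
  then show ?thesis
    by eventually_elim (use gauss_bump_properties(4)[of 1 0] in \<open>auto simp: u_def less_le\<close>)
qed

lemma fun_of_distr_AE:
  assumes "represented_by S g"
  shows "represented_by S (fun_of_distr S)" "AE x in lborel. fun_of_distr S x = g x"
proof -
  show r: "represented_by S (fun_of_distr S)"
    unfolding fun_of_distr_def using someI[of "represented_by S", OF assms] by simp
  show "AE x in lborel. fun_of_distr S x = g x"
    by (rule represented_by_unique[OF r assms])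
qed

abbreviation counting :: "int measure" where "counting \<equiv> count_space UNIV"

section \<open>Dyadic frequency bands\<close>

lemma pair_sigma_finite_CI: "pair_sigma_finite counting (lborel :: 'a::euclidean_space measure)"
  by (simp add: pair_sigma_finite_def sigma_finite_measure_count_space sigma_finite_lborel)

lemma nn_integral_CI_geometric:
  assumes b: "0 < b"
  shows "(\<integral>\<^sup>+j. ennreal (2 powr (- b * \<bar>real_of_int (j - J)\<bar>)) \<partial>counting) \<le> ennreal (2 / (1 - 2 powr (- b)))"
proof -
  let ?f = "\<lambda>j. ennreal (2 powr (- b * \<bar>real_of_int (j - J)\<bar>))"
  let ?r = "2 powr (- b) :: real"
  have r: "0 \<le> ?r" "?r < 1" using b by (auto simp: powr_less_one)
  have geo: "(\<integral>\<^sup>+n. ennreal (2 powr (- b * real n)) \<partial>count_space UNIV) = ennreal (1 / (1 - ?r))"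
  proof -
    have "(\<integral>\<^sup>+n. ennreal (2 powr (- b * real n)) \<partial>count_space UNIV) = (\<Sum>n. ennreal (?r ^ n))"
    proof -
      have "2 powr (- b * real n) = ?r ^ n" for n
        using powr_realpow[of ?r n] by (simp add: powr_powr)
      then show ?thesis by (simp only: nn_integral_count_space_nat)
    qed
    also have "\<dots> = ennreal (\<Sum>n. ?r ^ n)"
      using r by (intro suminf_ennreal2 summable_geometric) auto
    also have "(\<Sum>n. ?r ^ n) = 1 / (1 - ?r)"
      using r by (intro suminf_geometric) auto
    finally show ?thesis .
  qed
  have "(\<integral>\<^sup>+j. ?f j \<partial>counting) \<le> (\<integral>\<^sup>+j. ?f j * indicator {J..} j + ?f j * indicator {..J} j \<partial>counting)"
    by (intro nn_integral_mono) (auto split: split_indicator)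
  also have "\<dots> = (\<integral>\<^sup>+j. ?f j \<partial>count_space {J..}) + (\<integral>\<^sup>+j. ?f j \<partial>count_space {..J})"
    by (subst nn_integral_add) (simp_all add: nn_integral_count_space_indicator)
  also have "(\<integral>\<^sup>+j. ?f j \<partial>count_space {J..}) = (\<integral>\<^sup>+n. ?f (J + int n) \<partial>count_space UNIV)"
    by (intro nn_integral_bij_count_space[symmetric] bij_betwI[where g="\<lambda>j. nat (j - J)"]) auto
  also have "(\<integral>\<^sup>+j. ?f j \<partial>count_space {..J}) = (\<integral>\<^sup>+n. ?f (J - int n) \<partial>count_space UNIV)"
    by (intro nn_integral_bij_count_space[symmetric] bij_betwI[where g="\<lambda>j. nat (J - j)"]) auto
  also have "(\<integral>\<^sup>+n. ?f (J + int n) \<partial>count_space UNIV) + (\<integral>\<^sup>+n. ?f (J - int n) \<partial>count_space UNIV)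
      = ennreal (1 / (1 - ?r)) + ennreal (1 / (1 - ?r))"
    using geo by simp
  also have "\<dots> = ennreal (2 / (1 - ?r))"
    using r by (simp add: ennreal_plus[symmetric] del: ennreal_plus)
  finally show ?thesis .
qed

definition dyadic :: "int \<Rightarrow> (real^2) set" where
  "dyadic j = {\<xi>. 2 powr j \<le> norm \<xi> \<and> norm \<xi> < 2 powr (j + 1)}"

definition piece :: "(real^2 \<Rightarrow> complex) \<Rightarrow> int \<Rightarrow> real^2 \<Rightarrow> complex" where
  "piece g j = (\<lambda>\<xi>. indicator (dyadic j) \<xi> * g \<xi>)"

definition freq :: "int \<Rightarrow> real" where "freq j = 2 powr (j + 1)"

text \<open>The squared homogeneous Sobolev norm of order \<open>\<gamma>\<close>, up to the factor \<open>(2 * pi)\<^sup>2\<close>.\<close>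

definition weighted_mass :: "real \<Rightarrow> (real^2 \<Rightarrow> complex) \<Rightarrow> ennreal" where
  "weighted_mass \<gamma> g = (\<integral>\<^sup>+\<xi>. ennreal (norm \<xi> powr (2 * \<gamma>) * (norm (g \<xi>))\<^sup>2) \<partial>lborel)"

lemma freq_pos: "0 < freq j" by (simp add: freq_def)

lemma dyadic_sets [measurable]: "dyadic j \<in> sets borel"
  unfolding dyadic_def by measurable

lemma piece_measurable [measurable (raw)]:
  "g \<in> borel_measurable borel \<Longrightarrow> piece g j \<in> borel_measurable borel"
  unfolding piece_def by measurable

lemma dyadic_iff:
  assumes "\<xi> \<noteq> 0"
  shows "\<xi> \<in> dyadic j \<longleftrightarrow> j = \<lfloor>log 2 (norm \<xi>)\<rfloor>"
proof -
  have "2 powr j \<le> norm \<xi> \<longleftrightarrow> real_of_int j \<le> log 2 (norm \<xi>)"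
    using assms by (simp add: le_log_iff)
  moreover have "norm \<xi> < 2 powr (j + 1) \<longleftrightarrow> log 2 (norm \<xi>) < real_of_int j + 1"
    using assms by (simp add: log_less_iff)
  ultimately show ?thesis by (simp add: dyadic_def) linarith
qed

lemma AE_neq_0: "AE \<xi> in lborel. \<xi> \<noteq> (0::real^2)"
  by (rule AE_lborel_singleton)

lemma nn_integral_CI_dyadic:
  assumes "\<xi> \<noteq> 0"
  shows "(\<integral>\<^sup>+j. indicator (dyadic j) \<xi> * c \<partial>counting) = c"
proof -
  have "(\<integral>\<^sup>+j. indicator (dyadic j) \<xi> * c \<partial>counting) = (\<integral>\<^sup>+j. c * indicator {\<lfloor>log 2 (norm \<xi>)\<rfloor>} j \<partial>counting)"
    using dyadic_iff[OF assms] by (intro nn_integral_cong) (auto split: split_indicator)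
  also have "\<dots> = c" by (subst nn_integral_cmult_indicator) auto
  finally show ?thesis .
qed

lemma integral_CI_dyadic:
  fixes c :: complex
  assumes "\<xi> \<noteq> 0"
  shows "(LINT j|counting. indicator (dyadic j) \<xi> * c) = c"
proof -
  have "(LINT j|counting. indicator (dyadic j) \<xi> * c) = (LINT j|counting. indicator {\<lfloor>log 2 (norm \<xi>)\<rfloor>} j *\<^sub>R c)"
    using dyadic_iff[OF assms] by (intro Bochner_Integration.integral_cong) (auto split: split_indicator)
  also have "\<dots> = c" by (simp add: measure_def)
  finally show ?thesis .
qed

lemma measurable_CI_pair:
  assumes [measurable]: "\<And>j. f j \<in> borel_measurable borel"
  shows "(\<lambda>(j, x). f j x) \<in> borel_measurable (counting \<Otimes>\<^sub>M lborel)"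
  by (rule measurable_pair_measure_countable1) auto

lemma borel_measurable_nn_integral_CI:
  fixes f :: "int \<Rightarrow> 'a::euclidean_space \<Rightarrow> ennreal"
  assumes "\<And>j. f j \<in> borel_measurable borel"
  shows "(\<lambda>x. \<integral>\<^sup>+j. f j x \<partial>counting) \<in> borel_measurable lborel"
proof -
  have "(\<lambda>(x, j). f j x) \<in> borel_measurable (lborel \<Otimes>\<^sub>M counting)"
    using measurable_CI_pair[OF assms] by (subst measurable_pair_swap_iff) (simp add: split_beta')
  then show ?thesis
    by (rule sigma_finite_measure.borel_measurable_nn_integral[OF sigma_finite_measure_count_space])
qed

lemma nn_integral_CI_swap:
  fixes f :: "int \<Rightarrow> 'a::euclidean_space \<Rightarrow> ennreal"
  assumes [measurable]: "\<And>j. f j \<in> borel_measurable borel"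
  shows "(\<integral>\<^sup>+j. \<integral>\<^sup>+x. f j x \<partial>lborel \<partial>counting) = (\<integral>\<^sup>+x. \<integral>\<^sup>+j. f j x \<partial>counting \<partial>lborel)"
proof -
  from pair_sigma_finite.Fubini[OF pair_sigma_finite_CI measurable_CI_pair[OF assms]]
  show ?thesis by simp
qed

lemma nn_integral_CI_piece:
  assumes [measurable]: "g \<in> borel_measurable borel" "w \<in> borel_measurable borel"
  shows "(\<integral>\<^sup>+j. \<integral>\<^sup>+\<xi>. w \<xi> * nsq (piece g j \<xi>) \<partial>lborel \<partial>counting) = (\<integral>\<^sup>+\<xi>. w \<xi> * nsq (g \<xi>) \<partial>lborel)"
proof -
  have "(\<integral>\<^sup>+j. \<integral>\<^sup>+\<xi>. w \<xi> * nsq (piece g j \<xi>) \<partial>lborel \<partial>counting)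
      = (\<integral>\<^sup>+\<xi>. \<integral>\<^sup>+j. w \<xi> * nsq (piece g j \<xi>) \<partial>counting \<partial>lborel)"
    by (rule nn_integral_CI_swap) measurable
  also have "\<dots> = (\<integral>\<^sup>+\<xi>. w \<xi> * nsq (g \<xi>) \<partial>lborel)"
  proof (rule nn_integral_cong_AE, rule AE_mp[OF AE_neq_0], rule AE_I2, rule impI)
    fix \<xi> :: "real^2" assume "\<xi> \<noteq> 0"
    have "(\<integral>\<^sup>+j. w \<xi> * nsq (piece g j \<xi>) \<partial>counting)
      = (\<integral>\<^sup>+j. indicator (dyadic j) \<xi> * (w \<xi> * nsq (g \<xi>)) \<partial>counting)"
      by (intro nn_integral_cong) (auto simp: piece_def split: split_indicator)
    then show "(\<integral>\<^sup>+j. w \<xi> * nsq (piece g j \<xi>) \<partial>counting) = w \<xi> * nsq (g \<xi>)"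
      using nn_integral_CI_dyadic[OF \<open>\<xi> \<noteq> 0\<close>] by simp
  qed
  finally show ?thesis .
qed

lemma nn_integral_CI_hmass_piece:
  assumes [measurable]: "g \<in> borel_measurable borel"
  shows "(\<integral>\<^sup>+j. weighted_mass \<gamma> (piece g j) \<partial>counting) = weighted_mass \<gamma> g"
  using nn_integral_CI_piece[of g "\<lambda>\<xi>. ennreal (norm \<xi> powr (2 * \<gamma>))"]
  by (simp add: weighted_mass_def ennreal_mult)

lemma mass_piece_le:
  assumes [measurable]: "g \<in> borel_measurable borel" and \<gamma>: "0 \<le> \<gamma>"
  shows "mass (piece g j) \<le> ennreal (2 powr (- 2 * \<gamma> * j)) * weighted_mass \<gamma> (piece g j)"
proof -
  have "mass (piece g j) \<le> (\<integral>\<^sup>+\<xi>. ennreal (2 powr (- 2 * \<gamma> * j))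
      * ennreal (norm \<xi> powr (2 * \<gamma>) * (norm (piece g j \<xi>))\<^sup>2) \<partial>lborel)"
  proof (rule nn_integral_mono)
    fix \<xi> :: "real^2"
    show "nsq (piece g j \<xi>) \<le> ennreal (2 powr (- 2 * \<gamma> * j))
        * ennreal (norm \<xi> powr (2 * \<gamma>) * (norm (piece g j \<xi>))\<^sup>2)"
    proof (cases "\<xi> \<in> dyadic j")
      case True
      then have "(2 powr j) powr (2 * \<gamma>) \<le> norm \<xi> powr (2 * \<gamma>)"
        using \<gamma> by (intro powr_mono2) (auto simp: dyadic_def)
      then have "2 powr (- 2 * \<gamma> * j) * (2 powr j) powr (2 * \<gamma>) \<le> 2 powr (- 2 * \<gamma> * j) * norm \<xi> powr (2 * \<gamma>)"
        by (intro mult_left_mono) auto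
      moreover have "2 powr (- 2 * \<gamma> * j) * (2 powr j) powr (2 * \<gamma>) = (1::real)"
        by (simp add: powr_powr powr_add[symmetric] mult_ac)
      ultimately have "1 \<le> 2 powr (- 2 * \<gamma> * j) * norm \<xi> powr (2 * \<gamma>)" by linarith
      then have "1 * (norm (piece g j \<xi>))\<^sup>2 \<le> (2 powr (- 2 * \<gamma> * j) * norm \<xi> powr (2 * \<gamma>))
          * (norm (piece g j \<xi>))\<^sup>2"
        by (rule mult_right_mono) simp
      then show ?thesis by (simp add: ennreal_mult[symmetric] mult.assoc ennreal_leI)
    qed (simp add: piece_def)
  qed
  also have "\<dots> = ennreal (2 powr (- 2 * \<gamma> * j)) * weighted_mass \<gamma> (piece g j)"
    unfolding weighted_mass_def by (rule nn_integral_cmult) measurable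
  finally show ?thesis .
qed

lemma hmass_piece_le: "weighted_mass \<gamma> (piece g j) \<le> weighted_mass \<gamma> g"
  unfolding weighted_mass_def by (intro nn_integral_mono) (auto simp: piece_def split: split_indicator)

text \<open>A square integrable function on a set of finite measure is integrable.\<close>

lemma band_piece:
  assumes [measurable]: "g \<in> borel_measurable borel" and \<gamma>: "0 \<le> \<gamma>" and fin: "weighted_mass \<gamma> g < top"
  shows "band_limited (freq j) (piece g j)"
proof -
  have m: "mass (piece g j) < top"
  proof -
    have "mass (piece g j) \<le> ennreal (2 powr (- 2 * \<gamma> * j)) * weighted_mass \<gamma> g"
      by (rule order_trans[OF mass_piece_le[OF assms(1) \<gamma>] mult_left_mono[OF hmass_piece_le]]) simp
    also have "\<dots> < top" using fin by (simp add: ennreal_mult_less_top)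
    finally show ?thesis .
  qed
  have "(\<integral>\<^sup>+\<xi>. ennreal (norm (piece g j \<xi>)) \<partial>lborel)
      \<le> (\<integral>\<^sup>+\<xi>. indicator {\<xi>. norm \<xi> \<le> freq j} \<xi> + nsq (piece g j \<xi>) \<partial>lborel)"
  proof (rule nn_integral_mono)
    fix \<xi> :: "real^2"
    let ?x = "norm (piece g j \<xi>)"
    show "ennreal ?x \<le> indicator {\<xi>. norm \<xi> \<le> freq j} \<xi> + ennreal (?x\<^sup>2)"
    proof (cases "\<xi> \<in> dyadic j")
      case True
      have "?x \<le> 1 + ?x\<^sup>2" using sum_squares_bound[of ?x 1]
          by (simp add: power2_eq_square) (smt (verit) norm_ge_zero)
      then have "ennreal ?x \<le> ennreal (1 + ?x\<^sup>2)" by (rule ennreal_leI)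
      also have "\<dots> = 1 + ennreal (?x\<^sup>2)" by (subst ennreal_plus) auto
      finally show ?thesis using True by (simp add: dyadic_def freq_def)
    qed (simp add: piece_def)
  qed
  also have "\<dots> = (\<integral>\<^sup>+\<xi>. indicator {\<xi>::real^2. norm \<xi> \<le> freq j} \<xi> \<partial>lborel) + mass (piece g j)"
    by (rule nn_integral_add) measurable
  also have "\<dots> < top"
    using m le_less_trans[OF nn_integral_disc_le[of "freq j"] ennreal_less_top] freq_pos[of j]
        by (simp add: ennreal_add_less_top)
  finally have "integrable lborel (piece g j)"
    by (intro integrableI_bounded) (auto simp: less_top)
  then show ?thesis
    by (auto simp: band_limited_def piece_def dyadic_def freq_def split: split_indicator)
qed

lemma ennreal_power2_le_imp_le:
  assumes "x\<^sup>2 \<le> ennreal (X\<^sup>2)" "0 \<le> X"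
  shows "x \<le> ennreal X"
proof (cases x)
  case (real r)
  then have "r\<^sup>2 \<le> X\<^sup>2" using assms by (simp add: ennreal_power)
  then show ?thesis using real assms by (auto intro!: ennreal_leI power2_le_imp_le)
next
  case top
  then show ?thesis using assms by (simp add: power2_eq_square ennreal_mult_top top_unique)
qed

lemma nn_integral_mult_le_mass:
  assumes [measurable]: "a \<in> borel_measurable borel" "b \<in> borel_measurable borel"
    and "mass a \<le> ennreal (X\<^sup>2)" "mass b \<le> ennreal (Y\<^sup>2)" "0 \<le> X" "0 \<le> Y"
  shows "(\<integral>\<^sup>+x. ennreal (norm (a x)) * ennreal (norm (b x)) \<partial>lborel) \<le> ennreal (X * Y)"
proof (rule ennreal_power2_le_imp_le)
  have "(\<integral>\<^sup>+x. ennreal (norm (a x)) * ennreal (norm (b x)) \<partial>lborel)\<^sup>2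
      \<le> (\<integral>\<^sup>+x. (ennreal (norm (a x)))\<^sup>2 \<partial>lborel) * (\<integral>\<^sup>+x. (ennreal (norm (b x)))\<^sup>2 \<partial>lborel)"
    by (rule Cauchy_Schwarz_nn_integral) measurable
  also have "\<dots> = mass a * mass b" by (simp add: ennreal_power)
  also have "\<dots> \<le> ennreal (X\<^sup>2) * ennreal (Y\<^sup>2)" using assms by (intro mult_mono) auto
  also have "\<dots> = ennreal ((X * Y)\<^sup>2)" by (simp add: ennreal_mult[symmetric] power_mult_distrib)
  finally show "(\<integral>\<^sup>+x. ennreal (norm (a x)) * ennreal (norm (b x)) \<partial>lborel)\<^sup>2 \<le> ennreal ((X * Y)\<^sup>2)" .
qed (use assms in simp)

lemma piece_bounds:
  assumes g [measurable]: "g \<in> borel_measurable borel" and \<gamma>: "0 < \<gamma>" "\<gamma> < 1"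
    and F: "weighted_mass \<gamma> g \<le> ennreal (F\<^sup>2)" "0 \<le> F"
  shows "mass (piece g j) \<le> ennreal ((2 powr (- \<gamma> * j) * F)\<^sup>2)"
    and "(LINT \<xi>|lborel. norm (piece g j \<xi>)) \<le> 4 * F * 2 powr ((1 - \<gamma>) * j)"
proof -
  have b: "band_limited (freq j) (piece g j)"
    using F by (intro band_piece[OF g, of \<gamma>]) (auto simp: \<gamma> less_imp_le le_less_trans)
  have "mass (piece g j) \<le> ennreal (2 powr (- 2 * \<gamma> * j)) * ennreal (F\<^sup>2)"
    using \<gamma> by (intro order_trans[OF mass_piece_le[OF g] mult_left_mono[OF order_trans[OF hmass_piece_le
        F(1)]]]) auto
  also have "\<dots> = ennreal ((2 powr (- \<gamma> * j) * F)\<^sup>2)"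
  proof -
    have "2 powr (- 2 * \<gamma> * j) = (2 powr (- \<gamma> * j))\<^sup>2"
      by (simp add: power2_eq_square powr_add[symmetric] mult.assoc)
    then show ?thesis by (simp add: ennreal_mult[symmetric] power_mult_distrib)
  qed
  finally show m: "mass (piece g j) \<le> ennreal ((2 powr (- \<gamma> * j) * F)\<^sup>2)" .
  have "ennreal ((LINT \<xi>|lborel. norm (piece g j \<xi>))\<^sup>2)
      \<le> ennreal (4 * (freq j)\<^sup>2) * ennreal ((2 powr (- \<gamma> * j) * F)\<^sup>2)"
    by (intro order_trans[OF band_integral_norm_le[OF b]] mult_left_mono m) (auto simp: freq_pos less_imp_le)
  also have "\<dots> = ennreal (4 * (freq j)\<^sup>2 * (2 powr (- \<gamma> * j) * F)\<^sup>2)"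
    by (simp add: ennreal_mult[symmetric])
  also have "4 * (freq j)\<^sup>2 * (2 powr (- \<gamma> * j) * F)\<^sup>2 = (4 * F * 2 powr ((1 - \<gamma>) * j))\<^sup>2"
  proof -
    have "2 powr ((1 - \<gamma>) * j) = 2 powr j * 2 powr (- \<gamma> * j)"
      by (simp add: powr_add[symmetric] algebra_simps)
    moreover have "freq j = 2 * 2 powr j" by (simp add: freq_def powr_add)
    ultimately show ?thesis by (simp add: power2_eq_square)
  qed
  finally have "(LINT \<xi>|lborel. norm (piece g j \<xi>))\<^sup>2 \<le> (4 * F * 2 powr ((1 - \<gamma>) * j))\<^sup>2"
    by (simp add: F)
  then show "(LINT \<xi>|lborel. norm (piece g j \<xi>)) \<le> 4 * F * 2 powr ((1 - \<gamma>) * j)"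
    by (rule power2_le_imp_le) (use F in auto)
qed

text \<open>The condition \<open>0 < \<gamma> < 1\<close> makes the integrals of \<open>norm (piece g j)\<close> summable over the low bands, by
a factor \<open>2 powr ((1 - \<gamma>) * j)\<close>, and its square norms over the high bands, by a factor
\<open>2 powr (- \<gamma> * j)\<close>.  The lemma is applied both to \<open>w j = wave (piece g j) t\<close> and to \<open>w j = piece g j\<close>.\<close>

lemma piece_pairing_summable:
  assumes g [measurable]: "g \<in> borel_measurable borel" and \<gamma>: "0 < \<gamma>" "\<gamma> < 1"
    and F: "weighted_mass \<gamma> g \<le> ennreal (F\<^sup>2)" "0 \<le> F"
    and [measurable]: "\<And>j. w j \<in> borel_measurable borel" "\<phi> \<in> borel_measurable borel"
    and low: "\<And>j. (\<integral>\<^sup>+x. ennreal (norm (w j x)) * ennreal (norm (\<phi> x)) \<partial>lborel)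
        \<le> ennreal ((LINT \<xi>|lborel. norm (piece g j \<xi>)) * X)"
    and high: "\<And>j. mass (w j) \<le> ennreal ((2 * pi)\<^sup>2) * mass (piece g j)" and \<phi>: "mass \<phi> \<le> ennreal (Y\<^sup>2)"
    and XY: "0 \<le> X" "0 \<le> Y"
  shows "(\<integral>\<^sup>+j. \<integral>\<^sup>+x. ennreal (norm (w j x)) * ennreal (norm (\<phi> x)) \<partial>lborel \<partial>counting) < top"
proof -
  let ?b = "min \<gamma> (1 - \<gamma>)"
  let ?A = "4 * F * X + 2 * pi * F * Y"
  have A: "0 \<le> ?A" using F XY by auto
  \<comment> \<open>Negative \<open>j\<close>: the hypothesis \<open>low\<close>; nonnegative \<open>j\<close>: the Cauchy-Schwarz inequality.\<close>
  have bd: "(\<integral>\<^sup>+x. ennreal (norm (w j x)) * ennreal (norm (\<phi> x)) \<partial>lborel)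
      \<le> ennreal ?A * ennreal (2 powr (- ?b * \<bar>real_of_int (j - 0)\<bar>))" for j
  proof (cases "j < 0")
    case True
    have "(LINT \<xi>|lborel. norm (piece g j \<xi>)) * X \<le> (4 * F * 2 powr ((1 - \<gamma>) * j)) * X"
      by (intro mult_right_mono piece_bounds[OF g \<gamma> F] XY)
    also have "\<dots> = (4 * F * X) * 2 powr ((1 - \<gamma>) * j)" by simp
    also have "\<dots> \<le> ?A * 2 powr (- ?b * \<bar>real_of_int (j - 0)\<bar>)"
    proof (rule mult_mono)
      have "?b * \<bar>real_of_int j\<bar> \<le> (1 - \<gamma>) * \<bar>real_of_int j\<bar>" by (intro mult_right_mono) auto
      then have "(1 - \<gamma>) * j \<le> - ?b * \<bar>real_of_int (j - 0)\<bar>" using True by (simp add: abs_if)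
      then show "2 powr ((1 - \<gamma>) * j) \<le> 2 powr (- ?b * \<bar>real_of_int (j - 0)\<bar>)" by (rule powr_mono) simp
    qed (use F XY in auto)
    finally have "ennreal ((LINT \<xi>|lborel. norm (piece g j \<xi>)) * X)
        \<le> ennreal (?A * 2 powr (- ?b * \<bar>real_of_int (j - 0)\<bar>))"
      by (rule ennreal_leI)
    with low[of j] show ?thesis using A by (simp add: ennreal_mult)
  next
    case False
    have "mass (w j) \<le> ennreal ((2 * pi)\<^sup>2) * ennreal ((2 powr (- \<gamma> * j) * F)\<^sup>2)"
      by (intro order_trans[OF high] mult_left_mono piece_bounds[OF g \<gamma> F]) auto
    also have "\<dots> = ennreal ((2 * pi * (2 powr (- \<gamma> * j) * F))\<^sup>2)"
      by (simp add: ennreal_mult[symmetric] power_mult_distrib)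
    finally have "(\<integral>\<^sup>+x. ennreal (norm (w j x)) * ennreal (norm (\<phi> x)) \<partial>lborel)
        \<le> ennreal ((2 * pi * (2 powr (- \<gamma> * j) * F)) * Y)"
      using F XY \<phi> by (intro nn_integral_mult_le_mass) auto
    also have "\<dots> \<le> ennreal (?A * 2 powr (- ?b * \<bar>real_of_int (j - 0)\<bar>))"
    proof (rule ennreal_leI)
      have "(2 * pi * (2 powr (- \<gamma> * j) * F)) * Y = (2 * pi * F * Y) * 2 powr (- \<gamma> * j)" by simp
      also have "\<dots> \<le> ?A * 2 powr (- ?b * \<bar>real_of_int (j - 0)\<bar>)"
      proof (rule mult_mono)
        have "?b * \<bar>real_of_int j\<bar> \<le> \<gamma> * \<bar>real_of_int j\<bar>" by (intro mult_right_mono) auto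
        then have "- \<gamma> * j \<le> - ?b * \<bar>real_of_int (j - 0)\<bar>" using False by (simp add: abs_if)
        then show "2 powr (- \<gamma> * j) \<le> 2 powr (- ?b * \<bar>real_of_int (j - 0)\<bar>)" by (rule powr_mono) simp
      qed (use F XY in auto)
      finally show "(2 * pi * (2 powr (- \<gamma> * j) * F)) * Y \<le> ?A * 2 powr (- ?b * \<bar>real_of_int (j - 0)\<bar>)" .
    qed
    finally show ?thesis using A by (simp add: ennreal_mult)
  qed
  have "(\<integral>\<^sup>+j. \<integral>\<^sup>+x. ennreal (norm (w j x)) * ennreal (norm (\<phi> x)) \<partial>lborel \<partial>counting)
      \<le> (\<integral>\<^sup>+j. ennreal ?A * ennreal (2 powr (- ?b * \<bar>real_of_int (j - 0)\<bar>)) \<partial>counting)"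
    by (intro nn_integral_mono bd)
  also have "\<dots> = ennreal ?A * (\<integral>\<^sup>+j. ennreal (2 powr (- ?b * \<bar>real_of_int (j - 0)\<bar>)) \<partial>counting)"
    by (rule nn_integral_cmult) simp
  also have "\<dots> \<le> ennreal ?A * ennreal (2 / (1 - 2 powr (- ?b)))"
    using \<gamma> by (intro mult_left_mono nn_integral_CI_geometric) auto
  also have "\<dots> < top" by (simp add: ennreal_mult_less_top)
  finally show ?thesis .
qed

section \<open>The half-wave evolution as a sum over frequency bands\<close>

lemma wave_pairing:
  assumes h: "integrable lborel h" and \<phi>: "integrable lborel \<phi>"
  shows "(LINT x|lborel. wave h t x * \<phi> x) = complex_of_real ((2 * pi)\<^sup>2)
      * (LINT \<xi>|lborel. cis (- t * norm \<xi>) * h \<xi> * inv_fourier \<phi> \<xi>)"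
proof -
  have [measurable]: "h \<in> borel_measurable borel" "\<phi> \<in> borel_measurable borel" using h \<phi> by auto
  let ?f = "\<lambda>\<xi> x. cis (x \<bullet> \<xi> - t * norm \<xi>) * (h \<xi> * \<phi> x)"
  have i: "integrable (lborel \<Otimes>\<^sub>M lborel) (\<lambda>(\<xi>, x). ?f \<xi> x)"
    by (rule Bochner_Integration.integrable_bound[OF integrable_times_pair[OF h \<phi>]]) (auto simp: norm_mult)
  have "(LINT x|lborel. wave h t x * \<phi> x) = (LINT x|lborel. LINT \<xi>|lborel. ?f \<xi> x)"
    by (simp only: wave_def integral_mult_left_zero[symmetric] mult.assoc)
  also have "\<dots> = (LINT \<xi>|lborel. LINT x|lborel. ?f \<xi> x)"
    by (rule lborel_pair.Fubini_integral[OF i])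
  also have "\<dots> = (LINT \<xi>|lborel. complex_of_real ((2 * pi)\<^sup>2) * (cis (- t * norm \<xi>) * h \<xi> * inv_fourier \<phi> \<xi>))"
  proof (rule Bochner_Integration.integral_cong[OF refl])
    fix \<xi> :: "real^2"
    have e: "?f \<xi> x = (cis (- t * norm \<xi>) * h \<xi>) * (cis (\<xi> \<bullet> x) * \<phi> x)" for x
    proof -
      have "cis (x \<bullet> \<xi> - t * norm \<xi>) = cis (- t * norm \<xi>) * cis (\<xi> \<bullet> x)"
        by (simp add: cis_mult inner_commute)
      then show ?thesis by simp
    qed
    have "(LINT x|lborel. ?f \<xi> x) = (cis (- t * norm \<xi>) * h \<xi>) * (LINT x|lborel. cis (\<xi> \<bullet> x) * \<phi> x)"
      unfolding e by (rule integral_mult_right_zero)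
    also have "(LINT x|lborel. cis (\<xi> \<bullet> x) * \<phi> x) = complex_of_real ((2 * pi)\<^sup>2) * inv_fourier \<phi> \<xi>"
      by (simp add: inv_fourier_def)
    finally show "(LINT x|lborel. ?f \<xi> x) = complex_of_real ((2 * pi)\<^sup>2)
        * (cis (- t * norm \<xi>) * h \<xi> * inv_fourier \<phi> \<xi>)"
      by (simp only: mult_ac)
  qed
  also have "\<dots> = complex_of_real ((2 * pi)\<^sup>2) * (LINT \<xi>|lborel. cis (- t * norm \<xi>) * h \<xi> * inv_fourier \<phi> \<xi>)"
    by (rule integral_mult_right_zero)
  finally show ?thesis .
qed

text \<open>The sum over the frequency bands is an integral over the counting measure on the integers, so that
Fubini's theorem applies to it; where it diverges its value is \<open>0\<close>.\<close>

definition wave_sum :: "(real^2 \<Rightarrow> complex) \<Rightarrow> real \<Rightarrow> real^2 \<Rightarrow> complex" where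
  "wave_sum g t x = (LINT j|counting. wave (piece g j) t x) / complex_of_real ((2 * pi)\<^sup>2)"

lemma wave_sum_measurable:
  assumes [measurable]: "g \<in> borel_measurable borel"
  shows "wave_sum g t \<in> borel_measurable borel"
proof -
  have sf: "sigma_finite_measure counting" by (rule sigma_finite_measure_count_space)
  have "(\<lambda>(j, x). wave (piece g j) t x) \<in> borel_measurable (counting \<Otimes>\<^sub>M lborel)"
    by (rule measurable_CI_pair) measurable
  then have "(\<lambda>(x, j). wave (piece g j) t x) \<in> borel_measurable (lborel \<Otimes>\<^sub>M counting)"
    by (subst measurable_pair_swap_iff) (simp add: split_beta')
  from sigma_finite_measure.borel_measurable_lebesgue_integral[OF sf this]
  have [measurable]: "(\<lambda>x. LINT j|counting. wave (piece g j) t x) \<in> borel_measurable borel" by simp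
  show ?thesis unfolding wave_sum_def[abs_def] by measurable
qed

text \<open>Two interchanges of the sum over the bands with an integral, in space and in frequency, both
justified by \<open>piece_pairing_summable\<close>; between them, band by band, \<open>wave_pairing\<close>.\<close>

lemma half_wave_represented:
  assumes g [measurable]: "g \<in> borel_measurable borel" and \<gamma>: "0 < \<gamma>" "\<gamma> < 1" and fin: "weighted_mass \<gamma> g < top"
  shows "represented_by (\<lambda>\<phi>. LINT \<xi>|lborel. cis (- t * norm \<xi>) * g \<xi> * inv_fourier \<phi> \<xi>) (wave_sum g t)"
  unfolding represented_by_def
proof (intro conjI allI impI)
  show "wave_sum g t \<in> borel_measurable borel" by (rule wave_sum_measurable[OF g])
  fix \<phi> assume s: "schwartz \<phi>"
  define F where "F = sqrt (enn2real (weighted_mass \<gamma> g))"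
  have F: "weighted_mass \<gamma> g \<le> ennreal (F\<^sup>2)" "0 \<le> F" using fin by (auto simp: F_def)
  have [measurable]: "\<phi> \<in> borel_measurable borel" using s by (rule schwartz_measurable)
  have i\<phi>: "integrable lborel \<phi>" by (rule schwartz_integrable[OF s])
  let ?X = "LINT x|lborel. norm (\<phi> x)"
  have X0: "0 \<le> ?X" by simp
  have X: "(\<integral>\<^sup>+x. ennreal (norm (\<phi> x)) \<partial>lborel) = ennreal ?X"
    using i\<phi> by (intro nn_integral_eq_integral) auto
  let ?\<psi> = "inv_fourier \<phi>"
  have [measurable]: "?\<psi> \<in> borel_measurable borel" by (rule inv_fourier_schwartz[OF s])
  have b: "band_limited (freq j) (piece g j)" for j
    by (rule band_piece[OF g _ fin]) (use \<gamma> in simp)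
  have ip: "integrable lborel (piece g j)" for j by (rule band_integrable[OF b])
  have [measurable]: "wave (piece g j) t \<in> borel_measurable borel" for j by measurable
  have J: "(\<integral>\<^sup>+x. ennreal (norm (piece g j x)) \<partial>lborel) = ennreal (LINT \<xi>|lborel. norm (piece g j \<xi>))" for j
    using ip by (intro nn_integral_eq_integral) auto
  have m: "mass k \<le> ennreal ((sqrt (enn2real (mass k)))\<^sup>2)" if "mass k < top" for k :: "real^2 \<Rightarrow> complex"
    using that by simp
  let ?f = "\<lambda>j x. wave (piece g j) t x * \<phi> x"
  let ?h = "\<lambda>j \<xi>. cis (- t * norm \<xi>) * piece g j \<xi> * ?\<psi> \<xi>"
  have s1: "(\<integral>\<^sup>+j. \<integral>\<^sup>+x. ennreal (norm (wave (piece g j) t x)) * ennreal (norm (\<phi> x)) \<partial>lborel \<partial>counting) < top"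
  proof (rule piece_pairing_summable[OF g \<gamma> F _ _ _ _ m[OF schwartz_integrable(2)[OF s]] X0])
    fix j
    have "(\<integral>\<^sup>+x. ennreal (norm (wave (piece g j) t x)) * ennreal (norm (\<phi> x)) \<partial>lborel)
      \<le> (\<integral>\<^sup>+x. ennreal (LINT \<xi>|lborel. norm (piece g j \<xi>)) * ennreal (norm (\<phi> x)) \<partial>lborel)"
      by (intro nn_integral_mono mult_right_mono ennreal_leI norm_wave_le ip) simp
    also have "\<dots> = ennreal (LINT \<xi>|lborel. norm (piece g j \<xi>)) * ennreal ?X"
      by (subst nn_integral_cmult) (auto simp: X)
    also have "\<dots> = ennreal ((LINT \<xi>|lborel. norm (piece g j \<xi>)) * ?X)"
      by (rule ennreal_mult[symmetric]) auto
    finally show "(\<integral>\<^sup>+x. ennreal (norm (wave (piece g j) t x)) * ennreal (norm (\<phi> x)) \<partial>lborel)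
        \<le> ennreal ((LINT \<xi>|lborel. norm (piece g j \<xi>)) * ?X)" .
    show "mass (wave (piece g j) t) \<le> ennreal ((2 * pi)\<^sup>2) * mass (piece g j)"
      by (rule wave_energy[OF ip])
  qed auto
  have s2: "(\<integral>\<^sup>+j. \<integral>\<^sup>+\<xi>. ennreal (norm (piece g j \<xi>)) * ennreal (norm (?\<psi> \<xi>)) \<partial>lborel \<partial>counting) < top"
  proof (rule piece_pairing_summable[OF g \<gamma> F _ _ _ _ m[OF inv_fourier_schwartz(3)[OF s]] X0])
    fix j
    have "(\<integral>\<^sup>+x. ennreal (norm (piece g j x)) * ennreal (norm (?\<psi> x)) \<partial>lborel)
      \<le> (\<integral>\<^sup>+x. ennreal (norm (piece g j x)) * ennreal ?X \<partial>lborel)"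
      by (intro nn_integral_mono mult_left_mono ennreal_leI inv_fourier_schwartz(2)[OF s]) simp
    also have "\<dots> = ennreal (LINT \<xi>|lborel. norm (piece g j \<xi>)) * ennreal ?X"
      by (subst nn_integral_multc) (auto simp: J)
    also have "\<dots> = ennreal ((LINT \<xi>|lborel. norm (piece g j \<xi>)) * ?X)"
      by (rule ennreal_mult[symmetric]) auto
    finally show "(\<integral>\<^sup>+x. ennreal (norm (piece g j x)) * ennreal (norm (?\<psi> x)) \<partial>lborel)
        \<le> ennreal ((LINT \<xi>|lborel. norm (piece g j \<xi>)) * ?X)" .
    have "1 \<le> 2 * pi" using pi_gt3 by simp
    then have "1 \<le> ennreal ((2 * pi)\<^sup>2)" using ennreal_leI[OF one_le_power[of "2 * pi" 2]]
        by (simp only: ennreal_1)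
    then have "1 * mass (piece g j) \<le> ennreal ((2 * pi)\<^sup>2) * mass (piece g j)"
      by (rule mult_right_mono) simp
    then show "mass (piece g j) \<le> ennreal ((2 * pi)\<^sup>2) * mass (piece g j)" by simp
  qed auto
  have int_pair: "integrable (counting \<Otimes>\<^sub>M lborel) (\<lambda>(j, x). k j x)"
    if [measurable]: "\<And>j. k j \<in> borel_measurable borel" and fin:
        "(\<integral>\<^sup>+j. \<integral>\<^sup>+x. ennreal (norm (k j x)) \<partial>lborel \<partial>counting) < top"
    for k :: "int \<Rightarrow> real^2 \<Rightarrow> complex"
  proof (rule integrableI_bounded)
    show m: "(\<lambda>(j, x). k j x) \<in> borel_measurable (counting \<Otimes>\<^sub>M lborel)"
      by (rule measurable_CI_pair) measurable
    have "(\<lambda>(j, x). ennreal (norm (k j x))) \<in> borel_measurable (counting \<Otimes>\<^sub>M lborel)"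
      by (rule measurable_CI_pair) measurable
    from lborel.nn_integral_fst[OF this] fin
    show "(\<integral>\<^sup>+z. ennreal (norm (case z of (j, x) \<Rightarrow> k j x)) \<partial>(counting \<Otimes>\<^sub>M lborel)) < \<infinity>"
      by (simp add: split_beta')
  qed
  have i1: "integrable (counting \<Otimes>\<^sub>M lborel) (\<lambda>(j, x). ?f j x)"
    by (rule int_pair) (use s1 in \<open>auto simp: norm_mult ennreal_mult\<close>)
  have i2: "integrable (counting \<Otimes>\<^sub>M lborel) (\<lambda>(j, x). ?h j x)"
    by (rule int_pair) (use s2 in \<open>auto simp: norm_mult ennreal_mult\<close>)
  let ?c = "complex_of_real ((2 * pi)\<^sup>2)"
  have c0: "?c \<noteq> 0" by simp
  have u: "wave_sum g t x * \<phi> x = (LINT j|counting. ?f j x) / ?c" for x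
    by (simp only: wave_sum_def integral_mult_left_zero times_divide_eq_left)
  have "integrable lborel (\<lambda>x. LINT j|counting. ?f j x)"
    using pair_sigma_finite.integrable_snd[OF pair_sigma_finite_CI i1] by simp
  then show "integrable lborel (\<lambda>x. wave_sum g t x * \<phi> x)"
    unfolding u by (rule integrable_divide_zero)
  have "(LINT x|lborel. wave_sum g t x * \<phi> x) = (LINT x|lborel. LINT j|counting. ?f j x) / ?c"
    unfolding u by (rule integral_divide_zero)
  also have "(LINT x|lborel. LINT j|counting. ?f j x) = (LINT j|counting. LINT x|lborel. ?f j x)"
    by (rule pair_sigma_finite.Fubini_integral[OF pair_sigma_finite_CI i1])
  also have "\<dots> = (LINT j|counting. ?c * (LINT \<xi>|lborel. ?h j \<xi>))"
    by (simp only: wave_pairing[OF ip i\<phi>])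
  also have "\<dots> = ?c * (LINT j|counting. LINT \<xi>|lborel. ?h j \<xi>)"
    by (rule integral_mult_right_zero)
  also have "(LINT j|counting. LINT \<xi>|lborel. ?h j \<xi>) = (LINT \<xi>|lborel. LINT j|counting. ?h j \<xi>)"
    by (rule pair_sigma_finite.Fubini_integral[OF pair_sigma_finite_CI i2, symmetric])
  also have "\<dots> = (LINT \<xi>|lborel. cis (- t * norm \<xi>) * g \<xi> * ?\<psi> \<xi>)"
  proof (rule integral_cong_AE)
    show "(\<lambda>\<xi>. LINT j|counting. ?h j \<xi>) \<in> borel_measurable lborel"
      using pair_sigma_finite.integrable_snd[OF pair_sigma_finite_CI i2] by auto
    show "AE \<xi> in lborel. (LINT j|counting. ?h j \<xi>) = cis (- t * norm \<xi>) * g \<xi> * ?\<psi> \<xi>"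
      using AE_neq_0
    proof eventually_elim
      case (elim \<xi>)
      have "?h j \<xi> = indicator (dyadic j) \<xi> * (cis (- t * norm \<xi>) * g \<xi> * ?\<psi> \<xi>)" for j
        by (simp add: piece_def)
      then show ?case by (simp only: integral_CI_dyadic[OF elim])
    qed
  qed measurable
  finally show "(LINT \<xi>|lborel. cis (- t * norm \<xi>) * g \<xi> * ?\<psi> \<xi>) = (LINT x|lborel. wave_sum g t x * \<phi> x)"
    using c0 by simp
qed

section \<open>Angular square means of the evolution\<close>

text \<open>Polar coordinates and Fubini, for the indicator of a null set.\<close>

lemma AE_circles:
  assumes "AE x in lborel. P x"
  shows "AE r in restrict_space lborel {0<..}. AE \<theta> in lborel. \<theta> \<in> {0..2*pi} \<longrightarrow> P (polar (\<theta>, r))"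
proof -
  obtain A where A: "{x \<in> space lborel. \<not> P x} \<subseteq> A" "emeasure lborel A = 0" "A \<in> sets lborel"
    using assms by (rule AE_E)
  have [measurable]: "A \<in> sets borel" using A(3) by simp
  define k where "k = (\<lambda>\<theta> r. indicator A (polar (\<theta>, r)) * ennreal r * indicator {0<..} r
      * indicator {0..2*pi} \<theta>)"
  have "(\<integral>\<^sup>+\<theta>. \<integral>\<^sup>+r. k \<theta> r \<partial>lborel \<partial>lborel)
      = (\<integral>\<^sup>+\<theta>\<in>{0..2*pi}. \<integral>\<^sup>+r\<in>{0<..}. indicator A (pt (r * cos \<theta>) (r * sin \<theta>)) * ennreal r \<partial>lborel \<partial>lborel)"
    by (simp add: k_def polar_def nn_integral_multc)
  also have "\<dots> \<le> 5 * (\<integral>\<^sup>+x. indicator A x \<partial>lborel)"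
    by (rule nn_integral_polar_le) measurable
  also have "\<dots> = 0" using A(2) by simp
  finally have "(\<integral>\<^sup>+\<theta>. \<integral>\<^sup>+r. k \<theta> r \<partial>lborel \<partial>lborel) = 0" by simp
  moreover have "(\<integral>\<^sup>+\<theta>. \<integral>\<^sup>+r. k \<theta> r \<partial>lborel \<partial>lborel) = (\<integral>\<^sup>+r. \<integral>\<^sup>+\<theta>. k \<theta> r \<partial>lborel \<partial>lborel)"
    unfolding k_def polar_def by (rule lborel_pair.Fubini') measurable
  ultimately have "(\<integral>\<^sup>+r. \<integral>\<^sup>+\<theta>. k \<theta> r \<partial>lborel \<partial>lborel) = 0" by simp
  then have "AE r in lborel. (\<integral>\<^sup>+\<theta>. k \<theta> r \<partial>lborel) = 0"
    by (subst (asm) nn_integral_0_iff_AE) (simp_all add: k_def polar_def)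
  then have "AE r in lborel. r \<in> {0<..} \<longrightarrow> (AE \<theta> in lborel. \<theta> \<in> {0..2*pi} \<longrightarrow> P (polar (\<theta>, r)))"
  proof eventually_elim
    case (elim r)
    show ?case
    proof
      assume r: "r \<in> {0<..}"
      have "AE \<theta> in lborel. k \<theta> r = 0"
        using elim by (subst (asm) nn_integral_0_iff_AE) (simp_all add: k_def polar_def)
      then show "AE \<theta> in lborel. \<theta> \<in> {0..2*pi} \<longrightarrow> P (polar (\<theta>, r))"
      proof eventually_elim
        case (elim \<theta>)
        then show ?case using r A(1) by (auto simp: k_def split: split_indicator_asm)
      qed
    qed
  qed
  then show ?thesis by (subst AE_restrict_space_iff) auto
qed

text \<open>The Cauchy-Schwarz inequality for the sum over the bands, with free weights \<open>c\<close> that each of the two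
main estimates chooses in its own way.\<close>

lemma wave_sum_sq_le:
  fixes c :: "int \<Rightarrow> real"
  assumes c: "\<And>j. 0 < c j"
  shows "nsq (wave_sum g t x)
    \<le> (\<integral>\<^sup>+j. ennreal (1 / c j) \<partial>counting) * (\<integral>\<^sup>+j. ennreal (c j) * nsq (wave (piece g j) t x) \<partial>counting)"
proof (cases "integrable counting (\<lambda>j. wave (piece g j) t x)")
  case False
  then show ?thesis by (simp add: wave_sum_def not_integrable_integral_eq)
next
  case True
  have "1 \<le> 2 * pi" using pi_gt3 by simp
  then have one: "1 \<le> (2 * pi)\<^sup>2" by (rule one_le_power)
  have "norm (wave_sum g t x) = norm (LINT j|counting. wave (piece g j) t x) / (2 * pi)\<^sup>2"
    by (simp add: wave_sum_def norm_divide norm_power norm_mult)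
  also have "\<dots> \<le> norm (LINT j|counting. wave (piece g j) t x) / 1"
    using one by (intro divide_left_mono) auto
  finally have "ennreal (norm (wave_sum g t x)) \<le> ennreal (norm (LINT j|counting. wave (piece g j) t x))"
    by (simp add: ennreal_leI)
  also have "\<dots> \<le> (\<integral>\<^sup>+j. ennreal (norm (wave (piece g j) t x)) \<partial>counting)"
    by (rule integral_norm_bound_ennreal[OF True])
  also have "\<dots> = (\<integral>\<^sup>+j. ennreal (1 / sqrt (c j)) * ennreal
      (sqrt (c j) * norm (wave (piece g j) t x)) \<partial>counting)"
    using c by (intro nn_integral_cong) (simp add: ennreal_mult[symmetric] less_imp_le less_imp_neq[symmetric])
  finally have "(ennreal (norm (wave_sum g t x)))\<^sup>2
      \<le> (\<integral>\<^sup>+j. ennreal (1 / sqrt (c j)) * ennreal (sqrt (c j) * norm (wave (piece g j) t x)) \<partial>counting)\<^sup>2"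
    by (rule power_mono) simp
  also have "\<dots> \<le> (\<integral>\<^sup>+j. (ennreal (1 / sqrt (c j)))\<^sup>2 \<partial>counting)
      * (\<integral>\<^sup>+j. (ennreal (sqrt (c j) * norm (wave (piece g j) t x)))\<^sup>2 \<partial>counting)"
    by (rule Cauchy_Schwarz_nn_integral) auto
  also have "(\<lambda>j. (ennreal (1 / sqrt (c j)))\<^sup>2) = (\<lambda>j. ennreal (1 / c j))"
    using c by (auto simp: ennreal_power power_divide less_imp_le)
  also have "(\<lambda>j. (ennreal (sqrt (c j) * norm (wave (piece g j) t x)))\<^sup>2)
      = (\<lambda>j. ennreal (c j) * nsq (wave (piece g j) t x))"
    using c by (auto simp: ennreal_power power_mult_distrib ennreal_mult less_imp_le)
  finally show ?thesis by (simp add: ennreal_power)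
qed

text \<open>For almost every radius, the function chosen by \<open>half_wave_fun\<close> agrees with \<open>wave_sum\<close> at almost
every angle; then \<open>wave_sum_sq_le\<close> is integrated over the angle and \<open>circle_le_env\<close> bounds each
band independently of the radius.\<close>

lemma half_wave_circle_esssup_le:
  fixes c :: "int \<Rightarrow> real" and f :: distr
  defines "g \<equiv> fun_of_distr (fourier_distr f)"
  assumes f: "represented_by (fourier_distr f) g0" and \<gamma>: "0 < \<gamma>" "\<gamma> < 1" and fin: "weighted_mass \<gamma> g < top"
    and c: "\<And>j. 0 < c j"
  shows "esssup (restrict_space lborel {0<..})
      (\<lambda>\<rho>. \<integral>\<^sup>+\<theta>\<in>{0..2*pi}. nsq (half_wave_fun f t (vector [\<rho> * cos \<theta>, \<rho> * sin \<theta>])) \<partial>lborel)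
    \<le> (\<integral>\<^sup>+j. ennreal (1 / c j) \<partial>counting) * (\<integral>\<^sup>+j. ennreal (c j) * envelope (freq j) (piece g j) t \<partial>counting)"
proof -
  have g [measurable]: "g \<in> borel_measurable borel"
    using fun_of_distr_AE(1)[OF f] by (simp add: g_def represented_by_def)
  have "half_wave t f = (\<lambda>\<phi>. LINT \<xi>|lborel. cis (- t * norm \<xi>) * g \<xi> * inv_fourier \<phi> \<xi>)"
    by (simp add: half_wave_def fourier_multiplier_def inv_fourier_distr_def g_def)
  then have r: "represented_by (half_wave t f) (wave_sum g t)"
    using half_wave_represented[OF g \<gamma> fin] by simp
  have [measurable]: "half_wave_fun f t \<in> borel_measurable borel"
    using fun_of_distr_AE(1)[OF r] by (simp add: half_wave_fun_def represented_by_def)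
  have ae: "AE x in lborel. half_wave_fun f t x = wave_sum g t x"
    using fun_of_distr_AE(2)[OF r] by (simp add: half_wave_fun_def)
  have b: "band_limited (freq j) (piece g j)" for j
    by (rule band_piece[OF g _ fin]) (use \<gamma> in simp)
  let ?K = "\<integral>\<^sup>+j. ennreal (1 / c j) \<partial>counting"
  show ?thesis
  proof (rule esssup_I)
    show "(\<lambda>\<rho>. \<integral>\<^sup>+\<theta>\<in>{0..2*pi}. nsq (half_wave_fun f t (vector [\<rho> * cos \<theta>, \<rho> * sin \<theta>])) \<partial>lborel) \<in>
        borel_measurable (restrict_space lborel {0<..})"
      by (rule measurable_restrict_space1) measurable
    have "AE r in restrict_space lborel {0<..}. r \<in> {0<..}"
      by (rule AE_I2) (simp add: space_restrict_space)
    with AE_circles[OF ae]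
    show "AE \<rho> in restrict_space lborel {0<..}. (\<integral>\<^sup>+\<theta>\<in>{0..2*pi}. nsq
        (half_wave_fun f t (vector [\<rho> * cos \<theta>, \<rho> * sin \<theta>])) \<partial>lborel)
        \<le> ?K * (\<integral>\<^sup>+j. ennreal (c j) * envelope (freq j) (piece g j) t \<partial>counting)"
    proof eventually_elim
      case (elim r)
      then have r: "0 < r" by simp
      let ?w = "\<lambda>j \<theta>. nsq (wave (piece g j) t (polar (\<theta>, r)))"
      have [measurable]: "?w j \<in> borel_measurable borel" for j
        unfolding polar_def by measurable
      have "(\<integral>\<^sup>+\<theta>\<in>{0..2*pi}. nsq (half_wave_fun f t (vector [r * cos \<theta>, r * sin \<theta>])) \<partial>lborel)
          = (\<integral>\<^sup>+\<theta>\<in>{0..2*pi}. nsq (wave_sum g t (polar (\<theta>, r))) \<partial>lborel)"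
        using elim(1) by (intro nn_integral_cong_AE, eventually_elim)
            (auto simp: polar_def split: split_indicator)
      also have "\<dots> \<le> (\<integral>\<^sup>+\<theta>. ?K * (\<integral>\<^sup>+j. ennreal (c j) * (?w j \<theta> * indicator {0..2*pi} \<theta>) \<partial>counting) \<partial>lborel)"
      proof (rule nn_integral_mono)
        fix \<theta> :: real
        show "nsq (wave_sum g t (polar (\<theta>, r))) * indicator {0..2*pi} \<theta>
            \<le> ?K * (\<integral>\<^sup>+j. ennreal (c j) * (?w j \<theta> * indicator {0..2*pi} \<theta>) \<partial>counting)"
          using wave_sum_sq_le[OF c, of g t "polar (\<theta>, r)"] by (auto split: split_indicator)
      qed
      also have "\<dots> = ?K * (\<integral>\<^sup>+\<theta>. \<integral>\<^sup>+j. ennreal (c j) * (?w j \<theta> * indicator {0..2*pi} \<theta>) \<partial>counting \<partial>lborel)"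
        by (intro nn_integral_cmult borel_measurable_nn_integral_CI) measurable
      also have "(\<integral>\<^sup>+\<theta>. \<integral>\<^sup>+j. ennreal (c j) * (?w j \<theta> * indicator {0..2*pi} \<theta>) \<partial>counting \<partial>lborel)
          = (\<integral>\<^sup>+j. \<integral>\<^sup>+\<theta>. ennreal (c j) * (?w j \<theta> * indicator {0..2*pi} \<theta>) \<partial>lborel \<partial>counting)"
        by (rule nn_integral_CI_swap[symmetric]) measurable
      also have "\<dots> = (\<integral>\<^sup>+j. ennreal (c j) * (\<integral>\<^sup>+\<theta>\<in>{0..2*pi}. ?w j \<theta> \<partial>lborel) \<partial>counting)"
        by (intro nn_integral_cong nn_integral_cmult) measurable
      also have "?K * \<dots> \<le> ?K * (\<integral>\<^sup>+j. ennreal (c j) * envelope (freq j) (piece g j) t \<partial>counting)"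
        by (intro mult_left_mono nn_integral_mono circle_le_env b freq_pos r) auto
      finally show ?case .
    qed
  qed
qed

section \<open>The logarithmic estimate\<close>

lemma ennpowr_mono: "x \<le> y \<Longrightarrow> 0 < p \<Longrightarrow> ennpowr x p \<le> ennpowr y p"
  by (cases x; cases y) (auto simp: ennpowr_def top_unique intro!: ennreal_leI powr_mono2)

lemma ennpowr_ennreal: "0 \<le> a \<Longrightarrow> ennpowr (ennreal a) p = ennreal (a powr p)"
  by (simp add: ennpowr_def)

lemma ennpowr_1: "ennpowr x 1 = x"
  by (cases x) (auto simp: ennpowr_def)

definition logconst :: "real \<Rightarrow> real \<Rightarrow> real" where
  "logconst \<gamma> \<eta> = 2 * (1 + 2 / \<eta>) * 2 powr \<eta> * 2 powr \<gamma>"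

text \<open>Since \<open>ln (2 + freq j * T) \<le> ln (2 + freq j) + ln (2 + T)\<close>, the dependence on \<open>T\<close> factors out at the
expense of a logarithm of the frequency, which is at most a multiple of its power \<open>\<eta>\<close>.  Another power
\<open>\<eta>\<close> is spent on the weight, so the total exponent is \<open>1 + 2 * \<eta> \<le> 2 * \<gamma>\<close>.  At low frequencies the
weight grows, but the factor \<open>freq j\<close> compensates this as \<open>\<eta> < 1\<close>.\<close>

lemma log_weight_le:
  assumes \<eta>: "0 < \<eta>" "\<eta> < 1" "1 + 2 * \<eta> \<le> 2 * \<gamma>" and T: "0 < T" and j: "2 powr j
      \<le> x" "x < 2 powr (real_of_int j + 1)"
  shows "2 powr (\<eta> * \<bar>real_of_int j\<bar>) * (freq j * ln (2 + freq j * T))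
      \<le> logconst \<gamma> \<eta> * ln (2 + T) * (1 + x\<^sup>2) powr \<gamma>"
proof -
  have "0 < 2 powr real_of_int j" by simp
  then have x: "0 < x" using j(1) by linarith
  have f: "freq j = 2 * 2 powr j" by (simp add: freq_def powr_add)
  then have fx: "freq j \<le> 2 * x" using j by simp
  have f0: "0 < freq j" by (rule freq_pos)
  have l2: "1 / 2 \<le> ln (2::real)" using ln2_ge_two_thirds by simp
  have "ln 2 \<le> ln (2 + T)" using T by simp
  then have lT: "1 / 2 \<le> ln (2 + T)" using l2 by linarith
  have "ln (2 + freq j * T) \<le> ln ((2 + freq j) * (2 + T))"
    using f0 T by (intro ln_mono) (auto simp: algebra_simps add_pos_pos)
  also have "\<dots> = ln (2 + freq j) + ln (2 + T)"
    using f0 T by (intro ln_mult_pos) auto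
  also have "ln (2 + freq j) \<le> ln (2 + 2 * x)"
    using fx f0 by (intro ln_mono) auto
  also have "ln (2 + 2 * x) \<le> (2 + 2 * x) powr \<eta> / \<eta>"
    using \<eta> x by (intro ln_powr_bound) auto
  finally have "ln (2 + freq j * T) \<le> (2 + 2 * x) powr \<eta> / \<eta> + ln (2 + T)" by simp
  also have "\<dots> \<le> (2 / \<eta> * (2 + 2 * x) powr \<eta>) * ln (2 + T) + 1 * ln (2 + T)"
  proof -
    have "(2 / \<eta> * (2 + 2 * x) powr \<eta>) * (1 / 2) \<le> (2 / \<eta> * (2 + 2 * x) powr \<eta>) * ln (2 + T)"
      using lT \<eta> by (intro mult_left_mono) auto
    then show ?thesis by simp
  qed
  also have "\<dots> \<le> (2 / \<eta> * (2 + 2 * x) powr \<eta>) * ln (2 + T) + (2 + 2 * x) powr \<eta> * ln (2 + T)"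
    using x \<eta> lT by (intro add_left_mono mult_right_mono ge_one_powr_ge_zero) auto
  also have "\<dots> = (1 + 2 / \<eta>) * (2 + 2 * x) powr \<eta> * ln (2 + T)"
    by (simp add: algebra_simps)
  also have "(2 + 2 * x) powr \<eta> = 2 powr \<eta> * (1 + x) powr \<eta>"
    using powr_mult[of 2 "1 + x" \<eta>] by (simp add: algebra_simps)
  finally have A: "ln (2 + freq j * T) \<le> (1 + 2 / \<eta>) * (2 powr \<eta> * (1 + x) powr \<eta>) * ln (2 + T)" .
  have B: "2 powr (\<eta> * \<bar>real_of_int j\<bar>) * freq j \<le> 2 * (1 + x) powr (1 + \<eta>)"
  proof (cases "0 \<le> j")
    case True
    then have "2 powr (\<eta> * \<bar>real_of_int j\<bar>) * freq j = 2 * (2 powr j) powr (1 + \<eta>)"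
      unfolding f by (simp add: powr_powr powr_add[symmetric] algebra_simps)
    also have "\<dots> \<le> 2 * (1 + x) powr (1 + \<eta>)"
      using j(1) \<eta> x by (intro mult_left_mono powr_mono2) auto
    finally show ?thesis .
  next
    case False
    then have "2 powr (\<eta> * \<bar>real_of_int j\<bar>) * freq j = 2 * 2 powr ((1 - \<eta>) * j)"
      unfolding f by (simp add: powr_add[symmetric] algebra_simps)
    also have "\<dots> \<le> 2 * 2 powr 0"
      using False \<eta> by (intro mult_left_mono powr_mono) (auto simp: mult_nonneg_nonpos)
    also have "\<dots> \<le> 2 * (1 + x) powr (1 + \<eta>)"
      using x \<eta> ge_one_powr_ge_zero[of "1 + x" "1 + \<eta>"] by simp
    finally show ?thesis .
  qed
  have "2 powr (\<eta> * \<bar>real_of_int j\<bar>) * (freq j * ln (2 + freq j * T))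
      = (2 powr (\<eta> * \<bar>real_of_int j\<bar>) * freq j) * ln (2 + freq j * T)"
    by simp
  also have "\<dots> \<le> (2 * (1 + x) powr (1 + \<eta>)) * ((1 + 2 / \<eta>) * (2 powr \<eta> * (1 + x) powr \<eta>) * ln (2 + T))"
    using f0 T by (intro mult_mono A B) (auto intro!: ln_ge_zero)
  also have "\<dots> = (2 * (1 + 2 / \<eta>) * 2 powr \<eta> * ln (2 + T)) * (1 + x) powr (1 + 2 * \<eta>)"
    using x powr_add[of "1 + x" "1 + \<eta>" \<eta>] by (simp add: algebra_simps)
  also have "\<dots> \<le> (2 * (1 + 2 / \<eta>) * 2 powr \<eta> * ln (2 + T)) * (2 powr \<gamma> * (1 + x\<^sup>2) powr \<gamma>)"
  proof (rule mult_left_mono)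
    have "(1 + x) powr (1 + 2 * \<eta>) \<le> (1 + x) powr (2 * \<gamma>)"
      using x \<eta> by (intro powr_mono) auto
    also have "\<dots> = ((1 + x)\<^sup>2) powr \<gamma>"
    proof -
      have "(1 + x) powr 2 = (1 + x)\<^sup>2" using x by simp
      then show ?thesis by (simp only: powr_powr[symmetric])
    qed
    also have "((1 + x)\<^sup>2) powr \<gamma> \<le> (2 * (1 + x\<^sup>2)) powr \<gamma>"
    proof (rule powr_mono2)
      show "(1 + x)\<^sup>2 \<le> 2 * (1 + x\<^sup>2)"
        using zero_le_power2[of "1 - x"] by (simp add: power2_sum power2_diff)
    qed (use \<eta> in auto)
    also have "\<dots> = 2 powr \<gamma> * (1 + x\<^sup>2) powr \<gamma>" by (rule powr_mult)
    finally show "(1 + x) powr (1 + 2 * \<eta>) \<le> 2 powr \<gamma> * (1 + x\<^sup>2) powr \<gamma>" .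
    show "0 \<le> 2 * (1 + 2 / \<eta>) * 2 powr \<eta> * ln (2 + T)" using \<eta> lT by auto
  qed
  also have "\<dots> = logconst \<gamma> \<eta> * ln (2 + T) * (1 + x\<^sup>2) powr \<gamma>"
    by (simp add: logconst_def)
  finally show ?thesis .
qed

text \<open>Weighted summation of \<open>env_L2\<close> over the bands.  The sum of the waves exists because the norm of order
\<open>\<gamma>\<close> dominates the homogeneous one of order \<open>1 / 2\<close>.\<close>

lemma logarithmic_estimate:
  assumes \<gamma>: "1 / 2 < \<gamma>"
  shows "\<exists>C. \<forall>T>0. \<forall>f. sobolev \<gamma> f \<longrightarrow>
    mixed_norm 2 {0..T} (half_wave_fun f) \<le> ennreal (C * (ln (2 + T)) powr (1/2) * sobolev_norm \<gamma> f)"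
proof -
  \<comment> \<open>The room that \<open>\<gamma> > 1 / 2\<close> leaves for the weights and for a logarithm of the frequency.\<close>
  define \<eta> where "\<eta> = min (1 / 2) (\<gamma> - 1 / 2)"
  have \<eta>: "0 < \<eta>" "\<eta> < 1" "1 + 2 * \<eta> \<le> 2 * \<gamma>" using \<gamma> by (auto simp: \<eta>_def min_def)
  define K :: real where "K = 2 / (1 - 2 powr (- \<eta>))"
  have K0: "0 \<le> K" using \<eta> powr_less_one[of 2 "- \<eta>"] by (auto simp: K_def)
  have L0: "0 \<le> logconst \<gamma> \<eta>" using \<eta> by (auto simp: logconst_def)
  define D where "D = K * (8 * shell_const * logconst \<gamma> \<eta>)"
  have D0: "0 \<le> D" using K0 L0 by (auto simp: D_def shell_const_def)
  show ?thesis
  proof (intro exI[of _ "sqrt D * (2 * pi)"] allI impI)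
    fix T :: real and f
    assume T: "0 < T" and f: "sobolev \<gamma> f"
    then obtain g0 where g0: "represented_by (fourier_distr f) g0"
      and ig0: "integrable lborel (\<lambda>\<xi>. (1 + (norm \<xi>)\<^sup>2) powr \<gamma> * (norm (g0 \<xi>))\<^sup>2)"
      unfolding sobolev_def by blast
    define g where "g = fun_of_distr (fourier_distr f)"
    have g [measurable]: "g \<in> borel_measurable borel" and ae: "AE \<xi> in lborel. g \<xi> = g0 \<xi>"
      using fun_of_distr_AE[OF g0] by (auto simp: g_def represented_by_def)
    have [measurable]: "g0 \<in> borel_measurable borel" using g0 by (simp add: represented_by_def)
    let ?w = "\<lambda>\<xi>::real^2. (1 + (norm \<xi>)\<^sup>2) powr \<gamma>"
    have ig: "integrable lborel (\<lambda>\<xi>. ?w \<xi> * (norm (g \<xi>))\<^sup>2)"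
      using ig0 by (rule integrable_cong_AE_imp) (use ae in \<open>auto elim: eventually_mono\<close>)
    define G where "G = (LINT \<xi>|lborel. ?w \<xi> * (norm (g \<xi>))\<^sup>2)"
    have G0: "0 \<le> G" unfolding G_def by (intro Bochner_Integration.integral_nonneg) auto
    have G: "(\<integral>\<^sup>+\<xi>. ennreal (?w \<xi>) * nsq (g \<xi>) \<partial>lborel) = ennreal G"
      unfolding G_def using nn_integral_eq_integral[OF ig] by (simp add: ennreal_mult)
    have "weighted_mass (1 / 2) g \<le> (\<integral>\<^sup>+\<xi>. ennreal (?w \<xi>) * nsq (g \<xi>) \<partial>lborel)"
      unfolding weighted_mass_def
    proof (rule nn_integral_mono)
      fix \<xi> :: "real^2"
      have "norm \<xi> powr (2 * (1 / 2)) \<le> ?w \<xi>"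
      proof -
        have "norm \<xi> = sqrt ((norm \<xi>)\<^sup>2)" by simp
        also have "\<dots> \<le> sqrt (1 + (norm \<xi>)\<^sup>2)" by (intro real_sqrt_le_mono) simp
        also have "\<dots> = (1 + (norm \<xi>)\<^sup>2) powr (1 / 2)" by (simp add: powr_half_sqrt add_nonneg_nonneg)
        also have "\<dots> \<le> ?w \<xi>" using \<gamma> by (intro powr_mono) auto
        finally show ?thesis by simp
      qed
      then show "ennreal (norm \<xi> powr (2 * (1 / 2)) * (norm (g \<xi>))\<^sup>2) \<le> ennreal (?w \<xi>) * nsq (g \<xi>)"
        by (subst ennreal_mult[symmetric]) (auto intro!: ennreal_leI mult_right_mono)
    qed
    also have "\<dots> < top" unfolding G by simp
    finally have fin: "weighted_mass (1 / 2) g < top" .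
    have b: "band_limited (freq j) (piece g j)" for j by (rule band_piece[OF g _ fin]) simp
    have [measurable]: "envelope (freq j) (piece g j) \<in> borel_measurable borel" for j
        by (rule env_measurable[OF b])
    let ?c = "\<lambda>j::int. 2 powr (\<eta> * \<bar>real_of_int j\<bar>)"
    let ?S = "\<lambda>t. \<integral>\<^sup>+j. ennreal (?c j) * envelope (freq j) (piece g j) t \<partial>counting"
    have Kb: "(\<integral>\<^sup>+j. ennreal (1 / ?c j) \<partial>counting) \<le> ennreal K"
      using nn_integral_CI_geometric[OF \<eta>(1), of 0] by (simp add: K_def powr_minus divide_inverse)
    have sup: "esssup (restrict_space lborel {0<..})
      (\<lambda>\<rho>. \<integral>\<^sup>+\<theta>\<in>{0..2*pi}. nsq (half_wave_fun f t (vector [\<rho> * cos \<theta>, \<rho> * sin \<theta>])) \<partial>lborel)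
          \<le> ennreal K * ?S t" (is "?E t \<le> _") for t
    proof -
      have "?E t \<le> (\<integral>\<^sup>+j. ennreal (1 / ?c j) \<partial>counting) * ?S t"
        unfolding g_def by (rule half_wave_circle_esssup_le[OF g0, of "1/2"]) (use fin in \<open>auto simp: g_def\<close>)
      also have "\<dots> \<le> ennreal K * ?S t" by (intro mult_right_mono Kb) simp
      finally show ?thesis .
    qed
    have piecebd: "ennreal (?c j) * (\<integral>\<^sup>+t\<in>{0..T}. envelope (freq j) (piece g j) t \<partial>lborel)
       \<le> ennreal (8 * shell_const * logconst \<gamma> \<eta> * ln (2 + T))
         * (\<integral>\<^sup>+\<xi>. ennreal (?w \<xi>) * nsq (piece g j \<xi>) \<partial>lborel)" for j
    proof -
      have "ennreal (?c j) * (\<integral>\<^sup>+t\<in>{0..T}. envelope (freq j) (piece g j) t \<partial>lborel)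
          \<le> ennreal (?c j) * (ennreal (8 * shell_const * freq j * ln (2 + freq j * T)) * mass (piece g j))"
        by (intro mult_left_mono env_L2 b freq_pos T) simp
      also have "\<dots> = ennreal (?c j * (8 * shell_const * freq j * ln (2 + freq j * T))) * mass (piece g j)"
        by (subst ennreal_mult') (auto simp: mult.assoc)
      also have "\<dots> = (\<integral>\<^sup>+\<xi>. ennreal (?c j * (8 * shell_const * freq j * ln (2 + freq j * T)))
          * nsq (piece g j \<xi>) \<partial>lborel)"
        by (rule nn_integral_cmult[symmetric]) measurable
      also have "\<dots> \<le> (\<integral>\<^sup>+\<xi>. ennreal (8 * shell_const * logconst \<gamma> \<eta> * ln (2 + T))
          * (ennreal (?w \<xi>) * nsq (piece g j \<xi>)) \<partial>lborel)"
      proof (rule nn_integral_mono)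
        fix \<xi> :: "real^2"
        show "ennreal (?c j * (8 * shell_const * freq j * ln (2 + freq j * T))) * nsq (piece g j \<xi>)
          \<le> ennreal (8 * shell_const * logconst \<gamma> \<eta> * ln (2 + T)) * (ennreal (?w \<xi>) * nsq (piece g j \<xi>))"
        proof (cases "\<xi> \<in> dyadic j")
          case True
          have "(8 * shell_const) * (?c j * (freq j * ln (2 + freq j * T)))
              \<le> (8 * shell_const) * (logconst \<gamma> \<eta> * ln (2 + T) * ?w \<xi>)"
            using True by (intro mult_left_mono log_weight_le[OF \<eta> T]) (auto simp: dyadic_def shell_const_def)
          then have "ennreal (?c j * (8 * shell_const * freq j * ln (2 + freq j * T)))
              \<le> ennreal (8 * shell_const * logconst \<gamma> \<eta> * ln (2 + T) * ?w \<xi>)"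
            by (intro ennreal_leI) (simp add: mult_ac)
          also have "\<dots> = ennreal (8 * shell_const * logconst \<gamma> \<eta> * ln (2 + T)) * ennreal (?w \<xi>)"
            by (rule ennreal_mult'') simp
          finally show ?thesis unfolding mult.assoc[symmetric] by (rule mult_right_mono) simp
        qed (simp add: piece_def)
      qed
      also have "\<dots> = ennreal (8 * shell_const * logconst \<gamma> \<eta> * ln (2 + T))
          * (\<integral>\<^sup>+\<xi>. ennreal (?w \<xi>) * nsq (piece g j \<xi>) \<partial>lborel)"
        by (rule nn_integral_cmult) measurable
      finally show ?thesis .
    qed
    have "(\<integral>\<^sup>+t\<in>{0..T}. ?E t \<partial>lborel) \<le> (\<integral>\<^sup>+t. \<integral>\<^sup>+j. ennreal K
        * (ennreal (?c j) * (envelope (freq j) (piece g j) t * indicator {0..T} t)) \<partial>counting \<partial>lborel)"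
    proof (rule nn_integral_mono)
      fix t
      show "?E t * indicator {0..T} t \<le> (\<integral>\<^sup>+j. ennreal K
          * (ennreal (?c j) * (envelope (freq j) (piece g j) t * indicator {0..T} t)) \<partial>counting)"
        using sup[of t] by (auto simp: nn_integral_cmult split: split_indicator)
    qed
    also have "\<dots> = (\<integral>\<^sup>+j. \<integral>\<^sup>+t. ennreal K * (ennreal (?c j)
        * (envelope (freq j) (piece g j) t * indicator {0..T} t)) \<partial>lborel \<partial>counting)"
      by (rule nn_integral_CI_swap[symmetric]) measurable
    also have "\<dots> = (\<integral>\<^sup>+j. ennreal K * (ennreal (?c j) *
        (\<integral>\<^sup>+t\<in>{0..T}. envelope (freq j) (piece g j) t \<partial>lborel)) \<partial>counting)"
      by (simp add: nn_integral_cmult)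
    also have "\<dots> \<le> (\<integral>\<^sup>+j. ennreal K * (ennreal (8 * shell_const * logconst \<gamma> \<eta> * ln (2 + T))
        * (\<integral>\<^sup>+\<xi>. ennreal (?w \<xi>) * nsq (piece g j \<xi>) \<partial>lborel)) \<partial>counting)"
      by (intro nn_integral_mono mult_left_mono piecebd) simp
    also have "\<dots> = ennreal K * (ennreal (8 * shell_const * logconst \<gamma> \<eta> * ln (2 + T)) * ennreal G)"
      using nn_integral_CI_piece[OF g, of "\<lambda>\<xi>. ennreal (?w \<xi>)"] by (simp add: nn_integral_cmult G)
    also have "\<dots> = ennreal (D * ln (2 + T) * G)"
      using K0 L0 G0 T by (simp add: ennreal_mult[symmetric] D_def shell_const_def mult_ac)
    finally have main: "(\<integral>\<^sup>+t\<in>{0..T}. ?E t \<partial>lborel) \<le> ennreal (D * ln (2 + T) * G)" .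
    have "mixed_norm 2 {0..T} (half_wave_fun f) \<le> ennpowr (ennreal (D * ln (2 + T) * G)) (1 / 2)"
      unfolding mixed_norm_def using main by (intro ennpowr_mono) (simp_all add: ennpowr_1)
    also have "\<dots> = ennreal (sqrt (D * ln (2 + T) * G))"
      using D0 G0 T by (simp add: ennpowr_ennreal powr_half_sqrt)
    also have "sqrt (D * ln (2 + T) * G) = sqrt D * (2 * pi) * (ln (2 + T)) powr (1/2) * sobolev_norm \<gamma> f"
      using T by (simp add: sobolev_norm_def G_def g_def[symmetric] real_sqrt_mult real_sqrt_divide
          powr_half_sqrt)
    finally show "mixed_norm 2 {0..T} (half_wave_fun f)
        \<le> ennreal (sqrt D * (2 * pi) * (ln (2 + T)) powr (1/2) * sobolev_norm \<gamma> f)" .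
  qed
qed

section \<open>The scale-invariant estimate\<close>

lemma nn_integral_CI_ge: "f j \<le> (\<integral>\<^sup>+j. f j \<partial>counting)"
  by (rule nn_integral_ge_point) simp

text \<open>If \<open>v j\<close> is bounded both by a growing and by a decaying geometric sequence, and \<open>X\<close> is about
\<open>2 powr J\<close>, the first bound is used for \<open>j \<le> J\<close> and the second for \<open>j > J\<close>; half of the decay
away from \<open>J\<close> pays for the weight.\<close>

lemma hedberg_sum_le:
  fixes v :: "int \<Rightarrow> real" and a b A B X \<eta> :: real and J :: int
  assumes \<eta>: "0 < \<eta>" "2 * \<eta> \<le> a" "2 * \<eta> \<le> b" and AB: "0 \<le> A" "0 \<le> B" and X: "2 powr J
      \<le> X" "X < 2 powr (real_of_int J + 1)"
    and low: "\<And>j. v j \<le> A * 2 powr (a * j)" and high: "\<And>j. v j \<le> B * 2 powr (- b * j)"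
  shows "2 powr (\<eta> * \<bar>real_of_int (j - J)\<bar>) * v j \<le> (A * X powr a + B * 2 powr b * X powr (- b))
      * 2 powr (- \<eta> * \<bar>real_of_int (j - J)\<bar>)"
proof -
  have "0 < 2 powr real_of_int J" by simp
  then have X0: "0 < X" using X(1) by linarith
  show ?thesis
  proof (cases "j \<le> J")
    case True
    define d where "d = real_of_int (J - j)"
    have d: "0 \<le> d" "\<bar>real_of_int (j - J)\<bar> = d" "real_of_int j = J - d" using True by (auto simp: d_def)
    have "2 powr (\<eta> * d) * v j \<le> 2 powr (\<eta> * d) * (A * 2 powr (a * j))"
      by (intro mult_left_mono low) auto
    also have "\<dots> = A * (2 powr J) powr a * 2 powr ((\<eta> - a) * d)"
      by (simp add: d(3) powr_powr powr_add[symmetric] algebra_simps)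
    also have "\<dots> \<le> A * X powr a * 2 powr (- \<eta> * d)"
    proof (rule mult_mono)
      show "A * (2 powr J) powr a \<le> A * X powr a"
        using X(1) \<eta> AB by (intro mult_left_mono powr_mono2) auto
      have "(\<eta> - a) * d \<le> - \<eta> * d" using \<eta> d(1) by (intro mult_right_mono) auto
      then show "2 powr ((\<eta> - a) * d) \<le> 2 powr (- \<eta> * d)" by (rule powr_mono) simp
    qed (use AB in auto)
    also have "\<dots> \<le> (A * X powr a + B * 2 powr b * X powr (- b)) * 2 powr (- \<eta> * d)"
      using AB by (intro mult_right_mono) auto
    finally show ?thesis by (simp only: d(2))
  next
    case False
    define d where "d = real_of_int (j - J)"
    have d: "0 \<le> d" "\<bar>real_of_int (j - J)\<bar> = d" "real_of_int j = J + d" using False by (auto simp: d_def)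
    have "2 powr (\<eta> * d) * v j \<le> 2 powr (\<eta> * d) * (B * 2 powr (- b * j))"
      by (intro mult_left_mono high) auto
    also have "\<dots> = (B * 2 powr b * (2 powr (real_of_int J + 1)) powr (- b)) * 2 powr ((\<eta> - b) * d)"
      by (simp add: d(3) powr_powr powr_add[symmetric] algebra_simps)
    also have "\<dots> \<le> (B * 2 powr b * X powr (- b)) * 2 powr (- \<eta> * d)"
    proof (rule mult_mono)
      show "B * 2 powr b * (2 powr (real_of_int J + 1)) powr (- b) \<le> B * 2 powr b * X powr (- b)"
        using X X0 \<eta> AB by (intro mult_left_mono powr_mono2') auto
      have "(\<eta> - b) * d \<le> - \<eta> * d" using \<eta> d(1) by (intro mult_right_mono) auto
      then show "2 powr ((\<eta> - b) * d) \<le> 2 powr (- \<eta> * d)" by (rule powr_mono) simp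
    qed (use AB in auto)
    also have "\<dots> \<le> (A * X powr a + B * 2 powr b * X powr (- b)) * 2 powr (- \<eta> * d)"
      using AB by (intro mult_right_mono) auto
    finally show ?thesis by (simp only: d(2))
  qed
qed

text \<open>The hypothesis on \<open>v\<close> controls low frequencies, whereas each term of the sum on the right-hand side,
that is, the power \<open>q1 / 2\<close> of \<open>2 powr (2 * \<delta> * j) * v j\<close>, is at most that sum.
The weights in \<open>E\<close> are centred at the frequency where the two bounds are equal.  The parameter \<open>\<delta>\<close> makes
    the exponents of \<open>2\<close> cancel when
the right-hand side is later integrated with \<open>env_Lp\<close>.\<close>

lemma hedberg_interpolation:
  fixes v :: "int \<Rightarrow> real" and E :: ennreal and q q1 \<delta> A F :: real
  assumes q: "2 < q1" "q1 < q" and \<delta>: "\<delta> = 1 / q1 - 1 / q" and A: "0 < A" and F: "0 < F"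
    and v: "\<And>j. 0 \<le> v j" "\<And>j. v j \<le> A * F\<^sup>2 * 2 powr (2 / q * j)"
    and E: "\<And>c. (\<And>j. 0 < c j) \<Longrightarrow> E \<le> (\<integral>\<^sup>+j. ennreal (1 / c j) \<partial>counting)
        * (\<integral>\<^sup>+j. ennreal (c j) * ennreal (v j) \<partial>counting)"
  defines "\<eta> \<equiv> min (1 / q) \<delta>"
  shows "ennpowr E (q / 2) \<le> ennreal (((2 / (1 - 2 powr (- \<eta>)))\<^sup>2 * (A + 2 powr (2 * \<delta>))) powr (q / 2)
      * F powr (q - q1)) *
     (\<integral>\<^sup>+j. ennreal (2 powr (\<delta> * q1 * j) * v j powr (q1 / 2)) \<partial>counting)"
proof -
  have d0: "0 < \<delta>" using q by (simp add: \<delta> field_simps)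
  have \<eta>: "0 < \<eta>" "2 * \<eta> \<le> 2 / q" "2 * \<eta> \<le> 2 * \<delta>" using d0 q by (auto simp: \<eta>_def)
  let ?K = "2 / (1 - 2 powr (- \<eta>))"
  have K0: "0 < ?K" using \<eta> powr_less_one[of 2 "- \<eta>"] by auto
  let ?C = "?K\<^sup>2 * (A + 2 powr (2 * \<delta>))"
  have C0: "0 < ?C" using K0 A by (intro mult_pos_pos add_pos_pos) auto
  let ?Z = "\<integral>\<^sup>+j. ennreal (2 powr (\<delta> * q1 * j) * v j powr (q1 / 2)) \<partial>counting"
  have R0: "0 < ?C powr (q / 2) * F powr (q - q1)" using C0 F by (intro mult_pos_pos) auto
  have geo: "(\<integral>\<^sup>+j. ennreal (2 powr (- \<eta> * \<bar>real_of_int (j - J)\<bar>)) \<partial>counting) \<le> ennreal ?K" for J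
    by (rule nn_integral_CI_geometric[OF \<eta>(1)])
  show ?thesis
  proof (cases ?Z)
    case top
    have "x \<le> ennreal R * top" if "0 < R" for x R
      using that by (simp add: ennreal_mult_top)
    from this[OF R0] show ?thesis unfolding top .
  next
    case (real z)
    show ?thesis
    proof (cases "z = 0")
      case True
      have "v j = 0" for j
      proof -
        have "ennreal (2 powr (\<delta> * q1 * j) * v j powr (q1 / 2)) \<le> 0"
          using nn_integral_CI_ge[of "\<lambda>j. ennreal (2 powr (\<delta> * q1 * j) * v j powr (q1 / 2))" j] real True
              by simp
        then have "2 powr (\<delta> * q1 * j) * v j powr (q1 / 2) \<le> 0" by (simp only: le_zero_eq ennreal_eq_0_iff)
        then have "v j powr (q1 / 2) \<le> 0" by (simp add: mult_le_0_iff)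
        then show ?thesis by simp
      qed
      then have "E \<le> 0" using E[of "\<lambda>j. 1"] by simp
      then show ?thesis by (simp add: ennpowr_def)
    next
      case False
      with real have z: "0 < z" by simp
      define w where "w = z powr (2 / q1)"
      have w: "0 < w" using z by (simp add: w_def)
      have wz: "w powr (q1 / 2) = z" using z q by (simp add: w_def powr_powr)
      \<comment> \<open>The frequency at which \<open>F\<^sup>2 * X powr (2 / q)\<close> equals \<open>w * X powr (- 2 * \<delta>)\<close>.\<close>
      define X where "X = (w / F\<^sup>2) powr (q1 / 2)"
      have X0: "0 < X" using w F by (simp add: X_def)
      define J where "J = \<lfloor>log 2 X\<rfloor>"
      have X: "2 powr J \<le> X" "X < 2 powr (real_of_int J + 1)"
        using X0 by (simp_all add: J_def le_log_iff[symmetric] log_less_iff[symmetric])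
      have high: "v j \<le> w * 2 powr (- (2 * \<delta>) * j)" for j
      proof -
        have "ennreal (2 powr (\<delta> * q1 * j) * v j powr (q1 / 2)) \<le> ennreal z"
          using nn_integral_CI_ge[of "\<lambda>j. ennreal (2 powr (\<delta> * q1 * j) * v j powr (q1 / 2))" j] real by simp
        then have "2 powr (\<delta> * q1 * j) * v j powr (q1 / 2) \<le> z" using z by simp
        also have "2 powr (\<delta> * q1 * j) * v j powr (q1 / 2) = (2 powr (2 * \<delta> * j) * v j) powr (q1 / 2)"
          using q by (simp add: powr_mult powr_powr algebra_simps)
        finally have "((2 powr (2 * \<delta> * j) * v j) powr (q1 / 2)) powr (2 / q1) \<le> w"
          unfolding w_def using q by (intro powr_mono2) auto
        then have "2 powr (2 * \<delta> * j) * v j \<le> w" using q v(1)[of j] by (simp add: powr_powr)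
        then have "2 powr (- (2 * \<delta>) * j) * (2 powr (2 * \<delta> * j) * v j) \<le> 2 powr (- (2 * \<delta>) * j) * w"
          by (intro mult_left_mono) auto
        moreover have "2 powr (- (2 * \<delta>) * j) * (2 powr (2 * \<delta> * j) * v j) = v j"
          by (simp add: mult.assoc[symmetric] powr_add[symmetric])
        ultimately have "v j \<le> 2 powr (- (2 * \<delta>) * j) * w" by (simp only:)
        then show ?thesis by (simp only: mult.commute)
      qed
      let ?B = "F\<^sup>2 * (w / F\<^sup>2) powr (q1 / q)"
      have B0: "0 < ?B" using w F by simp
      have e1: "A * F\<^sup>2 * X powr (2 / q) = A * ?B"
        using q by (simp add: X_def powr_powr)
      have e2: "w * 2 powr (2 * \<delta>) * X powr (- (2 * \<delta>)) = 2 powr (2 * \<delta>) * ?B"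
      proof -
        have qd: "q1 / 2 * - (2 * \<delta>) = q1 / q - 1" using q by (simp add: \<delta> field_simps)
        have "X powr (- (2 * \<delta>)) = (w / F\<^sup>2) powr (q1 / q - 1)"
          unfolding X_def powr_powr qd ..
        also have "\<dots> = (w / F\<^sup>2) powr (q1 / q) / (w / F\<^sup>2)"
          using w F by (simp add: powr_diff)
        finally show ?thesis using w F by simp
      qed
      let ?c = "\<lambda>j. 2 powr (\<eta> * \<bar>real_of_int (j - J)\<bar>)"
      have vb: "ennreal (?c j) * ennreal (v j) \<le> ennreal ((A + 2 powr (2 * \<delta>)) * ?B)
          * ennreal (2 powr (- \<eta> * \<bar>real_of_int (j - J)\<bar>))" for j
      proof -
        have "?c j * v j \<le> (A * F\<^sup>2 * X powr (2 / q) + w * 2 powr (2 * \<delta>) * X powr (- (2 * \<delta>)))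
            * 2 powr (- \<eta> * \<bar>real_of_int (j - J)\<bar>)"
          by (rule hedberg_sum_le[OF \<eta> _ _ X v(2) high]) (use A F w in auto)
        also have "A * F\<^sup>2 * X powr (2 / q) + w * 2 powr (2 * \<delta>) * X powr (- (2 * \<delta>))
            = (A + 2 powr (2 * \<delta>)) * ?B"
          unfolding e1 e2 by (rule distrib_right[symmetric])
        finally have "ennreal (?c j * v j) \<le> ennreal ((A + 2 powr (2 * \<delta>)) * ?B
            * 2 powr (- \<eta> * \<bar>real_of_int (j - J)\<bar>))"
          by (rule ennreal_leI)
        then show ?thesis using v(1)[of j] by (simp only: ennreal_mult'' powr_ge_zero)
      qed
      have "E \<le> (\<integral>\<^sup>+j. ennreal (1 / ?c j) \<partial>counting) * (\<integral>\<^sup>+j. ennreal (?c j) * ennreal (v j) \<partial>counting)"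
        by (rule E) simp
      also have "(\<integral>\<^sup>+j. ennreal (1 / ?c j) \<partial>counting) =
          (\<integral>\<^sup>+j. ennreal (2 powr (- \<eta> * \<bar>real_of_int (j - J)\<bar>)) \<partial>counting)"
        by (simp add: powr_minus divide_inverse)
      also have "\<dots> * (\<integral>\<^sup>+j. ennreal (?c j) * ennreal (v j) \<partial>counting)
         \<le> ennreal ?K * (\<integral>\<^sup>+j. ennreal ((A + 2 powr (2 * \<delta>)) * ?B)
           * ennreal (2 powr (- \<eta> * \<bar>real_of_int (j - J)\<bar>)) \<partial>counting)"
        by (intro mult_mono geo nn_integral_mono vb) auto
      also have "(\<integral>\<^sup>+j. ennreal ((A + 2 powr (2 * \<delta>)) * ?B)
          * ennreal (2 powr (- \<eta> * \<bar>real_of_int (j - J)\<bar>)) \<partial>counting)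
         = ennreal ((A + 2 powr (2 * \<delta>)) * ?B) * (\<integral>\<^sup>+j. ennreal
           (2 powr (- \<eta> * \<bar>real_of_int (j - J)\<bar>)) \<partial>counting)"
        by (rule nn_integral_cmult) simp
      also have "ennreal ?K * (ennreal ((A + 2 powr (2 * \<delta>)) * ?B)
          * (\<integral>\<^sup>+j. ennreal (2 powr (- \<eta> * \<bar>real_of_int (j - J)\<bar>)) \<partial>counting))
         \<le> ennreal ?K * (ennreal ((A + 2 powr (2 * \<delta>)) * ?B) * ennreal ?K)"
        by (intro mult_left_mono geo) auto
      also have "\<dots> = ennreal (?K * (((A + 2 powr (2 * \<delta>)) * ?B) * ?K))"
      proof -
        have "ennreal k * (ennreal m * ennreal k) = ennreal (k * (m * k))" if "0 \<le> k" "0 \<le> m" for k m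
          using that by (simp add: ennreal_mult)
        from this[of ?K "(A + 2 powr (2 * \<delta>)) * ?B"] show ?thesis
          using K0 A B0 by (meson add_nonneg_nonneg less_imp_le mult_nonneg_nonneg powr_ge_zero)
      qed
      also have "?K * (((A + 2 powr (2 * \<delta>)) * ?B) * ?K) = ?C * ?B"
        by (simp only: power2_eq_square mult_ac)
      finally have "ennpowr E (q / 2) \<le> ennpowr (ennreal (?C * ?B)) (q / 2)"
        using q by (intro ennpowr_mono) auto
      also have "\<dots> = ennreal ((?C * ?B) powr (q / 2))"
        using C0 B0 by (intro ennpowr_ennreal mult_nonneg_nonneg less_imp_le)
      also have "(?C * ?B) powr (q / 2) = ?C powr (q / 2) * F powr (q - q1) * z"
      proof -
        have F2: "F\<^sup>2 = F powr 2" using F by simp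
        have "?B powr (q / 2) = (F\<^sup>2) powr (q / 2) * (w / F\<^sup>2) powr (q1 / 2)"
          using q by (simp add: powr_mult powr_powr)
        also have "(w / F\<^sup>2) powr (q1 / 2) = z / (F\<^sup>2) powr (q1 / 2)"
          by (simp only: powr_divide wz)
        also have "(F\<^sup>2) powr (q / 2) * (z / (F\<^sup>2) powr (q1 / 2)) = F powr (q - q1) * z"
          unfolding F2 powr_powr by (simp add: powr_diff)
        finally show ?thesis by (simp only: powr_mult mult.assoc)
      qed
      also have "ennreal (?C powr (q / 2) * F powr (q - q1) * z)
          = ennreal (?C powr (q / 2) * F powr (q - q1)) * ?Z"
        using real by (simp add: ennreal_mult'')
      finally show ?thesis .
    qed
  qed
qed

text \<open>After \<open>hedberg_interpolation\<close> with \<open>A = 4 * shell_const\<close>, the sum over the bands stands outside the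
\<open>q1\<close>-th powers, where \<open>env_Lp\<close> applies band by band.  The exponents of \<open>2\<close> cancel, and
\<open>p > 1\<close> together with \<open>\<epsilon> j \<le> F\<^sup>2\<close> reduces the sum of the \<open>\<epsilon> j powr p\<close> to the sum of the \<open>\<epsilon> j\<close>.\<close>

lemma homogeneous_estimate:
  assumes q: "2 < q"
  shows "\<exists>C. \<forall>f. hom_sobolev (1 - 1/q) f \<longrightarrow> mixed_norm q UNIV (half_wave_fun f)
      \<le> ennreal (C * hom_sobolev_norm (1 - 1/q) f)"
proof -
  define \<gamma> where "\<gamma> = 1 - 1 / q"
  have \<gamma>: "0 < \<gamma>" "\<gamma> < 1" using q by (auto simp: \<gamma>_def)
  \<comment> \<open>Any exponent strictly between \<open>2\<close> and \<open>q\<close> would do.\<close>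
  define q1 where "q1 = (2 + q) / 2"
  have q1: "2 < q1" "q1 < q" using q by (auto simp: q1_def)
  define p where "p = q1 / 2"
  have p: "1 < p" using q1 by (simp add: p_def)
  define \<delta> where "\<delta> = 1 / q1 - 1 / q"
  define \<eta> where "\<eta> = min (1 / q) \<delta>"
  have shell_const: "0 < shell_const" by (simp add: shell_const_def)
  define C1 where "C1 = ((2 / (1 - 2 powr (- \<eta>)))\<^sup>2 * (4 * shell_const + 2 powr (2 * \<delta>))) powr (q / 2)"
  have C1: "0 \<le> C1" by (simp add: C1_def)
  define C2 where "C2 = shell_const powr p * 2 powr (q1 - 1) / (1 - 2 powr (1 - p))"
  have C2: "0 \<le> C2" using p powr_less_one[of 2 "1 - p"] by (simp add: C2_def)
  show ?thesis
  proof (intro exI[of _ "(C1 * C2) powr (1 / q) * (2 * pi)"] allI impI)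
    fix f assume f: "hom_sobolev (1 - 1/q) f"
    then obtain g0 where g0: "represented_by (fourier_distr f) g0"
      and ig0: "integrable lborel (\<lambda>\<xi>. norm \<xi> powr (2 * \<gamma>) * (norm (g0 \<xi>))\<^sup>2)"
      unfolding hom_sobolev_def \<gamma>_def by blast
    define g where "g = fun_of_distr (fourier_distr f)"
    have g [measurable]: "g \<in> borel_measurable borel" and ae: "AE \<xi> in lborel. g \<xi> = g0 \<xi>"
      using fun_of_distr_AE[OF g0] by (auto simp: g_def represented_by_def)
    have [measurable]: "g0 \<in> borel_measurable borel" using g0 by (simp add: represented_by_def)
    have ig: "integrable lborel (\<lambda>\<xi>. norm \<xi> powr (2 * \<gamma>) * (norm (g \<xi>))\<^sup>2)"
      using ig0 by (rule integrable_cong_AE_imp) (use ae in \<open>auto elim: eventually_mono\<close>)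
    define G where "G = (LINT \<xi>|lborel. norm \<xi> powr (2 * \<gamma>) * (norm (g \<xi>))\<^sup>2)"
    have G0: "0 \<le> G" unfolding G_def by (intro Bochner_Integration.integral_nonneg) auto
    have G: "weighted_mass \<gamma> g = ennreal G"
      unfolding G_def weighted_mass_def using nn_integral_eq_integral[OF ig] by simp
    then have fin: "weighted_mass \<gamma> g < top" by simp
    define F where "F = sqrt G"
    have F0: "0 \<le> F" using G0 by (simp add: F_def)
    have F2: "weighted_mass \<gamma> g = ennreal (F\<^sup>2)" using G G0 by (simp add: F_def)
    have b: "band_limited (freq j) (piece g j)" for j by (rule band_piece[OF g _ fin]) (use \<gamma> in simp)
    have [measurable]: "envelope (freq j) (piece g j) \<in> borel_measurable borel" for j
        by (rule env_measurable[OF b])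
    define \<epsilon> where "\<epsilon> = (\<lambda>j. enn2real (weighted_mass \<gamma> (piece g j)))"
    have \<epsilon>: "weighted_mass \<gamma> (piece g j) = ennreal (\<epsilon> j)" "0 \<le> \<epsilon> j" "\<epsilon> j \<le> F\<^sup>2" for j
    proof -
      have "weighted_mass \<gamma> (piece g j) \<le> ennreal (F\<^sup>2)" using hmass_piece_le[of \<gamma> g j] by (simp add: F2)
      moreover from le_less_trans[OF this ennreal_less_top]
      show e: "weighted_mass \<gamma> (piece g j) = ennreal (\<epsilon> j)" by (simp add: \<epsilon>_def)
      ultimately show "\<epsilon> j \<le> F\<^sup>2" by simp
      show "0 \<le> \<epsilon> j" by (simp add: \<epsilon>_def)
    qed
    have sum\<epsilon>: "(\<integral>\<^sup>+j. ennreal (\<epsilon> j) \<partial>counting) = ennreal (F\<^sup>2)"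
      using nn_integral_CI_hmass_piece[OF g, of \<gamma>] by (simp add: \<epsilon> F2)
    define m where "m = (\<lambda>j. enn2real (mass (piece g j)))"
    have m: "mass (piece g j) = ennreal (m j)" "0 \<le> m j" "m j \<le> 2 powr (- 2 * \<gamma> * j) * \<epsilon> j" for j
    proof -
      have le: "mass (piece g j) \<le> ennreal (2 powr (- 2 * \<gamma> * j) * \<epsilon> j)"
        using mass_piece_le[OF g, of \<gamma> j] \<gamma> \<epsilon>[of j] by (simp add: ennreal_mult)
      from le_less_trans[OF this ennreal_less_top]
      show e: "mass (piece g j) = ennreal (m j)" by (simp add: m_def)
      show "m j \<le> 2 powr (- 2 * \<gamma> * j) * \<epsilon> j" using le \<epsilon>(2)[of j] unfolding e by simp
      show "0 \<le> m j" by (simp add: m_def)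
    qed
    define v where "v = (\<lambda>t j. enn2real (envelope (freq j) (piece g j) t))"
    have [measurable]: "(\<lambda>t. v t j) \<in> borel_measurable borel" for j unfolding v_def by measurable
    have v0: "0 \<le> v t j" for t j by (simp add: v_def)
    have envle: "envelope (freq j) (piece g j) t \<le> ennreal (4 * shell_const * F\<^sup>2 * 2 powr (2 / q * j))" for t j
    proof -
      have "envelope (freq j) (piece g j) t \<le> ennreal (shell_const * (freq j)\<^sup>2)
          * ennreal (2 powr (- 2 * \<gamma> * j) * F\<^sup>2)"
      proof (intro order_trans[OF env_le[OF b freq_pos]] mult_left_mono)
        have "m j \<le> 2 powr (- 2 * \<gamma> * j) * F\<^sup>2"
          by (rule order_trans[OF m(3)]) (intro mult_left_mono \<epsilon>(3), simp)
        then show "mass (piece g j) \<le> ennreal (2 powr (- 2 * \<gamma> * j) * F\<^sup>2)"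
          unfolding m(1) by (rule ennreal_leI)
      qed simp
      also have "\<dots> = ennreal (shell_const * (freq j)\<^sup>2 * (2 powr (- 2 * \<gamma> * j) * F\<^sup>2))"
        using shell_const by (subst ennreal_mult) auto
      also have "shell_const * (freq j)\<^sup>2 * (2 powr (- 2 * \<gamma> * j) * F\<^sup>2)
          = 4 * shell_const * F\<^sup>2 * 2 powr (2 / q * j)"
      proof -
        have "freq j = 2 * 2 powr j" by (simp add: freq_def powr_add)
        then have "(freq j)\<^sup>2 = 4 * (2 powr j * 2 powr j)" by (simp add: power2_eq_square)
        moreover have "2 powr j * 2 powr j * 2 powr (- 2 * \<gamma> * j) = 2 powr (2 / q * j)"
          by (simp add: powr_add[symmetric] \<gamma>_def algebra_simps)
        ultimately show ?thesis by (simp add: mult_ac)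
      qed
      finally show ?thesis .
    qed
    have envelope: "envelope (freq j) (piece g j) t = ennreal (v t j)" for t j
      using le_less_trans[OF envle ennreal_less_top, of j t] by (simp add: v_def)
    have vle: "v t j \<le> 4 * shell_const * F\<^sup>2 * 2 powr (2 / q * j)" for t j
      using envle[of j t] shell_const unfolding envelope by simp
    let ?E = "\<lambda>t. esssup (restrict_space lborel {0<..})
      (\<lambda>\<rho>. \<integral>\<^sup>+\<theta>\<in>{0..2*pi}. nsq (half_wave_fun f t (vector [\<rho> * cos \<theta>, \<rho> * sin \<theta>])) \<partial>lborel)"
    have E: "?E t \<le> (\<integral>\<^sup>+j. ennreal (1 / c j) \<partial>counting) * (\<integral>\<^sup>+j. ennreal (c j) * ennreal (v t j) \<partial>counting)"
      if "\<And>j. 0 < c j" for c t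
      using half_wave_circle_esssup_le[OF g0 \<gamma>, of c t] that fin unfolding envelope[symmetric] g_def by simp
    let ?Z = "\<lambda>t. \<integral>\<^sup>+j. ennreal (2 powr (\<delta> * q1 * j) * v t j powr p) \<partial>counting"
    have Z: "(\<integral>\<^sup>+t. ?Z t \<partial>lborel) \<le> ennreal (C2 * F powr q1)"
    proof -
      have each: "(\<integral>\<^sup>+t. ennreal (2 powr (\<delta> * q1 * j) * v t j powr p) \<partial>lborel)
          \<le> ennreal (C2 * (F\<^sup>2) powr (p - 1)) * ennreal (\<epsilon> j)" for j
      proof -
        have "(\<integral>\<^sup>+t. ennreal (2 powr (\<delta> * q1 * j) * v t j powr p) \<partial>lborel)
            = ennreal (2 powr (\<delta> * q1 * j)) * (\<integral>\<^sup>+t. ennreal (v t j powr p) \<partial>lborel)"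
          by (simp add: ennreal_mult nn_integral_cmult)
        also have "\<dots> \<le> ennreal (2 powr (\<delta> * q1 * j)) * ennreal (shell_const powr p
            * freq j powr (2 * p - 1) * m j powr p / (1 - 2 powr (1 - p)))"
          unfolding v_def by (intro mult_left_mono env_Lp b freq_pos p m) simp
        also have "\<dots> = ennreal (2 powr (\<delta> * q1 * j) * (shell_const powr p * freq j powr (2 * p - 1)
            * m j powr p / (1 - 2 powr (1 - p))))"
          by (rule ennreal_mult'[symmetric]) simp
        also have "\<dots> \<le> ennreal (C2 * (F\<^sup>2) powr (p - 1) * \<epsilon> j)"
        proof (rule ennreal_leI)
          have pp: "0 < 1 - 2 powr (1 - p)" using p powr_less_one[of 2 "1 - p"] by simp
          have "m j powr p \<le> (2 powr (- 2 * \<gamma> * j) * \<epsilon> j) powr p"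
            using m p by (intro powr_mono2) auto
          also have "\<dots> = 2 powr (- 2 * \<gamma> * j * p) * (\<epsilon> j powr (p - 1) * \<epsilon> j)"
          proof -
            have "\<epsilon> j powr p = \<epsilon> j powr (p - 1) * \<epsilon> j"
              using \<epsilon>(2)[of j] by (cases "\<epsilon> j = 0") (auto simp: powr_diff)
            then show ?thesis by (simp only: powr_mult powr_powr)
          qed
          also have "\<dots> \<le> 2 powr (- 2 * \<gamma> * j * p) * ((F\<^sup>2) powr (p - 1) * \<epsilon> j)"
            using \<epsilon>[of j] p by (intro mult_left_mono mult_right_mono powr_mono2) auto
          finally have mj: "m j powr p \<le> 2 powr (- 2 * \<gamma> * j * p) * ((F\<^sup>2) powr (p - 1) * \<epsilon> j)" .
          have "2 powr (\<delta> * q1 * j) * (shell_const powr p * freq j powr (2 * p - 1)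
              * m j powr p / (1 - 2 powr (1 - p)))
             \<le> 2 powr (\<delta> * q1 * j) * (shell_const powr p * freq j powr (2 * p - 1)
               * (2 powr (- 2 * \<gamma> * j * p) * ((F\<^sup>2) powr (p - 1) * \<epsilon> j)) / (1 - 2 powr (1 - p)))"
            using pp by (intro mult_left_mono divide_right_mono mj) auto
          also have "\<dots> = (2 powr (\<delta> * q1 * j) * freq j powr (2 * p - 1) * 2 powr (- 2 * \<gamma> * j * p))
              * (shell_const powr p / (1 - 2 powr (1 - p)) * ((F\<^sup>2) powr (p - 1) * \<epsilon> j))"
            by simp
          also have "2 powr (\<delta> * q1 * j) * freq j powr (2 * p - 1) * 2 powr (- 2 * \<gamma> * j * p) = 2 powr (q1 - 1)"
          proof -
            have "\<delta> * q1 * j + (real_of_int j + 1) * (2 * p - 1) + (- 2 * \<gamma> * j * p) = q1 - 1"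
              using q1 by (simp add: \<delta>_def p_def \<gamma>_def field_simps)
            then show ?thesis by (simp only: freq_def powr_powr powr_add[symmetric])
          qed
          also have "2 powr (q1 - 1) * (shell_const powr p / (1 - 2 powr (1 - p))
              * ((F\<^sup>2) powr (p - 1) * \<epsilon> j)) = C2 * (F\<^sup>2) powr (p - 1) * \<epsilon> j"
            by (simp add: C2_def)
          finally show "2 powr (\<delta> * q1 * j) * (shell_const powr p * freq j powr (2 * p - 1)
              * m j powr p / (1 - 2 powr (1 - p))) \<le> C2 * (F\<^sup>2) powr (p - 1) * \<epsilon> j" .
        qed
        also have "\<dots> = ennreal (C2 * (F\<^sup>2) powr (p - 1)) * ennreal (\<epsilon> j)"
          by (rule ennreal_mult''[OF \<epsilon>(2)])
        finally show ?thesis .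
      qed
      have "(\<integral>\<^sup>+t. ?Z t \<partial>lborel) = (\<integral>\<^sup>+j. \<integral>\<^sup>+t. ennreal (2 powr (\<delta> * q1 * j) * v t j powr p) \<partial>lborel \<partial>counting)"
        by (rule nn_integral_CI_swap[symmetric]) measurable
      also have "\<dots> \<le> (\<integral>\<^sup>+j. ennreal (C2 * (F\<^sup>2) powr (p - 1)) * ennreal (\<epsilon> j) \<partial>counting)"
        by (intro nn_integral_mono each)
      also have "\<dots> = ennreal (C2 * (F\<^sup>2) powr (p - 1)) * ennreal (F\<^sup>2)"
        by (simp add: nn_integral_cmult sum\<epsilon>)
      also have "\<dots> = ennreal (C2 * (F\<^sup>2) powr (p - 1) * F\<^sup>2)"
        by (rule ennreal_mult''[symmetric]) simp
      also have "C2 * (F\<^sup>2) powr (p - 1) * F\<^sup>2 = C2 * F powr q1"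
      proof (cases "F = 0")
        case False
        then have "0 < F" using F0 by simp
        then have "F\<^sup>2 = F powr 2" by simp
        then have "(F\<^sup>2) powr (p - 1) * F\<^sup>2 = F powr (2 * (p - 1)) * F powr 2" by (simp only: powr_powr)
        also have "\<dots> = F powr q1" by (simp add: powr_add[symmetric] p_def algebra_simps)
        finally show ?thesis by simp
      qed simp
      finally show ?thesis .
    qed
    have main: "(\<integral>\<^sup>+t. ennpowr (?E t) (q / 2) \<partial>lborel) \<le> ennreal (C1 * C2 * F powr q)"
    proof (cases "F = 0")
      case True
      have "v t j = 0" for t j using vle[of t j] v0[of t j] True by simp
      then have "?E t \<le> 0" for t using E[of "\<lambda>j. 1" t] by simp
      then have "ennpowr (?E t) (q / 2) = 0" for t by (simp add: ennpowr_def)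
      then show ?thesis by simp
    next
      case False
      then have F: "0 < F" using F0 by simp
      have "ennpowr (?E t) (q / 2) \<le> ennreal (C1 * F powr (q - q1)) * ?Z t" for t
        unfolding C1_def \<eta>_def p_def
        by (rule hedberg_interpolation[OF q1 \<delta>_def _ F v0]) (use shell_const vle E in auto)
      then have "(\<integral>\<^sup>+t. ennpowr (?E t) (q / 2) \<partial>lborel) \<le> (\<integral>\<^sup>+t. ennreal (C1 * F powr (q - q1)) * ?Z t \<partial>lborel)"
        by (intro nn_integral_mono)
      also have "\<dots> = ennreal (C1 * F powr (q - q1)) * (\<integral>\<^sup>+t. ?Z t \<partial>lborel)"
        by (intro nn_integral_cmult borel_measurable_nn_integral_CI) measurable
      also have "\<dots> \<le> ennreal (C1 * F powr (q - q1)) * ennreal (C2 * F powr q1)"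
        by (intro mult_left_mono Z) simp
      also have "\<dots> = ennreal (C1 * F powr (q - q1) * (C2 * F powr q1))"
        using C1 C2 by (intro ennreal_mult[symmetric]) auto
      also have "C1 * F powr (q - q1) * (C2 * F powr q1) = C1 * C2 * F powr q"
        using powr_add[of F "q - q1" q1] by (simp add: mult_ac)
      finally show ?thesis .
    qed
    have "mixed_norm q UNIV (half_wave_fun f) \<le> ennpowr (ennreal (C1 * C2 * F powr q)) (1 / q)"
      unfolding mixed_norm_def using main q by (intro ennpowr_mono) simp_all
    also have "\<dots> = ennreal ((C1 * C2 * F powr q) powr (1 / q))"
      using C1 C2 by (intro ennpowr_ennreal) auto
    also have "(C1 * C2 * F powr q) powr (1 / q) = (C1 * C2) powr (1 / q) * F"
      using q F0 by (simp add: powr_mult powr_powr)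
    also have "\<dots> = (C1 * C2) powr (1 / q) * (2 * pi) * hom_sobolev_norm (1 - 1/q) f"
      by (simp add: hom_sobolev_norm_def F_def G_def g_def[symmetric] \<gamma>_def[symmetric] real_sqrt_divide
          real_sqrt_mult)
    finally show "mixed_norm q UNIV (half_wave_fun f) \<le> ennreal ((C1 * C2) powr (1 / q) * (2 * pi)
        * hom_sobolev_norm (1 - 1/q) f)" .
  qed
qed

theorem theorem1p2:
  shows "(\<forall>\<gamma>::real. \<gamma> > 1/2 \<longrightarrow>
            (\<exists>C::real. \<forall>T::real. T > 0 \<longrightarrow> (\<forall>f. sobolev \<gamma> f \<longrightarrow>
               mixed_norm 2 {0..T} (half_wave_fun f)
                 \<le> ennreal (C * (ln (2 + T)) powr (1/2) * sobolev_norm \<gamma> f))))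
       \<and> (\<forall>q::real. 2 < q \<longrightarrow>
            (\<exists>C::real. \<forall>f. hom_sobolev (1 - 1/q) f \<longrightarrow>
               mixed_norm q UNIV (half_wave_fun f)
                 \<le> ennreal (C * hom_sobolev_norm (1 - 1/q) f)))"
  using logarithmic_estimate homogeneous_estimate by blast

end
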